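(* Let $m,n\in\mathbb{N}$ with $nm>2$ and fix $\mathbf{y}\in\mathbb{R}^m$. Suppose $\pi=\{\pi_1,\dots,\pi_k\}$ is a partition of $\{1,\dots,m+n\}$ with $|\pi_j|\geq 2$ for each $j$, and suppose there exists $\ell\in\{1,\dots,k\}$ with $|\pi_\ell|\geq 3$ and $\pi_\ell\cap\{m+1,\dots,m+n\}\neq\emptyset$. If $\psi:\mathbb{N}\to\mathbb{R}_{\geq 0}$ is any function such that $\sum_{q=1}^\infty q^{n-1}\psi(q)^m$ diverges, then for almost every $\mathbf{x}\in\operatorname{Mat}_{n\times m}(\mathbb{R})$ there exist infinitely many $(\mathbf{p},\mathbf{q})\in P(\pi)$ with \[ |\mathbf{q}\mathbf{x}-\mathbf{p}-\mathbf{y}|<\psi(|\mathbf{q}|). \] Conversely, if $\sum_{q} q^{n-1}\psi(q)^m$ converges, then for almost every $\mathbf{x}\in\operatorname{Mat}_{n\times m}(\mathbb{R})$ there are only finitely many $(\mathbf{p},\mathbf{q})\in P(\pi)$ satisfying this inequality.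
   Context: Elements of $\mathbb{Z}^{m+n}=\mathbb{Z}^m\times\mathbb{Z}^n$ are written $(\mathbf{p},\mathbf{q})$; coordinates $1,\dots,m$ are those of $\mathbf{p}$ and $m+1,\dots,m+n$ those of $\mathbf{q}$. For a partition $\pi$ of $\{1,\dots,m+n\}$, $P(\pi)$ is the set of $(\mathbf{p},\mathbf{q})\in\mathbb{Z}^{m+n}$ such that for each part $\pi_j$, the gcd of the coordinates of $(\mathbf{p},\mathbf{q})$ with indices in $\pi_j$ equals $1$. $\mathbf{q}$ is a row vector, so $\mathbf{q}\mathbf{x}\in\mathbb{R}^m$. $|\cdot|$ is the maximum norm. "Almost every" refers to Lebesgue measure. *)

theory Defs
  imports "HOL-Analysis.Analysis"
begin

text \<open>
  The coordinate set \<open>{1,\<dots>,m+n}\<close> is modelled by the sum type \<open>'m + 'n\<close>, with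
  \<open>m = CARD('m)\<close> and \<open>n = CARD('n)\<close>: \<open>Inl i\<close> indexes the coordinates of \<open>\<^bold>p\<close> and
  \<open>Inr j\<close> those of \<open>\<^bold>q\<close>.
\<close>

definition coord :: "(int ^ 'm) \<times> (int ^ 'n) \<Rightarrow> 'm + 'n \<Rightarrow> int" where
  "coord v = case_sum (($) (fst v)) (($) (snd v))"

definition coprime_on_parts :: "('m + 'n) set set \<Rightarrow> ((int ^ 'm) \<times> (int ^ 'n)) set" where
  "coprime_on_parts \<pi> = {v. \<forall>A\<in>\<pi>. Gcd (coord v ` A) = 1}"

definition real_vec :: "int ^ 'k \<Rightarrow> real ^ 'k" where
  "real_vec v = (\<chi> i. real_of_int (v $ i))"

text \<open>The maximum norm of an integer vector as a natural number, so that \<open>\<psi>\<close> can be applied to it;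
  on real vectors the maximum norm is \<^const>\<open>infnorm\<close>.\<close>

definition max_norm :: "int ^ 'k \<Rightarrow> nat" where
  "max_norm v = Max (range (\<lambda>i. nat \<bar>v $ i\<bar>))"

definition solutions ::
  "('m + 'n) set set \<Rightarrow> real ^ 'm \<Rightarrow> (nat \<Rightarrow> real) \<Rightarrow> real ^ 'm ^ 'n \<Rightarrow> ((int ^ 'm) \<times> (int ^ 'n)) set"
where
  "solutions \<pi> y \<psi> x =
     {(p, q) \<in> coprime_on_parts \<pi>. infnorm (real_vec q v* x - real_vec p - y) < \<psi> (max_norm q)}"

end

theory Submission
  imports Defs
begin

text \<open>
  The divergence half is a second moment argument. Fix an index \<open>j\<close> of a coordinate of \<open>q\<close> in the part with
  at least three elements and use only the \<open>q\<close> with \<open>q\<^sub>j = k\<close> and all other coordinates in \<open>{1..k}\<close>.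
  Linearly independent \<open>q, q'\<close> give exactly independent events on the torus; a parallel pair
  \<open>q = d v\<close>, \<open>q' = e v\<close> with \<open>d, e\<close> coprime has an excess \<open>(\<psi> / d)^m\<close>, and the sum of these is
  controlled by \<open>\<Sum> d^(2 - m - n)\<close>, which is where \<open>n m > 2\<close>, that is \<open>m + n \<ge> 4\<close>, enters. So the
  counting functions \<open>F\<^sub>N\<close>, divided by the partial sums \<open>S\<^sub>N\<close> of the series, are bounded in \<open>L\<^sup>2\<close>.
  The coprimality conditions cost only a constant factor of the first moment on every small cube, because each
  part keeps two coordinates besides \<open>q\<^sub>j\<close>. If the set without large solutions had positive measure, it
  would contain a compact set \<open>K\<close> that fills almost all of an open set \<open>U\<close>; the first moment forces
  \<open>F\<^sub>N / S\<^sub>N\<close> to have mass comparable to the measure of \<open>K\<close> on \<open>U\<close>, whereas \<open>L\<^sup>2\<close>-boundedness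
  makes the mass on \<open>U - K\<close> small and the mass on \<open>K\<close> tends to \<open>0\<close>.
\<close>

subsection \<open>Periodic functions on the torus\<close>

text \<open>The gcd conditions couple \<open>p\<close> and \<open>q\<close>: replacing
  \<open>x\<close> by \<open>x + z\<close> with \<open>z\<close> integral moves \<open>p\<close> by
  integer combinations of the entries of \<open>q\<close>. The set of \<open>x\<close> with
  infinitely many solutions is therefore not visibly periodic, and zero-one laws for periodic limsup
  sets give nothing directly. This is why the lower bound for the first moment is local, with the
  same constant for every small cube: any set of positive measure then yields a contradiction. Upper
  bounds tolerate dropping coprimality, so second moments are computed for the periodic count of all
  \<open>p\<close>, where one unit cube suffices; only the first moment sees coprime points. The
  entry \<open>j\<close> of \<open>q\<close> equals \<open>k\<close> and cannot be sieved, so in its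
  part the gcd is controlled by the other coordinates; two of them in each part produce
  \<open>1 / l^2\<close> for a prime \<open>l\<close>, which is summable. The order of choices
  matters: the proportion \<open>c\<close> is built from \<open>\<pi>\<close>, m and n, the open set
  is fitted to \<open>c\<close>, the cube size to the open set, and the threshold for
  \<open>k\<close> comes last.\<close>

definition int_lattice :: "'a::euclidean_space set" where
  "int_lattice = {z. \<forall>b\<in>Basis. z \<bullet> b \<in> \<int>}"

definition unit_cube :: "'a::euclidean_space set" where
  "unit_cube = {x. \<forall>b\<in>Basis. 0 \<le> x \<bullet> b \<and> x \<bullet> b < 1}"

definition lattice_periodic :: "('a::euclidean_space \<Rightarrow> 'b) \<Rightarrow> bool" where
  "lattice_periodic f \<longleftrightarrow> (\<forall>x. \<forall>z\<in>int_lattice. f (x + z) = f x)"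

lemma int_lattice_uminus: "z \<in> int_lattice \<Longrightarrow> - z \<in> int_lattice"
  by (auto simp: int_lattice_def)

lemma countable_int_lattice: "countable (int_lattice :: 'a::euclidean_space set)"
proof -
  have "(int_lattice :: 'a set) \<subseteq> (\<lambda>f. \<Sum>b\<in>Basis. of_int (f b) *\<^sub>R b) ` (Basis \<rightarrow>\<^sub>E (UNIV :: int set))"
  proof
    fix z :: 'a assume z: "z \<in> int_lattice"
    define f where "f = (\<lambda>b\<in>Basis. \<lfloor>z \<bullet> b\<rfloor>)"
    have "(\<Sum>b\<in>Basis. of_int (f b) *\<^sub>R b) = (\<Sum>b\<in>Basis. (z \<bullet> b) *\<^sub>R b)"
      using z by (intro sum.cong) (auto simp: f_def int_lattice_def)
    then have "z = (\<Sum>b\<in>Basis. of_int (f b) *\<^sub>R b)" by (simp add: euclidean_representation)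
    moreover have "f \<in> Basis \<rightarrow>\<^sub>E UNIV" by (auto simp: f_def)
    ultimately show "z \<in> (\<lambda>f. \<Sum>b\<in>Basis. of_int (f b) *\<^sub>R b) ` (Basis \<rightarrow>\<^sub>E (UNIV :: int set))"
      by blast
  qed
  moreover have "countable (Basis \<rightarrow>\<^sub>E (UNIV :: int set) :: ('a \<Rightarrow> int) set)"
    by (intro countable_PiE) auto
  ultimately show ?thesis by (meson countable_image countable_subset)
qed

lemma unit_cube_borel [measurable]: "(unit_cube :: 'a::euclidean_space set) \<in> sets borel"
proof -
  have "(unit_cube :: 'a set) = (\<Inter>b\<in>Basis. {x. 0 \<le> x \<bullet> b} \<inter> {x. x \<bullet> b < 1})"
    by (auto simp: unit_cube_def)
  also have "\<dots> \<in> sets borel"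
    by (intro sets.finite_INT) auto
  finally show ?thesis .
qed

lemma ex1_lattice_translate:
  fixes x :: "'a::euclidean_space"
  shows "\<exists>!z. z \<in> int_lattice \<and> x + z \<in> unit_cube"
proof
  let ?z = "- (\<Sum>b\<in>Basis. of_int \<lfloor>x \<bullet> b\<rfloor> *\<^sub>R b) :: 'a"
  have z: "?z \<bullet> b = - of_int \<lfloor>x \<bullet> b\<rfloor>" if "b \<in> Basis" for b
    using that by simp
  show "?z \<in> int_lattice \<and> x + ?z \<in> unit_cube"
    by (auto simp: int_lattice_def unit_cube_def inner_diff_left) linarith
  fix z assume A: "z \<in> int_lattice \<and> x + z \<in> unit_cube"
  show "z = ?z"
  proof (rule euclidean_eqI)
    fix b :: 'a assume b: "b \<in> Basis"
    obtain k where k: "z \<bullet> b = of_int k" using A b by (auto simp: int_lattice_def elim: Ints_cases)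
    have "0 \<le> x \<bullet> b + of_int k" "x \<bullet> b + of_int k < 1"
      using A b by (auto simp: unit_cube_def inner_left_distrib simp flip: k)
    then have "k = - \<lfloor>x \<bullet> b\<rfloor>" by linarith
    then show "z \<bullet> b = ?z \<bullet> b" using z[OF b] k by simp
  qed
qed

text \<open>A partition of unity, written as an integral over counting measure so that it can be
  exchanged with Lebesgue integrals.\<close>

lemma sum_lattice_translates:
  fixes x :: "'a::euclidean_space"
  shows "(\<integral>\<^sup>+z. indicator unit_cube (x + z) \<partial>count_space int_lattice) = 1"
proof -
  obtain z0 where z0: "z0 \<in> int_lattice" "x + z0 \<in> unit_cube"
    and un: "\<And>z. z \<in> int_lattice \<Longrightarrow> x + z \<in> unit_cube \<Longrightarrow> z = z0"
    using ex1_lattice_translate[of x] by blast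
  have "(\<integral>\<^sup>+z. indicator unit_cube (x + z) \<partial>count_space int_lattice) = (\<Sum>z\<in>{z0}. indicator unit_cube (x + z) :: ennreal)"
    by (rule nn_integral_count_space') (use z0 in \<open>auto simp: indicator_def dest: un\<close>)
  then show ?thesis using z0 by simp
qed

lemma sum_lattice_translates_minus:
  fixes x :: "'a::euclidean_space"
  shows "(\<integral>\<^sup>+z. indicator unit_cube (x - z) \<partial>count_space int_lattice) = 1"
proof -
  have "bij_betw uminus (int_lattice :: 'a set) int_lattice"
    by (rule bij_betwI[where g=uminus]) (auto simp: int_lattice_uminus)
  from nn_integral_bij_count_space[OF this, of "\<lambda>z. indicator unit_cube (x + z)"]
  show ?thesis using sum_lattice_translates[of x] by simp
qed

lemma nn_integral_lborel_shift:
  fixes f :: "'a::euclidean_space \<Rightarrow> ennreal"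
  assumes [measurable]: "f \<in> borel_measurable borel"
  shows "(\<integral>\<^sup>+x. f (x + w) \<partial>lborel) = (\<integral>\<^sup>+x. f x \<partial>lborel)"
proof -
  have "(\<integral>\<^sup>+x. f x \<partial>lborel) = (\<integral>\<^sup>+x. f x \<partial>distr lborel borel ((+) w))"
    by (simp add: lborel_distr_plus)
  also have "\<dots> = (\<integral>\<^sup>+x. f (w + x) \<partial>lborel)" by (subst nn_integral_distr) auto
  finally show ?thesis by (simp add: add.commute)
qed

text \<open>Inserting the partition of unity by the functions
  \<open>indicator unit_cube (x - z)\<close> and exchanging sum and integral cuts space into
  translates of the unit cube; each piece is then moved back by \<open>z\<close>.\<close>

lemma nn_integral_lattice_unfold:
  fixes f :: "'a::euclidean_space \<Rightarrow> ennreal"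
  assumes [measurable]: "f \<in> borel_measurable borel"
  shows "(\<integral>\<^sup>+x. f x \<partial>lborel) =
    (\<integral>\<^sup>+z. (\<integral>\<^sup>+x. f (x + z) * indicator unit_cube x \<partial>lborel) \<partial>count_space int_lattice)"
proof -
  have "(\<integral>\<^sup>+x. f x \<partial>lborel) = (\<integral>\<^sup>+x. (\<integral>\<^sup>+z. f x * indicator unit_cube (x - z) \<partial>count_space int_lattice) \<partial>lborel)"
    by (simp add: nn_integral_cmult sum_lattice_translates_minus)
  also have "\<dots> = (\<integral>\<^sup>+z. (\<integral>\<^sup>+x. f x * indicator unit_cube (x - z) \<partial>lborel) \<partial>count_space int_lattice)"
    by (rule nn_integral_count_space_nn_integral[OF countable_int_lattice]) measurable
  also have "\<dots> = (\<integral>\<^sup>+z. (\<integral>\<^sup>+x. f (x + z) * indicator unit_cube x \<partial>lborel) \<partial>count_space int_lattice)"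
  proof (rule nn_integral_cong)
    fix z :: 'a
    show "(\<integral>\<^sup>+x. f x * indicator unit_cube (x - z) \<partial>lborel) = (\<integral>\<^sup>+x. f (x + z) * indicator unit_cube x \<partial>lborel)"
      using nn_integral_lborel_shift[of "\<lambda>x. f x * indicator unit_cube (x - z)" z] by simp
  qed
  finally show ?thesis .
qed

text \<open>The shifted cube is cut along the lattice and reassembled: after unfolding, periodicity
  frees \<open>f\<close> from \<open>z\<close>, and the remaining sum of
  \<open>indicator unit_cube (x - w + z)\<close> over \<open>z\<close> is 1.\<close>

lemma nn_integral_periodic_shift:
  fixes f :: "'a::euclidean_space \<Rightarrow> ennreal"
  assumes [measurable]: "f \<in> borel_measurable borel" and per: "lattice_periodic f"
  shows "(\<integral>\<^sup>+x. f (x + w) * indicator unit_cube x \<partial>lborel) = (\<integral>\<^sup>+x. f x * indicator unit_cube x \<partial>lborel)"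
proof -
  have "(\<integral>\<^sup>+x. f (x + w) * indicator unit_cube x \<partial>lborel) = (\<integral>\<^sup>+x. f x * indicator unit_cube (x - w) \<partial>lborel)"
    using nn_integral_lborel_shift[of "\<lambda>x. f x * indicator unit_cube (x - w)" w] by simp
  also have "\<dots> = (\<integral>\<^sup>+z. (\<integral>\<^sup>+x. f (x + z) * indicator unit_cube (x + z - w) * indicator unit_cube x \<partial>lborel) \<partial>count_space int_lattice)"
    by (rule nn_integral_lattice_unfold) measurable
  also have "\<dots> = (\<integral>\<^sup>+z. (\<integral>\<^sup>+x. f x * indicator unit_cube x * indicator unit_cube (x - w + z) \<partial>lborel) \<partial>count_space int_lattice)"
  proof (intro nn_integral_cong)
    fix z x :: 'a assume "z \<in> space (count_space int_lattice)"
    then have "f (x + z) = f x" using per by (auto simp: lattice_periodic_def)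
    then show "f (x + z) * indicator unit_cube (x + z - w) * indicator unit_cube x =
        f x * indicator unit_cube x * indicator unit_cube (x - w + z)"
      by (simp add: mult_ac diff_add_eq)
  qed
  also have "\<dots> = (\<integral>\<^sup>+x. (\<integral>\<^sup>+z. f x * indicator unit_cube x * indicator unit_cube (x - w + z) \<partial>count_space int_lattice) \<partial>lborel)"
    by (rule nn_integral_count_space_nn_integral[OF countable_int_lattice, symmetric]) measurable
  also have "\<dots> = (\<integral>\<^sup>+x. f x * indicator unit_cube x \<partial>lborel)"
    by (simp add: nn_integral_cmult sum_lattice_translates)
  finally show ?thesis .
qed

lemma emeasure_unit_cube: "emeasure lborel (unit_cube :: 'a::euclidean_space set) = 1"
proof (rule antisym)
  have "box 0 One \<subseteq> (unit_cube :: 'a set)" by (auto simp: unit_cube_def box_def less_imp_le)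
  then have "emeasure lborel (box 0 One :: 'a set) \<le> emeasure lborel (unit_cube :: 'a set)"
    by (intro emeasure_mono) auto
  then show "1 \<le> emeasure lborel (unit_cube :: 'a set)" by simp
  have "unit_cube \<subseteq> (cbox 0 One :: 'a set)" by (auto simp: unit_cube_def cbox_def less_imp_le)
  then have "emeasure lborel (unit_cube :: 'a set) \<le> emeasure lborel (cbox 0 One :: 'a set)"
    by (intro emeasure_mono) auto
  then show "emeasure lborel (unit_cube :: 'a set) \<le> 1" by simp
qed

text \<open>The integral of \<open>\<Phi> (L x + c)\<close> over the torus does not depend on \<open>c\<close>, because a translation of
  \<open>x\<close> realises every \<open>c\<close>; averaging over \<open>c\<close> then replaces it by the integral of \<open>\<Phi>\<close>.\<close>

lemma nn_integral_torus_map: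
  fixes L :: "'a::euclidean_space \<Rightarrow> 'b::euclidean_space" and \<Phi> :: "'b \<Rightarrow> ennreal"
  assumes L: "linear L" "surj L" "\<And>z. z \<in> int_lattice \<Longrightarrow> L z \<in> int_lattice"
    and [measurable]: "\<Phi> \<in> borel_measurable borel" and per: "lattice_periodic \<Phi>"
  shows "(\<integral>\<^sup>+x. \<Phi> (L x) * indicator unit_cube x \<partial>lborel) = (\<integral>\<^sup>+u. \<Phi> u * indicator unit_cube u \<partial>lborel)"
proof -
  have [measurable]: "L \<in> borel_measurable borel"
    using L(1) by (intro borel_measurable_continuous_onI linear_continuous_on) (simp add: linear_conv_bounded_linear)
  have const: "(\<integral>\<^sup>+x. \<Phi> (L x + c) * indicator unit_cube x \<partial>lborel) = (\<integral>\<^sup>+x. \<Phi> (L x) * indicator unit_cube x \<partial>lborel)" for c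
  proof -
    obtain w where w: "L w = c" using L(2) by (metis surjD)
    have "lattice_periodic (\<lambda>x. \<Phi> (L x))"
      using per L by (auto simp: lattice_periodic_def linear_add)
    from nn_integral_periodic_shift[OF _ this, of w] show ?thesis
      using L(1) by (simp add: linear_add w)
  qed
  have "(\<integral>\<^sup>+x. \<Phi> (L x) * indicator unit_cube x \<partial>lborel) =
     (\<integral>\<^sup>+c. (\<integral>\<^sup>+x. \<Phi> (L x + c) * indicator unit_cube x \<partial>lborel) * indicator unit_cube (c::'b) \<partial>lborel)"
    by (simp add: const nn_integral_cmult emeasure_unit_cube)
  also have "\<dots> = (\<integral>\<^sup>+c. (\<integral>\<^sup>+x. \<Phi> (L x + c) * indicator unit_cube x * indicator unit_cube c \<partial>lborel) \<partial>lborel)"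
    by (simp add: nn_integral_multc)
  also have "\<dots> = (\<integral>\<^sup>+x. (\<integral>\<^sup>+c. \<Phi> (L x + c) * indicator unit_cube x * indicator unit_cube c \<partial>lborel) \<partial>lborel)"
    by (rule lborel_pair.Fubini') measurable
  also have "\<dots> = (\<integral>\<^sup>+x. (\<integral>\<^sup>+c. \<Phi> (c + L x) * indicator unit_cube c \<partial>lborel) * indicator unit_cube x \<partial>lborel)"
    by (simp add: mult_ac nn_integral_cmult add.commute)
  also have "\<dots> = (\<integral>\<^sup>+x. (\<integral>\<^sup>+c. \<Phi> c * indicator unit_cube c \<partial>lborel) * indicator unit_cube (x :: 'a) \<partial>lborel)"
    by (simp add: nn_integral_periodic_shift[OF _ per])
  also have "\<dots> = (\<integral>\<^sup>+c. \<Phi> c * indicator unit_cube c \<partial>lborel)"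
    by (simp add: nn_integral_cmult emeasure_unit_cube)
  finally show ?thesis .
qed

subsection \<open>Integer points near a vector\<close>

lemma card_vec_product:
  fixes W :: "'k::finite \<Rightarrow> 'a set"
  shows "card {v :: 'a ^ 'k. \<forall>i. v $ i \<in> W i} = (\<Prod>i\<in>UNIV. card (W i))"
proof -
  have "bij_betw vec_nth {v :: 'a ^ 'k. \<forall>i. v $ i \<in> W i} (PiE UNIV W)"
    by (rule bij_betwI[where g=vec_lambda]) auto
  then have "card {v :: 'a ^ 'k. \<forall>i. v $ i \<in> W i} = card (PiE UNIV W)"
    by (rule bij_betw_same_card)
  also have "\<dots> = (\<Prod>i\<in>UNIV. card (W i))" by (rule card_PiE) simp
  finally show ?thesis .
qed

lemma finite_vec_product:
  fixes W :: "'k::finite \<Rightarrow> 'a set"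
  assumes "\<And>i. finite (W i)"
  shows "finite {v :: 'a ^ 'k. \<forall>i. v $ i \<in> W i}"
proof -
  have "{v :: 'a ^ 'k. \<forall>i. v $ i \<in> W i} \<subseteq> vec_lambda ` (PiE UNIV W)"
    by (auto intro!: image_eqI[where x="vec_nth _"])
  moreover have "finite (PiE UNIV W)" by (intro finite_PiE) (auto simp: assms)
  ultimately show ?thesis by (meson finite_imageI finite_subset)
qed

section \<open>Max-norm balls: volumes and integer points\<close>

lemma infnorm_less_iff:
  fixes x :: "'a::euclidean_space"
  shows "infnorm x < r \<longleftrightarrow> (\<forall>b\<in>Basis. \<bar>x \<bullet> b\<bar> < r)"
  by (subst infnorm_Max) (subst Max_less_iff, auto)

lemma infnorm_le_iff:
  fixes x :: "'a::euclidean_space"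
  shows "infnorm x \<le> r \<longleftrightarrow> (\<forall>b\<in>Basis. \<bar>x \<bullet> b\<bar> \<le> r)"
  by (subst infnorm_Max) (subst Max_le_iff, auto)

lemma infnorm_less_iff_cart: "infnorm (x :: real ^ 'm) < r \<longleftrightarrow> (\<forall>i. \<bar>x $ i\<bar> < r)"
  by (auto simp: infnorm_less_iff Basis_vec_def inner_axis)

lemma infnorm_le_iff_cart: "infnorm (x :: real ^ 'm) \<le> r \<longleftrightarrow> (\<forall>i. \<bar>x $ i\<bar> \<le> r)"
  by (auto simp: infnorm_le_iff Basis_vec_def inner_axis)

lemma borel_measurable_infnorm [measurable]:
  "(infnorm :: 'a::euclidean_space \<Rightarrow> real) \<in> borel_measurable borel"
  by (intro borel_measurable_continuous_onI continuous_intros)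

lemma infnorm_ball_eq_box:
  fixes c :: "'a::euclidean_space"
  shows "{x. infnorm (x - c) < r} = box (c - r *\<^sub>R One) (c + r *\<^sub>R One)"
  by (auto simp: infnorm_less_iff box_def inner_diff_left inner_add_left abs_less_iff field_simps)

lemma infnorm_cball_eq_cbox:
  fixes c :: "'a::euclidean_space"
  shows "{x. infnorm (x - c) \<le> r} = cbox (c - r *\<^sub>R One) (c + r *\<^sub>R One)"
  by (auto simp: infnorm_le_iff cbox_def inner_diff_left inner_add_left abs_le_iff field_simps)

lemma emeasure_infnorm_ball:
  fixes c :: "'a::euclidean_space"
  assumes "0 \<le> r"
  shows "emeasure lborel {x. infnorm (x - c) < r} = ennreal ((2 * r) ^ DIM('a))"
  using assms by (simp add: infnorm_ball_eq_box emeasure_lborel_box_eq inner_diff_left inner_add_left)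

lemma emeasure_infnorm_cball:
  fixes c :: "'a::euclidean_space"
  assumes "0 \<le> r"
  shows "emeasure lborel {x. infnorm (x - c) \<le> r} = ennreal ((2 * r) ^ DIM('a))"
  using assms by (simp add: infnorm_cball_eq_cbox emeasure_lborel_cbox_eq inner_diff_left inner_add_left)

lemma nn_integral_scaled_infnorm_ball:
  fixes c :: "'a::euclidean_space"
  assumes "0 \<le> r" "0 < d"
  shows "(\<integral>\<^sup>+x. indicator {..<r} (infnorm (d *\<^sub>R x - c)) \<partial>lborel) = ennreal ((2 * r / d) ^ DIM('a))"
proof -
  have eq: "infnorm (d *\<^sub>R x - c) < r \<longleftrightarrow> infnorm (x - c /\<^sub>R d) < r / d" for x
  proof -
    have "d *\<^sub>R x - c = d *\<^sub>R (x - c /\<^sub>R d)" using assms by (simp add: algebra_simps)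
    then have "infnorm (d *\<^sub>R x - c) = d * infnorm (x - c /\<^sub>R d)" using assms by (metis abs_of_pos infnorm_mul)
    then show ?thesis using assms by (simp add: field_simps)
  qed
  have "(\<integral>\<^sup>+x. indicator {..<r} (infnorm (d *\<^sub>R x - c)) \<partial>lborel) =
     (\<integral>\<^sup>+x. indicator {x. infnorm (x - c /\<^sub>R d) < r / d} x \<partial>lborel)"
    by (intro nn_integral_cong) (auto simp: indicator_def eq)
  also have "\<dots> = emeasure lborel {x. infnorm (x - c /\<^sub>R d) < r / d}"
    by (rule nn_integral_indicator) (simp add: infnorm_ball_eq_box)
  finally show ?thesis using assms by (simp add: emeasure_infnorm_ball)
qed

lemma card_int_near_le:
  fixes c t :: real
  assumes "0 \<le> t"
  shows "finite {a::int. \<bar>of_int a - c\<bar> < t}" "real (card {a::int. \<bar>of_int a - c\<bar> < t}) \<le> 2 * t + 1"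
proof -
  have sub: "{a::int. \<bar>of_int a - c\<bar> < t} \<subseteq> {\<lfloor>c - t\<rfloor> + 1..\<lceil>c + t\<rceil> - 1}"
    by auto linarith+
  then show "finite {a::int. \<bar>of_int a - c\<bar> < t}" by (rule finite_subset) simp
  show "real (card {a::int. \<bar>of_int a - c\<bar> < t}) \<le> 2 * t + 1"
  proof (cases "{a::int. \<bar>of_int a - c\<bar> < t} = {}")
    case True
    then show ?thesis using assms by (metis add_nonneg_nonneg card.empty mult_nonneg_nonneg of_nat_0 zero_le_numeral zero_le_one)
  next
    case False
    \<comment> \<open>A witness makes the length of the integer interval nonnegative, so that
      \<open>nat\<close> can be removed below.\<close>
    then obtain a :: int where a: "\<bar>of_int a - c\<bar> < t" by auto
    have "card {a::int. \<bar>of_int a - c\<bar> < t} \<le> card {\<lfloor>c - t\<rfloor> + 1..\<lceil>c + t\<rceil> - 1}"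
      by (rule card_mono[OF _ sub]) simp
    also have "\<dots> = nat (\<lceil>c + t\<rceil> - 1 - \<lfloor>c - t\<rfloor>)" by simp
    finally have "real (card {a::int. \<bar>of_int a - c\<bar> < t}) \<le> real (nat (\<lceil>c + t\<rceil> - 1 - \<lfloor>c - t\<rfloor>))" by simp
    also have "\<dots> = of_int (\<lceil>c + t\<rceil> - 1 - \<lfloor>c - t\<rfloor>)"
    proof -
      have "\<lfloor>c - t\<rfloor> \<le> a" "a \<le> \<lceil>c + t\<rceil> - 1" using a by linarith+
      then show ?thesis by simp
    qed
    also have "\<dots> \<le> 2 * t + 1" by linarith
    finally show ?thesis .
  qed
qed

lemma card_int_vec_near_le:
  fixes c :: "real ^ 'm"
  assumes t: "0 \<le> t"
  shows "finite {a :: int ^ 'm. infnorm (real_vec a - c) < t}"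
    "real (card {a :: int ^ 'm. infnorm (real_vec a - c) < t}) \<le> (2 * t + 1) ^ CARD('m)"
proof -
  have eq: "{a :: int ^ 'm. infnorm (real_vec a - c) < t} = {a. \<forall>i. a $ i \<in> {k. \<bar>of_int k - c $ i\<bar> < t}}"
    by (auto simp: infnorm_less_iff_cart real_vec_def)
  show "finite {a :: int ^ 'm. infnorm (real_vec a - c) < t}"
    unfolding eq by (intro finite_vec_product card_int_near_le t)
  have "real (card {a :: int ^ 'm. infnorm (real_vec a - c) < t}) = (\<Prod>i\<in>UNIV. real (card {k. \<bar>of_int k - c $ i\<bar> < t}))"
    unfolding eq card_vec_product by simp
  also have "\<dots> \<le> (\<Prod>i\<in>(UNIV :: 'm set). 2 * t + 1)"
    by (intro prod_mono conjI card_int_near_le t) simp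
  finally show "real (card {a :: int ^ 'm. infnorm (real_vec a - c) < t}) \<le> (2 * t + 1) ^ CARD('m)"
    by simp
qed

section \<open>Integer vectors as lattice points, and the periodised ball\<close>

lemma real_vec_add: "real_vec (a + b) = real_vec a + real_vec b"
  and real_vec_minus: "real_vec (- a) = - real_vec a"
  and real_vec_diff: "real_vec (a - b) = real_vec a - real_vec b"
  and real_vec_smult: "real_vec (k *s a) = of_int k *\<^sub>R real_vec a"
  by (simp_all add: real_vec_def vec_eq_iff)

lemma inj_real_vec: "inj real_vec"
  by (auto simp: inj_def real_vec_def vec_eq_iff)

lemma int_lattice_cart: "z \<in> int_lattice \<longleftrightarrow> (\<forall>i. (z :: real ^ 'm) $ i \<in> \<int>)"
  by (auto simp: int_lattice_def Basis_vec_def inner_axis)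

lemma bij_real_vec: "bij_betw real_vec UNIV (int_lattice :: (real ^ 'm) set)"
proof -
  have "z \<in> range real_vec" if "z \<in> int_lattice" for z :: "real ^ 'm"
  proof
    show "z = real_vec (\<chi> i. \<lfloor>z $ i\<rfloor>)"
      using that by (auto simp: int_lattice_cart real_vec_def vec_eq_iff)
  qed auto
  moreover have "real_vec p \<in> int_lattice" for p :: "int ^ 'm"
    by (auto simp: int_lattice_cart real_vec_def)
  ultimately show ?thesis using inj_real_vec by (auto simp: bij_betw_def)
qed

text \<open>The periodisation of the indicator of the ball of radius \<open>r\<close> around
  \<open>y\<close>. An extended nonnegative integral over counting measure is used instead of a
  cardinality, so that it can be exchanged with Lebesgue integrals; finiteness is established
  separately.\<close>

definition near_count :: "real ^ 'm \<Rightarrow> real \<Rightarrow> real ^ 'm \<Rightarrow> ennreal" where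
  "near_count y r u = (\<integral>\<^sup>+p. indicator {..<r} (infnorm (u - real_vec p - y)) \<partial>count_space UNIV)"

lemma borel_measurable_nn_integral_countable:
  fixes f :: "'b::countable \<Rightarrow> 'a \<Rightarrow> ennreal"
  assumes "\<And>p. f p \<in> borel_measurable M"
  shows "(\<lambda>x. \<integral>\<^sup>+p. f p x \<partial>count_space A) \<in> borel_measurable M"
proof -
  interpret sigma_finite_measure "count_space A"
    by (rule sigma_finite_measure_count_space_countable) simp
  have "(\<lambda>(x, p). f p x) \<in> borel_measurable (M \<Otimes>\<^sub>M count_space A)"
    by (subst measurable_pair_swap_iff, simp add: split_beta', rule measurable_pair_measure_countable1)
      (auto simp: assms)
  then show ?thesis by (rule borel_measurable_nn_integral)
qed

lemma near_count_measurable [measurable]: "near_count y r \<in> borel_measurable borel"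
  unfolding near_count_def by (rule borel_measurable_nn_integral_countable) measurable

lemma near_count_add_int: "near_count y r (u + real_vec z) = near_count y r u"
proof -
  have "bij_betw (\<lambda>p. p + z) UNIV UNIV" by (rule bij_betwI[where g="\<lambda>p. p - z"]) auto
  from nn_integral_bij_count_space[OF this, of "\<lambda>p. indicator {..<r} (infnorm (u + real_vec z - real_vec p - y))"]
  show ?thesis by (simp add: near_count_def real_vec_add)
qed

lemma periodic_near_count: "lattice_periodic (near_count y r)"
  unfolding lattice_periodic_def
  using near_count_add_int bij_real_vec by (metis bij_betw_imp_surj_on rangeE)

lemma nn_integral_lattice_unfold_vec:
  fixes f :: "real ^ 'm \<Rightarrow> ennreal"
  assumes [measurable]: "f \<in> borel_measurable borel"
  shows "(\<integral>\<^sup>+x. f x \<partial>lborel) = (\<integral>\<^sup>+p. (\<integral>\<^sup>+x. f (x - real_vec p) * indicator unit_cube x \<partial>lborel) \<partial>count_space UNIV)"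
proof -
  have "bij_betw (\<lambda>p :: int ^ 'm. - p) UNIV UNIV" by (rule bij_betwI[where g=uminus]) auto
  then have "bij_betw (real_vec \<circ> uminus) UNIV (int_lattice :: (real ^ 'm) set)"
    by (rule bij_betw_trans[OF _ bij_real_vec])
  from nn_integral_bij_count_space[OF this, of "\<lambda>z. (\<integral>\<^sup>+x. f (x + z) * indicator unit_cube x \<partial>lborel)"]
  show ?thesis by (simp add: nn_integral_lattice_unfold[OF assms] real_vec_minus)
qed

text \<open>Unfolding reassembles the translates into a single ball in the whole space. Overlapping
  translates are counted with multiplicity, so the volume formula stays exact for large
  \<open>r\<close>.\<close>

lemma nn_integral_near_count:
  fixes y :: "real ^ 'm"
  assumes "0 \<le> r"
  shows "(\<integral>\<^sup>+u. near_count y r u * indicator unit_cube u \<partial>lborel) = ennreal ((2 * r) ^ CARD('m))"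
proof -
  have "(\<integral>\<^sup>+u. near_count y r u * indicator unit_cube u \<partial>lborel) =
    (\<integral>\<^sup>+u. (\<integral>\<^sup>+p. indicator {..<r} (infnorm (u - real_vec p - y)) * indicator unit_cube u \<partial>count_space UNIV) \<partial>lborel)"
    by (simp add: near_count_def nn_integral_multc)
  also have "\<dots> = (\<integral>\<^sup>+p. (\<integral>\<^sup>+u. indicator {..<r} (infnorm (u - real_vec p - y)) * indicator unit_cube u \<partial>lborel) \<partial>count_space UNIV)"
    by (rule nn_integral_count_space_nn_integral) auto
  also have "\<dots> = (\<integral>\<^sup>+u. indicator {..<r} (infnorm (u - y)) \<partial>lborel)"
    by (rule nn_integral_lattice_unfold_vec[symmetric]) measurable
  also have "\<dots> = ennreal ((2 * r) ^ CARD('m))"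
    using nn_integral_scaled_infnorm_ball[OF assms, of 1 y] by simp
  finally show ?thesis .
qed

lemma finite_near:
  fixes y u :: "real ^ 'm"
  shows "finite {p. infnorm (u - real_vec p - y) < r}"
proof (cases "0 \<le> r")
  case True
  have "infnorm (u - real_vec p - y) = infnorm (real_vec p - (u - y))" for p :: "int ^ 'm"
    by (subst infnorm_sub) (simp add: algebra_simps)
  then show ?thesis using card_int_vec_near_le(1)[OF True, of "u - y"] by simp
next
  case False
  then have "{p. infnorm (u - real_vec p - y) < r} = {}"
    using infnorm_pos_le by (metis (no_types, lifting) Collect_empty_eq order.strict_trans1 less_eq_real_def)
  then show ?thesis by (metis finite.emptyI)
qed

lemma near_count_eq_card: "near_count y r u = of_nat (card {p. infnorm (u - real_vec p - y) < r})"
proof -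
  have "near_count y r u = (\<Sum>p\<in>{p. infnorm (u - real_vec p - y) < r}. indicator {..<r} (infnorm (u - real_vec p - y)))"
    unfolding near_count_def by (rule nn_integral_count_space'[OF finite_near]) auto
  then show ?thesis by simp
qed

text \<open>A pair \<open>(\<rho>, p)\<close> counted on the left is encoded by the integer vector
  \<open>e \<rho> - d p\<close>. Coprimality of \<open>d\<close> and \<open>e\<close> recovers
  \<open>\<rho>\<close> modulo \<open>d\<close>, hence \<open>\<rho>\<close> itself, and the vector
  lies within \<open>d s\<close> of the point \<open>d (y - w)\<close>. All residues together thus
  cost a single count of integer points in a cube of side \<open>2 d s\<close>.\<close>

lemma sum_residues_near_count_le:
  fixes y w :: "real ^ 'm" and d e :: nat
  assumes "0 \<le> s" "0 < d" "coprime d e"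
  shows "(\<Sum>\<rho> | \<forall>i. \<rho> $ i \<in> {0..<int d}. near_count y s (w + (real e / real d) *\<^sub>R real_vec \<rho>))
    \<le> ennreal ((2 * real d * s + 1) ^ CARD('m))"
proof -
  define R where "R = {\<rho> :: int ^ 'm. \<forall>i. \<rho> $ i \<in> {0..<int d}}"
  define B where "B = (\<lambda>\<rho>. {p. infnorm (w + (real e / real d) *\<^sub>R real_vec \<rho> - real_vec p - y) < s})"
  define T where "T = {a :: int ^ 'm. infnorm (real_vec a - real d *\<^sub>R (y - w)) < real d * s}"
  have fR: "finite R" unfolding R_def by (intro finite_vec_product) simp
  have T: "finite T" "real (card T) \<le> (2 * (real d * s) + 1) ^ CARD('m)"
    unfolding T_def using assms by (auto intro!: card_int_vec_near_le)
  define h where "h = (\<lambda>(\<rho>, p). int e *s \<rho> - int d *s p :: int ^ 'm)"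
  have "inj_on h (Sigma R B)"
  proof (rule inj_onI, clarify)
    fix \<rho> p \<rho>' p' assume r: "\<rho> \<in> R" "\<rho>' \<in> R" and eq: "h (\<rho>, p) = h (\<rho>', p')"
    have "\<rho> $ i = \<rho>' $ i \<and> p $ i = p' $ i" for i
    proof -
      have "(int e *s \<rho> - int d *s p) $ i = (int e *s \<rho>' - int d *s p') $ i"
        using eq by (simp add: h_def)
      then have *: "int e * (\<rho> $ i - \<rho>' $ i) = int d * (p $ i - p' $ i)" by (simp add: algebra_simps)
      then have "int d dvd int e * (\<rho> $ i - \<rho>' $ i)" by simp
      then have "int d dvd \<rho> $ i - \<rho>' $ i"
        using assms(3) by (simp add: coprime_dvd_mult_right_iff)
      moreover have "\<bar>\<rho> $ i - \<rho>' $ i\<bar> < int d"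
        using r unfolding R_def by (simp, smt (verit))
      ultimately have 0: "\<rho> $ i = \<rho>' $ i"
        by (metis abs_of_nonneg dvd_imp_le_int eq_iff_diff_eq_0 linorder_not_le of_nat_0_le_iff)
      then show ?thesis using * assms(2) by simp
    qed
    then show "\<rho> = \<rho>' \<and> p = p'" by (simp add: vec_eq_iff)
  qed
  moreover have "h ` Sigma R B \<subseteq> T"
  proof clarify
    fix \<rho> p assume "p \<in> B \<rho>"
    then have "infnorm (w + (real e / real d) *\<^sub>R real_vec \<rho> - real_vec p - y) < s" by (simp add: B_def)
    moreover have "real_vec (h (\<rho>, p)) - real d *\<^sub>R (y - w)
       = real d *\<^sub>R (w + (real e / real d) *\<^sub>R real_vec \<rho> - real_vec p - y)"
      using assms(2) by (simp add: h_def real_vec_diff real_vec_smult algebra_simps)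
    ultimately show "h (\<rho>, p) \<in> T" using assms(2) by (simp add: T_def infnorm_mul)
  qed
  ultimately have "card (Sigma R B) \<le> card T" using T(1) by (rule card_inj_on_le)
  moreover have "card (Sigma R B) = (\<Sum>\<rho>\<in>R. card (B \<rho>))"
    by (rule card_SigmaI) (auto simp: fR B_def finite_near)
  ultimately have "(\<Sum>\<rho>\<in>R. card (B \<rho>)) \<le> card T" by simp
  then have "real (\<Sum>\<rho>\<in>R. card (B \<rho>)) \<le> real (card T)" by (rule of_nat_mono)
  also have "\<dots> \<le> (2 * real d * s + 1) ^ CARD('m)" using T(2) by (simp add: mult.assoc)
  finally have "real (\<Sum>\<rho>\<in>R. card (B \<rho>)) \<le> (2 * real d * s + 1) ^ CARD('m)" .
  then have "ennreal (real (\<Sum>\<rho>\<in>R. card (B \<rho>))) \<le> ennreal ((2 * real d * s + 1) ^ CARD('m))"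
    by (rule ennreal_leI)
  then show ?thesis
    unfolding near_count_eq_card R_def[symmetric] by (simp add: ennreal_of_nat_eq_real_of_nat B_def)
qed

text \<open>Writing \<open>p = \<rho> + d z\<close> leaves one sum over \<open>z\<close> for each
  residue vector \<open>\<rho>\<close>; the shift by \<open>d z\<close> matches a translation of
  \<open>u\<close> by \<open>z\<close> under the dilation \<open>d u\<close>.\<close>

lemma near_count_split_residues:
  fixes y u :: "real ^ 'm" and d :: nat
  assumes "0 < d"
  shows "near_count y r u = (\<Sum>\<rho> | \<forall>i. \<rho> $ i \<in> {0..<int d}.
    \<integral>\<^sup>+z. indicator {..<r} (infnorm (u - real d *\<^sub>R real_vec z - real_vec \<rho> - y)) \<partial>count_space UNIV)"
proof -
  define R where "R = {\<rho> :: int ^ 'm. \<forall>i. \<rho> $ i \<in> {0..<int d}}"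
  have fR: "finite R" unfolding R_def by (intro finite_vec_product) simp
  let ?I = "\<lambda>p. indicator {..<r} (infnorm (u - real_vec p - y)) :: ennreal"
  have inj: "inj (\<lambda>z :: int ^ 'm. \<rho> + int d *s z)" for \<rho>
    using assms by (auto simp: inj_def vec_eq_iff)
  have "near_count y r u = (\<integral>\<^sup>+p. (\<Sum>\<rho>\<in>R. ?I p * indicator (range (\<lambda>z. \<rho> + int d *s z)) p) \<partial>count_space UNIV)"
    unfolding near_count_def
  proof (intro nn_integral_cong)
    fix p :: "int ^ 'm"
    define \<rho>0 where "\<rho>0 = (\<chi> i. p $ i mod int d)"
    have 1: "\<rho>0 \<in> R" using assms by (auto simp: \<rho>0_def R_def)
    have "p = \<rho>0 + int d *s (\<chi> i. p $ i div int d)"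
      by (simp add: vec_eq_iff \<rho>0_def)
    then have 2: "p \<in> range (\<lambda>z. \<rho>0 + int d *s z)" by blast
    have 3: "\<rho> = \<rho>0" if "\<rho> \<in> R" "p \<in> range (\<lambda>z. \<rho> + int d *s z)" for \<rho>
      using that by (auto simp: R_def \<rho>0_def vec_eq_iff)
    have "(\<Sum>\<rho>\<in>R. ?I p * indicator (range (\<lambda>z. \<rho> + int d *s z)) p) = (\<Sum>\<rho>\<in>{\<rho>0}. ?I p * indicator (range (\<lambda>z. \<rho> + int d *s z)) p)"
      by (rule sum.mono_neutral_right[OF fR]) (use 1 in \<open>auto dest!: 3 simp: indicator_def\<close>)
    then show "?I p = (\<Sum>\<rho>\<in>R. ?I p * indicator (range (\<lambda>z. \<rho> + int d *s z)) p)" using 2 by simp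
  qed
  also have "\<dots> = (\<Sum>\<rho>\<in>R. \<integral>\<^sup>+p. ?I p * indicator (range (\<lambda>z. \<rho> + int d *s z)) p \<partial>count_space UNIV)"
    by (rule nn_integral_sum) simp
  also have "\<dots> = (\<Sum>\<rho>\<in>R. \<integral>\<^sup>+z. ?I (\<rho> + int d *s z) \<partial>count_space UNIV)"
  proof (rule sum.cong[OF refl])
    fix \<rho>
    have "(\<integral>\<^sup>+p. ?I p * indicator (range (\<lambda>z. \<rho> + int d *s z)) p \<partial>count_space UNIV) =
       (\<integral>\<^sup>+p. ?I p \<partial>count_space (range (\<lambda>z. \<rho> + int d *s z)))"
      by (subst nn_integral_count_space_indicator[of "range (\<lambda>z. \<rho> + int d *s z)"]) auto
    also have "\<dots> = (\<integral>\<^sup>+z. ?I (\<rho> + int d *s z) \<partial>count_space UNIV)"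
      by (rule nn_integral_bij_count_space[symmetric]) (simp add: bij_betw_def inj)
    finally show "(\<integral>\<^sup>+p. ?I p * indicator (range (\<lambda>z. \<rho> + int d *s z)) p \<partial>count_space UNIV) =
      (\<integral>\<^sup>+z. ?I (\<rho> + int d *s z) \<partial>count_space UNIV)" .
  qed
  finally show ?thesis
    by (simp add: R_def real_vec_add real_vec_smult algebra_simps)
qed

text \<open>Only the first factor is split into residues. Its sum over \<open>z\<close> is unfolded
  together with the unit cube into an integral over the whole space, where the first factor is a
  single ball of radius \<open>r / d\<close>; the residues survive in the second factor, whose sum
  is bounded pointwise. The result is about \<open>(4 r s)^m\<close>, the value for independent
  events, when \<open>d s\<close> is large, and about \<open>(2 r / d)^m\<close> when it is
  small.\<close>

lemma near_count_coprime_overlap: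
  fixes y :: "real ^ 'm" and d e :: nat
  assumes "0 \<le> r" "0 \<le> s" "0 < d" "coprime d e"
  shows "(\<integral>\<^sup>+u. near_count y r (real d *\<^sub>R u) * near_count y s (real e *\<^sub>R u) * indicator unit_cube u \<partial>lborel)
     \<le> ennreal ((2 * r / real d) ^ CARD('m) * (2 * real d * s + 1) ^ CARD('m))"
proof -
  define R where "R = {\<rho> :: int ^ 'm. \<forall>i. \<rho> $ i \<in> {0..<int d}}"
  have fR: "finite R" unfolding R_def by (intro finite_vec_product) simp
  let ?I = "\<lambda>x. indicator {..<r} (infnorm (x - y)) :: ennreal"
  let ?H = "near_count y s"
  \<comment> \<open>Since \<open>e z\<close> is integral, the second factor is unchanged when
    \<open>u\<close> becomes \<open>u - z\<close>; this is what permits unfolding both factors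
    together.\<close>
  have per: "?H (real e *\<^sub>R (u - real_vec z)) = ?H (real e *\<^sub>R u)" for u z
    using near_count_add_int[of y s "real e *\<^sub>R (u - real_vec z)" "int e *s z"]
    by (simp add: real_vec_smult algebra_simps)
  have "(\<integral>\<^sup>+u. near_count y r (real d *\<^sub>R u) * ?H (real e *\<^sub>R u) * indicator unit_cube u \<partial>lborel) =
    (\<integral>\<^sup>+u. (\<Sum>\<rho>\<in>R. \<integral>\<^sup>+z. ?I (real d *\<^sub>R u - real d *\<^sub>R real_vec z - real_vec \<rho>) * (?H (real e *\<^sub>R u) * indicator unit_cube u) \<partial>count_space UNIV) \<partial>lborel)"
    by (subst near_count_split_residues[OF assms(3)])
       (simp add: R_def sum_distrib_right nn_integral_multc mult.assoc)
  also have "\<dots> = (\<Sum>\<rho>\<in>R. \<integral>\<^sup>+u. (\<integral>\<^sup>+z. ?I (real d *\<^sub>R u - real d *\<^sub>R real_vec z - real_vec \<rho>) * (?H (real e *\<^sub>R u) * indicator unit_cube u) \<partial>count_space UNIV) \<partial>lborel)"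
    by (rule nn_integral_sum) (simp, rule borel_measurable_nn_integral_countable, measurable)
  also have "\<dots> = (\<Sum>\<rho>\<in>R. \<integral>\<^sup>+u. ?I (real d *\<^sub>R u) * ?H (real e *\<^sub>R u + (real e / real d) *\<^sub>R real_vec \<rho>) \<partial>lborel)"
  proof (rule sum.cong[OF refl])
    fix \<rho> :: "int ^ 'm"
    have "(\<integral>\<^sup>+u. (\<integral>\<^sup>+z. ?I (real d *\<^sub>R u - real d *\<^sub>R real_vec z - real_vec \<rho>) * (?H (real e *\<^sub>R u) * indicator unit_cube u) \<partial>count_space UNIV) \<partial>lborel)
      = (\<integral>\<^sup>+z. (\<integral>\<^sup>+u. ?I (real d *\<^sub>R u - real d *\<^sub>R real_vec z - real_vec \<rho>) * (?H (real e *\<^sub>R u) * indicator unit_cube u) \<partial>lborel) \<partial>count_space UNIV)"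
      by (rule nn_integral_count_space_nn_integral) auto
    also have "\<dots> = (\<integral>\<^sup>+z. (\<integral>\<^sup>+u. ?I (real d *\<^sub>R (u - real_vec z) - real_vec \<rho>) * ?H (real e *\<^sub>R (u - real_vec z)) * indicator unit_cube u \<partial>lborel) \<partial>count_space UNIV)"
      by (simp only: per mult.assoc) (simp only: scaleR_right_diff_distrib)
    also have "\<dots> = (\<integral>\<^sup>+u. ?I (real d *\<^sub>R u - real_vec \<rho>) * ?H (real e *\<^sub>R u) \<partial>lborel)"
      by (rule nn_integral_lattice_unfold_vec[symmetric]) measurable
    \<comment> \<open>The translation by \<open>\<rho> / d\<close> centres the ball and moves the
      residue into the second factor.\<close>
    also have "\<dots> = (\<integral>\<^sup>+u. ?I (real d *\<^sub>R (u + real_vec \<rho> /\<^sub>R real d) - real_vec \<rho>) * ?H (real e *\<^sub>R (u + real_vec \<rho> /\<^sub>R real d)) \<partial>lborel)"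
      by (rule nn_integral_lborel_shift[symmetric]) measurable
    also have "\<dots> = (\<integral>\<^sup>+u. ?I (real d *\<^sub>R u) * ?H (real e *\<^sub>R u + (real e / real d) *\<^sub>R real_vec \<rho>) \<partial>lborel)"
      using assms(3) by (simp add: algebra_simps divide_inverse)
    finally show "(\<integral>\<^sup>+u. (\<integral>\<^sup>+z. ?I (real d *\<^sub>R u - real d *\<^sub>R real_vec z - real_vec \<rho>) * (?H (real e *\<^sub>R u) * indicator unit_cube u) \<partial>count_space UNIV) \<partial>lborel)
      = (\<integral>\<^sup>+u. ?I (real d *\<^sub>R u) * ?H (real e *\<^sub>R u + (real e / real d) *\<^sub>R real_vec \<rho>) \<partial>lborel)" .
  qed
  also have "\<dots> = (\<integral>\<^sup>+u. ?I (real d *\<^sub>R u) * (\<Sum>\<rho>\<in>R. ?H (real e *\<^sub>R u + (real e / real d) *\<^sub>R real_vec \<rho>)) \<partial>lborel)"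
    by (simp add: sum_distrib_left nn_integral_sum)
  also have "\<dots> \<le> (\<integral>\<^sup>+u. ?I (real d *\<^sub>R u) * ennreal ((2 * real d * s + 1) ^ CARD('m)) \<partial>lborel)"
    unfolding R_def by (intro nn_integral_mono mult_left_mono sum_residues_near_count_le assms) auto
  also have "\<dots> = ennreal ((2 * r / real d) ^ CARD('m)) * ennreal ((2 * real d * s + 1) ^ CARD('m))"
    using nn_integral_scaled_infnorm_ball[of r "real d" y] assms by (simp add: nn_integral_multc)
  finally show ?thesis using assms by (simp add: ennreal_mult)
qed

subsection \<open>Linear forms on matrices\<close>

lemma int_lattice_matrix: "z \<in> int_lattice \<longleftrightarrow> (\<forall>i s. (z :: real ^ 'm ^ 'n) $ i $ s \<in> \<int>)"
  by (auto simp: int_lattice_def Basis_vec_def inner_axis)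

lemma vector_matrix_mult_nth: "(v v* x) $ s = (\<Sum>i\<in>UNIV. v $ i * x $ i $ s)"
  by (simp add: vector_matrix_mult_def)

lemma linear_vector_matrix_mult: "linear (\<lambda>x :: real ^ 'm ^ 'n. v v* x)"
  by (rule linearI) (simp_all add: vec_eq_iff vector_matrix_mult_nth sum.distrib algebra_simps sum_distrib_left)

lemma vector_matrix_mult_measurable [measurable]:
  "(\<lambda>x :: real ^ 'm ^ 'n. v v* x) \<in> borel_measurable borel"
  using linear_vector_matrix_mult[of v]
  by (intro borel_measurable_continuous_onI linear_continuous_on) (simp add: linear_conv_bounded_linear)

lemma vector_matrix_mult_lattice:
  fixes z :: "real ^ 'm ^ 'n"
  assumes "z \<in> int_lattice"
  shows "real_vec q v* z \<in> int_lattice"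
  using assms by (auto simp: int_lattice_matrix int_lattice_cart vector_matrix_mult_nth real_vec_def intro!: Ints_sum Ints_mult)

lemma vector_matrix_mult_axis:
  fixes t :: "real ^ 'm"
  shows "v v* (axis j t :: real ^ 'm ^ 'n) = (v $ j) *\<^sub>R t"
proof -
  have "(\<Sum>i\<in>UNIV. v $ i * (axis j t :: real ^ 'm ^ 'n) $ i $ s) = (\<Sum>i\<in>UNIV. if i = j then v $ i * t $ s else 0)" for s
    by (intro sum.cong) (auto simp: axis_def)
  then show ?thesis by (simp add: vec_eq_iff vector_matrix_mult_nth)
qed

definition approx_count :: "real ^ 'm \<Rightarrow> real \<Rightarrow> int ^ 'n \<Rightarrow> real ^ 'm ^ 'n \<Rightarrow> ennreal" where
  "approx_count y r q x = near_count y r (real_vec q v* x)"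

lemma approx_count_measurable [measurable]: "approx_count y r q \<in> borel_measurable borel"
  unfolding approx_count_def by measurable

lemma periodic_approx_count: "lattice_periodic (approx_count y r q)"
  using periodic_near_count[of y r]
  by (auto simp: lattice_periodic_def approx_count_def linear_add[OF linear_vector_matrix_mult] vector_matrix_mult_lattice)

lemma surj_vector_matrix_mult:
  assumes "v $ j \<noteq> 0"
  shows "surj (\<lambda>x :: real ^ 'm ^ 'n. v v* x)"
proof (rule surjI)
  fix t :: "real ^ 'm"
  show "v v* (axis j (t /\<^sub>R (v $ j)) :: real ^ 'm ^ 'n) = t"
    using assms by (simp add: vector_matrix_mult_axis)
qed

lemma nn_integral_vector_matrix_mult:
  fixes \<Phi> :: "real ^ 'm \<Rightarrow> ennreal" and q :: "int ^ 'n"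
  assumes "q $ j \<noteq> 0" "\<Phi> \<in> borel_measurable borel" "lattice_periodic \<Phi>"
  shows "(\<integral>\<^sup>+x. \<Phi> (real_vec q v* x) * indicator unit_cube x \<partial>lborel) = (\<integral>\<^sup>+u. \<Phi> u * indicator unit_cube u \<partial>lborel)"
proof (rule nn_integral_torus_map[OF linear_vector_matrix_mult surj_vector_matrix_mult])
  show "real_vec q $ j \<noteq> 0" using assms by (simp add: real_vec_def)
qed (use assms vector_matrix_mult_lattice in auto)

lemma nn_integral_approx_count:
  fixes y :: "real ^ 'm" and q :: "int ^ 'n"
  assumes "q $ j \<noteq> 0" "0 \<le> r"
  shows "(\<integral>\<^sup>+x. approx_count y r q x * indicator unit_cube x \<partial>lborel) = ennreal ((2 * r) ^ CARD('m))"
  unfolding approx_count_def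
  by (subst nn_integral_vector_matrix_mult[OF assms(1)])
     (simp_all add: nn_integral_near_count periodic_near_count assms)

lemma int_lattice_prod: "(a, b) \<in> int_lattice \<longleftrightarrow> a \<in> int_lattice \<and> b \<in> int_lattice"
  by (simp add: int_lattice_def Basis_prod_def ball_Un)

lemma unit_cube_prod: "(a, b) \<in> unit_cube \<longleftrightarrow> a \<in> unit_cube \<and> b \<in> unit_cube"
  by (simp add: unit_cube_def Basis_prod_def ball_Un)

text \<open>A nonzero two by two minor of \<open>q\<close> and \<open>q'\<close> makes the map
  taking \<open>x\<close> to the pair of its two images surjective. It preserves integrality, so the
  integral over the matrix torus becomes one over a product of two tori, where the factors
  separate.\<close>

lemma approx_count_independent:
  fixes y :: "real ^ 'm" and q q' :: "int ^ 'n"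
  assumes D: "q $ j * q' $ i \<noteq> q' $ j * q $ i" and "0 \<le> r" "0 \<le> s"
  shows "(\<integral>\<^sup>+x. approx_count y r q x * approx_count y s q' x * indicator unit_cube x \<partial>lborel)
    = ennreal ((2 * r) ^ CARD('m) * (2 * s) ^ CARD('m))"
proof -
  let ?L = "\<lambda>x :: real ^ 'm ^ 'n. (real_vec q v* x, real_vec q' v* x)"
  let ?\<Phi> = "\<lambda>(u, v). near_count y r u * near_count y s v"
  define \<delta> where "\<delta> = real_of_int (q $ j * q' $ i - q' $ j * q $ i)"
  have \<delta>: "\<delta> \<noteq> 0" using D by (simp add: \<delta>_def flip: of_int_mult)
  have lin: "linear ?L"
    by (intro linearI) (simp_all add: linear_add[OF linear_vector_matrix_mult] linear_cmul[OF linear_vector_matrix_mult])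
  \<comment> \<open>Cramer's rule: the preimage of \<open>(c, c')\<close> is supported on the rows
    \<open>j\<close> and \<open>i\<close>, with the minor \<open>\<delta>\<close> as
    denominator.\<close>
  have "?L (axis j ((of_int (q' $ i) *\<^sub>R c - of_int (q $ i) *\<^sub>R c') /\<^sub>R \<delta>) + axis i ((of_int (q $ j) *\<^sub>R c' - of_int (q' $ j) *\<^sub>R c) /\<^sub>R \<delta>)) = (c, c')" for c c'
  proof -
    have "\<delta> *\<^sub>R (of_int a *\<^sub>R (u /\<^sub>R \<delta>) + of_int b *\<^sub>R (v /\<^sub>R \<delta>)) = of_int a *\<^sub>R u + of_int b *\<^sub>R v" for u v :: "real ^ 'm" and a b
      using \<delta> by (simp add: scaleR_right_distrib mult.left_commute[of \<delta>])
    moreover have "of_int (q $ j) *\<^sub>R (of_int (q' $ i) *\<^sub>R c - of_int (q $ i) *\<^sub>R c') + of_int (q $ i) *\<^sub>R (of_int (q $ j) *\<^sub>R c' - of_int (q' $ j) *\<^sub>R c) = \<delta> *\<^sub>R c"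
      "of_int (q' $ j) *\<^sub>R (of_int (q' $ i) *\<^sub>R c - of_int (q $ i) *\<^sub>R c') + of_int (q' $ i) *\<^sub>R (of_int (q $ j) *\<^sub>R c' - of_int (q' $ j) *\<^sub>R c) = \<delta> *\<^sub>R c'"
      by (simp_all add: \<delta>_def algebra_simps)
    ultimately have "of_int (q $ j) *\<^sub>R ((of_int (q' $ i) *\<^sub>R c - of_int (q $ i) *\<^sub>R c') /\<^sub>R \<delta>) + of_int (q $ i) *\<^sub>R ((of_int (q $ j) *\<^sub>R c' - of_int (q' $ j) *\<^sub>R c) /\<^sub>R \<delta>) = c"
     "of_int (q' $ j) *\<^sub>R ((of_int (q' $ i) *\<^sub>R c - of_int (q $ i) *\<^sub>R c') /\<^sub>R \<delta>) + of_int (q' $ i) *\<^sub>R ((of_int (q $ j) *\<^sub>R c' - of_int (q' $ j) *\<^sub>R c) /\<^sub>R \<delta>) = c'"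
      using \<delta> by (metis scaleR_cancel_left)+
    then show ?thesis
      by (simp add: linear_add[OF linear_vector_matrix_mult] vector_matrix_mult_axis) (simp add: real_vec_def)
  qed
  then have "surj ?L" unfolding surj_def by (metis surj_pair)
  moreover have "lattice_periodic ?\<Phi>"
    using periodic_near_count[of y r] periodic_near_count[of y s]
    by (auto simp: lattice_periodic_def int_lattice_prod)
  moreover have "?\<Phi> \<in> borel_measurable borel" unfolding borel_prod[symmetric] by measurable
  ultimately have "(\<integral>\<^sup>+x. ?\<Phi> (?L x) * indicator unit_cube x \<partial>lborel) = (\<integral>\<^sup>+u. ?\<Phi> u * indicator unit_cube u \<partial>lborel)"
    by (intro nn_integral_torus_map[OF lin]) (auto simp: int_lattice_prod vector_matrix_mult_lattice)
  also have "\<dots> = (\<integral>\<^sup>+z. (\<lambda>(u, v). (near_count y r u * indicator unit_cube u) * (near_count y s v * indicator unit_cube v)) z \<partial>(lborel \<Otimes>\<^sub>M lborel))"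
    unfolding lborel_prod by (intro nn_integral_cong) (auto simp: unit_cube_prod split: split_indicator)
  also have "\<dots> = (\<integral>\<^sup>+u. \<integral>\<^sup>+v. (near_count y r u * indicator unit_cube u) * (near_count y s v * indicator unit_cube v) \<partial>lborel \<partial>lborel)"
    by (subst lborel.nn_integral_fst[symmetric]) auto
  also have "\<dots> = ennreal ((2 * r) ^ CARD('m)) * ennreal ((2 * s) ^ CARD('m))"
    using assms by (simp add: nn_integral_cmult nn_integral_multc nn_integral_near_count)
  finally show ?thesis using assms by (simp add: approx_count_def ennreal_mult)
qed

lemma power_add_le:
  fixes a b :: real
  assumes "0 \<le> a" "0 \<le> b"
  shows "(a + b) ^ m \<le> 2 ^ m * (a ^ m + b ^ m)"
proof -
  have "(a + b) ^ m \<le> (2 * max a b) ^ m" using assms by (intro power_mono) auto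
  also have "\<dots> = 2 ^ m * max a b ^ m" by (simp add: power_mult_distrib)
  also have "\<dots> \<le> 2 ^ m * (a ^ m + b ^ m)" using assms by (intro mult_left_mono) (auto simp: max_def)
  finally show ?thesis .
qed

text \<open>Both vectors are multiples of one integer vector: cancelling \<open>g = gcd k l\<close>
  leaves coprime \<open>d\<close> and \<open>e\<close> with \<open>d q' = e q\<close>, so
  \<open>q = d v\<close> and \<open>q' = e v\<close>, and the integral is pulled back through
  \<open>v\<close> from a torus of dimension m. The divisibility of \<open>q\<close> by
  \<open>d\<close> is stated separately because it limits how many such \<open>q\<close> there
  are.\<close>

lemma approx_count_parallel:
  fixes y :: "real ^ 'm" and q q' :: "int ^ 'n" and k l :: nat
  assumes "q $ j = int k" "q' $ j = int l" "0 < k" "0 < l" and par: "\<And>i. int k * q' $ i = int l * q $ i"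
    and "0 \<le> r" "0 \<le> s"
  shows "\<And>i. int (k div gcd k l) dvd q $ i"
   "(\<integral>\<^sup>+x. approx_count y r q x * approx_count y s q' x * indicator unit_cube x \<partial>lborel)
    \<le> ennreal (8 ^ CARD('m) * (r ^ CARD('m) * s ^ CARD('m)) + 4 ^ CARD('m) * (r / real (k div gcd k l)) ^ CARD('m))"
proof -
  define g where "g = gcd k l"
  define d e where "d = k div g" and "e = l div g"
  have g: "g > 0" "k = g * d" "l = g * e" using assms by (auto simp: g_def d_def e_def)
  have d: "d > 0" using g assms by (cases d) auto
  have cop: "coprime d e" unfolding d_def e_def g_def using assms by (intro div_gcd_coprime) auto
  have par': "int d * q' $ i = int e * q $ i" for i
    using par[of i] g by (simp add: mult.assoc)
  have dv: "int d dvd q $ i" for i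
  proof -
    have "int d dvd int e * q $ i" by (metis par' dvd_triv_left)
    then show ?thesis using cop by (simp add: coprime_dvd_mult_right_iff)
  qed
  then show "\<And>i. int (k div gcd k l) dvd q $ i" by (simp add: d_def g_def)
  define v where "v = (\<chi> i. q $ i div int d)"
  have q: "q = int d *s v" using dv by (simp add: vec_eq_iff v_def)
  have q': "q' = int e *s v"
  proof (simp add: vec_eq_iff, rule allI)
    fix i
    have "int d * q' $ i = int d * (int e * v $ i)" using par'[of i] by (simp add: q)
    then show "q' $ i = int e * v $ i" using d by simp
  qed
  have vj: "v $ j \<noteq> 0" using q assms by auto
  have sc: "real_vec (int c *s v) v* x = real c *\<^sub>R (real_vec v v* x)" for c and x :: "real ^ 'm ^ 'n"
    by (simp add: vec_eq_iff vector_matrix_mult_nth real_vec_def sum_distrib_left mult_ac)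
  let ?\<Phi> = "\<lambda>u. near_count y r (real d *\<^sub>R u) * near_count y s (real e *\<^sub>R u)"
  have per: "lattice_periodic (\<lambda>u. near_count y t (real c *\<^sub>R u))" for c t
  proof -
    have "real c *\<^sub>R z \<in> int_lattice" if "z \<in> int_lattice" for z :: "real ^ 'm"
      using that by (auto simp: int_lattice_cart)
    then show ?thesis using periodic_near_count[of y t] by (auto simp: lattice_periodic_def scaleR_right_distrib)
  qed
  have "(\<integral>\<^sup>+x. approx_count y r q x * approx_count y s q' x * indicator unit_cube x \<partial>lborel)
     = (\<integral>\<^sup>+x. ?\<Phi> (real_vec v v* x) * indicator unit_cube x \<partial>lborel)"
    by (simp add: approx_count_def q q' sc)
  also have "\<dots> = (\<integral>\<^sup>+u. ?\<Phi> u * indicator unit_cube u \<partial>lborel)"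
    by (rule nn_integral_vector_matrix_mult[where j=j])
      (use vj per[of r d] per[of s e] in \<open>auto simp: lattice_periodic_def\<close>)
  also have "\<dots> \<le> ennreal ((2 * r / real d) ^ CARD('m) * (2 * real d * s + 1) ^ CARD('m))"
    by (rule near_count_coprime_overlap) (use assms d cop in auto)
  \<comment> \<open>Both factors merge into one m-th power of a sum; splitting that power costs
    \<open>2^m\<close> and turns 4 and 2 into the constants 8 and 4.\<close>
  also have "(2 * r / real d) ^ CARD('m) * (2 * real d * s + 1) ^ CARD('m) = (4 * (r * s) + 2 * (r / real d)) ^ CARD('m)"
    using d by (simp add: algebra_simps flip: power_mult_distrib)
  also have "ennreal \<dots> \<le> ennreal (2 ^ CARD('m) * ((4 * (r * s)) ^ CARD('m) + (2 * (r / real d)) ^ CARD('m)))"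
    using assms by (intro ennreal_leI power_add_le) auto
  also have "2 ^ CARD('m) * ((4 * (r * s)) ^ CARD('m) + (2 * (r / real d)) ^ CARD('m)) =
     8 ^ CARD('m) * (r ^ CARD('m) * s ^ CARD('m)) + 4 ^ CARD('m) * (r / real d) ^ CARD('m)"
  proof -
    have "(8::real) ^ CARD('m) = 2 ^ CARD('m) * 4 ^ CARD('m)" "(4::real) ^ CARD('m) = 2 ^ CARD('m) * 2 ^ CARD('m)"
      by (simp_all flip: power_mult_distrib)
    then show ?thesis by (simp only: power_mult_distrib distrib_left mult.assoc)
  qed
  finally show "(\<integral>\<^sup>+x. approx_count y r q x * approx_count y s q' x * indicator unit_cube x \<partial>lborel)
    \<le> ennreal (8 ^ CARD('m) * (r ^ CARD('m) * s ^ CARD('m)) + 4 ^ CARD('m) * (r / real (k div gcd k l)) ^ CARD('m))"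
    by (simp add: d_def g_def)
qed

subsection \<open>Second moment\<close>

text \<open>For \<open>k > 0\<close> the entry \<open>j\<close> attains the max norm, so
  \<open>\<psi>\<close> is evaluated at \<open>k\<close> for all these vectors, while their number
  \<open>k^(n - 1)\<close> still has the order of the whole sphere. Two such vectors with
  \<open>k, l > 0\<close> can be parallel only in the ratio \<open>k : l\<close>.\<close>

definition denoms :: "'n \<Rightarrow> nat \<Rightarrow> (int ^ 'n) set" where
  "denoms j k = {q. \<forall>i. q $ i \<in> (if i = j then {int k} else {1..int k})}"

lemma finite_denoms: "finite (denoms j k)"
  unfolding denoms_def by (rule finite_vec_product) simp

lemma denoms_nth: "q \<in> denoms j k \<Longrightarrow> q $ j = int k"
  by (auto simp: denoms_def dest!: spec[of _ j])

lemma denoms_bounds: "q \<in> denoms j k \<Longrightarrow> k > 0 \<Longrightarrow> 1 \<le> q $ i \<and> q $ i \<le> int k"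
  by (auto simp: denoms_def dest!: spec[of _ i] split: if_splits)

lemma card_multiples_le:
  assumes "d > 0"
  shows "card {a \<in> {1..int k}. int d dvd a} \<le> k div d"
proof -
  have "{a \<in> {1..int k}. int d dvd a} \<subseteq> (\<lambda>c. int d * int c) ` {1..k div d}"
  proof
    fix a assume a: "a \<in> {a \<in> {1..int k}. int d dvd a}"
    then obtain c where c: "a = int d * c" by auto
    have "0 < int d * c" using a c by simp
    then have "c > 0" using assms by (simp add: zero_less_mult_iff)
    moreover have "c \<le> int k div int d"
    proof -
      have "(int d * c) div int d \<le> int k div int d" using a c assms by (intro zdiv_mono1) auto
      then show ?thesis using assms by simp
    qed
    ultimately have "nat c \<in> {1..k div d}" by (auto simp: zdiv_int nat_le_iff)
    then show "a \<in> (\<lambda>c. int d * int c) ` {1..k div d}"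
      using c \<open>c > 0\<close> by (intro image_eqI[where x="nat c"]) auto
  qed
  then have "card {a \<in> {1..int k}. int d dvd a} \<le> card ((\<lambda>c. int d * int c) ` {1..k div d})"
    by (intro card_mono) auto
  also have "\<dots> \<le> k div d" using card_image_le[of "{1..k div d}"] by fastforce
  finally show ?thesis .
qed

lemma prod_if_eq_power:
  fixes a b :: "'a::comm_monoid_mult" and j :: "'n::finite"
  shows "(\<Prod>i\<in>UNIV. if i = j then a else b) = a * b ^ (CARD('n) - 1)"
proof -
  have "(\<Prod>i\<in>UNIV. if i = j then a else b) = a * (\<Prod>i\<in>UNIV - {j}. if i = j then a else b)"
    by (subst prod.remove[of _ j]) auto
  also have "(\<Prod>i\<in>UNIV - {j}. if i = j then a else b) = (\<Prod>i\<in>UNIV - {j}. b)"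
    by (rule prod.cong) auto
  finally show ?thesis by simp
qed

lemma card_denoms: "card (denoms (j :: 'n::finite) k) = k ^ (CARD('n) - 1)"
proof -
  have "card (denoms j k) = (\<Prod>i\<in>UNIV. card (if i = j then {int k} else {1..int k}))"
    unfolding denoms_def by (rule card_vec_product)
  also have "\<dots> = (\<Prod>i\<in>UNIV. if i = j then 1 else k)" by (rule prod.cong) auto
  finally show ?thesis by (simp add: prod_if_eq_power)
qed

lemma card_denoms_dvd_le:
  assumes "d > 0"
  shows "card {q \<in> denoms (j :: 'n::finite) k. \<forall>i. int d dvd q $ i} \<le> (k div d) ^ (CARD('n) - 1)"
proof -
  have "card {q \<in> denoms j k. \<forall>i. int d dvd q $ i} \<le>
     card {q. \<forall>i. q $ i \<in> (if i = j then {int k} else {a \<in> {1..int k}. int d dvd a})}"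
  proof (rule card_mono)
    show "finite {q. \<forall>i. q $ i \<in> (if i = j then {int k} else {a \<in> {1..int k}. int d dvd a})}"
      by (rule finite_vec_product) (auto intro: finite_subset[of _ "{1..int k}"])
  qed (auto simp: denoms_def)
  also have "\<dots> = (\<Prod>i\<in>UNIV. card (if i = j then {int k} else {a \<in> {1..int k}. int d dvd a}))"
    by (rule card_vec_product)
  also have "\<dots> \<le> (\<Prod>i\<in>UNIV. if i = j then 1 else k div d)"
    by (rule prod_mono) (use card_multiples_le[OF assms] in auto)
  finally show ?thesis by (simp add: prod_if_eq_power)
qed

section \<open>Sums over parallel pairs\<close>

lemma sum_inverse_squares_le: "(\<Sum>d=1..k. 1 / real d ^ 2) \<le> 2"
proof -
  \<comment> \<open>The induction carries the telescoping defect \<open>1 / (k + 1)\<close>.\<close>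
  have "(\<Sum>d=1..Suc k. 1 / real d ^ 2) \<le> 2 - 1 / real (Suc k)" for k
  proof (induction k)
    case (Suc k)
    have "1 / real (Suc (Suc k)) ^ 2 \<le> 1 / real (Suc k) - 1 / real (Suc (Suc k))"
      by (simp add: divide_simps power2_eq_square)
    then show ?case using Suc by simp
  qed simp
  then have *: "(\<Sum>d=1..Suc k. 1 / real d ^ 2) \<le> 2" for k
    by (smt (verit) divide_nonneg_nonneg of_nat_0_le_iff)
  show ?thesis using *[of "k - 1"] by (cases k) auto
qed

text \<open>Each \<open>l\<close> is recovered from the fraction \<open>l / k\<close> in lowest
  terms \<open>e / d\<close>. A denominator \<open>d\<close> has at most \<open>d\<close> numerators
  \<open>e\<close>, so the sum is at most that of \<open>d / d^3\<close>.\<close>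

lemma sum_reduced_denominators_le: "(\<Sum>l=1..k. 1 / real (k div gcd k l) ^ 3) \<le> 2"
proof -
  let ?f = "\<lambda>l. (k div gcd k l, l div gcd k l)"
  have inj: "inj_on ?f {1..k}"
  proof (rule inj_onI)
    fix l l' assume l: "l \<in> {1..k}" "l' \<in> {1..k}" and "?f l = ?f l'"
    then have eq: "k div gcd k l = k div gcd k l'" "l div gcd k l = l' div gcd k l'" by auto
    have k: "k > 0" using l by auto
    have "gcd k l * (k div gcd k l) = gcd k l' * (k div gcd k l')" by simp
    then have "gcd k l = gcd k l'" using eq k by (metis dvd_div_eq_0_iff gcd_dvd1 mult_cancel2 not_gr_zero)
    then show "l = l'" using eq by (metis dvd_mult_div_cancel gcd_dvd2)
  qed
  have sub: "?f ` {1..k} \<subseteq> Sigma {1..k} (\<lambda>d. {1..d})"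
  proof clarify
    fix l assume "l \<in> {1..k}"
    then show "k div gcd k l \<in> {1..k} \<and> l div gcd k l \<in> {1..k div gcd k l}"
      by (auto simp: div_le_mono Suc_le_eq div_greater_zero_iff gcd_le1_nat gcd_le2_nat)
  qed
  have "(\<Sum>l=1..k. 1 / real (k div gcd k l) ^ 3) = (\<Sum>x\<in>?f ` {1..k}. 1 / real (fst x) ^ 3)"
    using inj by (simp add: sum.reindex)
  also have "\<dots> \<le> (\<Sum>x\<in>Sigma {1..k} (\<lambda>d. {1..d}). 1 / real (fst x) ^ 3)"
    by (rule sum_mono2[OF _ sub]) auto
  also have "\<dots> = (\<Sum>d=1..k. \<Sum>e=1..d. 1 / real d ^ 3)"
    by (subst sum.Sigma) (auto simp: split_beta')
  also have "\<dots> = (\<Sum>d=1..k. 1 / real d ^ 2)"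
    by (intro sum.cong) (auto simp: power2_eq_square power3_eq_cube)
  also have "\<dots> \<le> 2" by (rule sum_inverse_squares_le)
  finally show ?thesis .
qed

lemma sum_Sigma_pair:
  assumes "finite A" "\<And>x. x \<in> A \<Longrightarrow> finite (B x)"
  shows "sum f (Sigma A B) = (\<Sum>x\<in>A. \<Sum>y\<in>B x. f (x, y))"
  using assms by (simp add: sum.Sigma)

text \<open>What a parallel pair contributes beyond a multiple of
  \<open>\<psi> k ^ m * \<psi> l ^ m\<close>. The condition \<open>l \<le> k\<close> charges it to
  the larger index: for fixed \<open>k\<close> the fractions \<open>l / k\<close> then stay at most
  1, and the sum over \<open>l\<close> is bounded independently of the range of summation.\<close>

definition parallel_excess :: "(nat \<Rightarrow> real) \<Rightarrow> nat \<Rightarrow> nat \<times> (int ^ 'n) \<Rightarrow> nat \<times> (int ^ 'n) \<Rightarrow> real" where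
  "parallel_excess \<psi> m = (\<lambda>(k, q) (l, q'). if l \<le> k \<and> (\<forall>i. int k * q' $ i = int l * q $ i)
      then 4 ^ m * (\<psi> k / real (k div gcd k l)) ^ m else 0)"

lemma parallel_excess_nonneg: "(\<And>k. 0 \<le> \<psi> k) \<Longrightarrow> 0 \<le> parallel_excess \<psi> m a b"
  by (auto simp: parallel_excess_def split: prod.splits)

lemma approx_count_pair_le:
  fixes y :: "real ^ 'm" and q q' :: "int ^ 'n"
  assumes q: "q \<in> denoms j k" "q' \<in> denoms j l" "0 < k" "0 < l" and \<psi>: "\<And>k. 0 \<le> \<psi> k"
  shows "(\<integral>\<^sup>+x. approx_count y (\<psi> k) q x * approx_count y (\<psi> l) q' x * indicator unit_cube x \<partial>lborel)
    \<le> ennreal (8 ^ CARD('m) * (\<psi> k ^ CARD('m) * \<psi> l ^ CARD('m)) +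
        (parallel_excess \<psi> CARD('m) (k, q) (l, q') + parallel_excess \<psi> CARD('m) (l, q') (k, q)))"
    (is "?I \<le> ennreal (?A + ?P)")
proof -
  have P: "?P \<ge> 0" by (intro add_nonneg_nonneg parallel_excess_nonneg \<psi>)
  \<comment> \<open>Because \<open>q $ j = k\<close> and \<open>q' $ j = l\<close>, the minors
    through the entry \<open>j\<close> decide: one of them is nonzero, or all vanish and the vectors
    are parallel. The two parallel cases differ in which index carries the excess.\<close>
  consider (ind) i where "q $ j * q' $ i \<noteq> q' $ j * q $ i"
    | (par1) "\<forall>i. int k * q' $ i = int l * q $ i" "l \<le> k"
    | (par2) "\<forall>i. int l * q $ i = int k * q' $ i" "k \<le> l"
    using denoms_nth[OF q(1)] denoms_nth[OF q(2)] by (metis le_cases)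
  then show ?thesis
  proof cases
    case ind
    have "?I = ennreal ((2 * \<psi> k) ^ CARD('m) * (2 * \<psi> l) ^ CARD('m))"
      by (rule approx_count_independent[OF ind \<psi> \<psi>])
    also have "\<dots> \<le> ennreal ?A"
    proof (rule ennreal_leI)
      have "(2 * \<psi> k) ^ CARD('m) * (2 * \<psi> l) ^ CARD('m) = (2 ^ CARD('m) * 2 ^ CARD('m)) * (\<psi> k ^ CARD('m) * \<psi> l ^ CARD('m))"
        by (simp only: power_mult_distrib mult_ac)
      also have "(2 :: real) ^ CARD('m) * 2 ^ CARD('m) = 4 ^ CARD('m)"
        by (simp flip: power_mult_distrib)
      also have "4 ^ CARD('m) * (\<psi> k ^ CARD('m) * \<psi> l ^ CARD('m)) \<le> ?A" by (intro mult_right_mono power_mono) (auto simp: \<psi>)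
      finally show "(2 * \<psi> k) ^ CARD('m) * (2 * \<psi> l) ^ CARD('m) \<le> ?A" .
    qed
    also have "\<dots> \<le> ennreal (?A + ?P)" using P by (intro ennreal_leI) simp
    finally show ?thesis .
  next
    case par1
    have "?I \<le> ennreal (?A + 4 ^ CARD('m) * (\<psi> k / real (k div gcd k l)) ^ CARD('m))"
      by (rule approx_count_parallel[where j=j]) (use par1 q \<psi> denoms_nth in auto)
    also have "\<dots> = ennreal (?A + parallel_excess \<psi> CARD('m) (k, q) (l, q'))"
      using par1 by (simp add: parallel_excess_def)
    also have "\<dots> \<le> ennreal (?A + ?P)"
      by (intro ennreal_leI) (simp add: parallel_excess_nonneg \<psi>)
    finally show ?thesis .
  next
    case par2
    have "?I = (\<integral>\<^sup>+x. approx_count y (\<psi> l) q' x * approx_count y (\<psi> k) q x * indicator unit_cube x \<partial>lborel)"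
      by (simp add: mult_ac)
    also have "\<dots> \<le> ennreal (8 ^ CARD('m) * (\<psi> l ^ CARD('m) * \<psi> k ^ CARD('m)) + 4 ^ CARD('m) * (\<psi> l / real (l div gcd l k)) ^ CARD('m))"
      by (rule approx_count_parallel[where j=j]) (use par2 q \<psi> denoms_nth in auto)
    also have "\<dots> = ennreal (?A + parallel_excess \<psi> CARD('m) (l, q') (k, q))"
      using par2 by (simp add: parallel_excess_def mult_ac)
    also have "\<dots> \<le> ennreal (?A + ?P)"
      by (intro ennreal_leI) (simp add: parallel_excess_nonneg \<psi>)
    finally show ?thesis .
  qed
qed

text \<open>A parallel \<open>q'\<close> is determined by \<open>q\<close>, and \<open>q\<close>
  must be divisible by \<open>d = k / gcd k l\<close>, which leaves at most
  \<open>(k / d)^(n - 1)\<close> vectors. Together with the factor \<open>d^(-m)\<close> of the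
  excess the saving is \<open>d^(n - 1 + m)\<close>, at least \<open>d^3\<close>.\<close>

lemma sum_parallel_excess_fixed_le:
  fixes j :: "'n::finite"
  assumes \<psi>: "\<And>k. 0 \<le> \<psi> k" and kl: "0 < k" "0 < l" "l \<le> k" and nm: "CARD('n) + m \<ge> 4"
  shows "(\<Sum>q\<in>denoms j k. \<Sum>q'\<in>denoms j l. parallel_excess \<psi> m (k, q) (l, q'))
     \<le> 4 ^ m * (real k ^ (CARD('n) - 1) * \<psi> k ^ m) * (1 / real (k div gcd k l) ^ 3)"
proof -
  define d where "d = k div gcd k l"
  have d: "d > 0" "d dvd k" using kl by (auto simp: d_def div_greater_zero_iff gcd_le1_nat dvd_div_eq_mult intro: dvdI[of _ _ "gcd k l"])
  define B where "B = 4 ^ m * (\<psi> k / real d) ^ m"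
  have B: "B \<ge> 0" using \<psi> by (simp add: B_def)
  define S where "S = {(q, q') \<in> denoms j k \<times> denoms j l. \<forall>i. int k * q' $ i = int l * q $ i}"
  have fin: "finite (denoms j k \<times> denoms j l)" by (simp add: finite_denoms)
  have "(\<Sum>q\<in>denoms j k. \<Sum>q'\<in>denoms j l. parallel_excess \<psi> m (k, q) (l, q')) =
      (\<Sum>x\<in>denoms j k \<times> denoms j l. if x \<in> S then B else 0)"
    unfolding sum.cartesian_product
    by (rule sum.cong) (auto simp: S_def parallel_excess_def B_def d_def kl split: if_splits)
  also have "\<dots> = real (card S) * B"
  proof -
    have "(denoms j k \<times> denoms j l) \<inter> {x. x \<in> S} = S" by (auto simp: S_def)
    then show ?thesis using fin by (simp add: sum.If_cases)
  qed
  also have "\<dots> \<le> (real k / real d) ^ (CARD('n) - 1) * B"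
  proof (rule mult_right_mono[OF _ B])
    have "card S \<le> card {q \<in> denoms j k. \<forall>i. int d dvd q $ i}"
    proof (rule card_inj_on_le[of fst])
      show "inj_on fst S"
      proof (rule inj_onI, clarsimp simp: S_def)
        fix q b c assume "\<forall>i. int k * b $ i = int l * q $ i" "\<forall>i. int k * c $ i = int l * q $ i"
        then have "int k * b $ i = int k * c $ i" for i by simp
        then show "b = c" using kl by (simp add: vec_eq_iff)
      qed
      show "finite {q \<in> denoms j k. \<forall>i. int d dvd q $ i}" by (simp add: finite_denoms)
      show "fst ` S \<subseteq> {q \<in> denoms j k. \<forall>i. int d dvd q $ i}"
        using approx_count_parallel(1)[OF denoms_nth denoms_nth kl(1,2), of _ j _ 0 0] unfolding S_def d_def by auto
    qed
    also have "\<dots> \<le> (k div d) ^ (CARD('n) - 1)" by (rule card_denoms_dvd_le[OF d(1)])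
    finally have "real (card S) \<le> real ((k div d) ^ (CARD('n) - 1))" by (rule of_nat_mono)
    also have "\<dots> = (real k / real d) ^ (CARD('n) - 1)" using d by (simp add: real_of_nat_div)
    finally show "real (card S) \<le> (real k / real d) ^ (CARD('n) - 1)" .
  qed
  also have "\<dots> = 4 ^ m * (real k ^ (CARD('n) - 1) * \<psi> k ^ m) * (1 / real d ^ (CARD('n) - 1 + m))"
    by (simp only: B_def power_divide power_add) (simp add: field_simps)
  also have "\<dots> \<le> 4 ^ m * (real k ^ (CARD('n) - 1) * \<psi> k ^ m) * (1 / real d ^ 3)"
    using \<psi> d nm by (intro mult_left_mono divide_left_mono power_increasing) auto
  finally show ?thesis by (simp add: d_def)
qed

lemma sum_parallel_excess_le:
  fixes j :: "'n::finite" and N :: nat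
  assumes \<psi>: "\<And>k. 0 \<le> \<psi> k" and nm: "CARD('n) + m \<ge> 4"
  shows "(\<Sum>a\<in>Sigma {1..N} (denoms j). \<Sum>b\<in>Sigma {1..N} (denoms j). parallel_excess \<psi> m a b)
     \<le> 2 * 4 ^ m * (\<Sum>k=1..N. real k ^ (CARD('n) - 1) * \<psi> k ^ m)"
proof -
  have "(\<Sum>a\<in>Sigma {1..N} (denoms j). \<Sum>b\<in>Sigma {1..N} (denoms j). parallel_excess \<psi> m a b) =
     (\<Sum>k=1..N. \<Sum>q\<in>denoms j k. \<Sum>l=1..N. \<Sum>q'\<in>denoms j l. parallel_excess \<psi> m (k, q) (l, q'))"
    by (simp add: sum_Sigma_pair finite_denoms)
  also have "\<dots> = (\<Sum>k=1..N. \<Sum>l=1..N. \<Sum>q\<in>denoms j k. \<Sum>q'\<in>denoms j l. parallel_excess \<psi> m (k, q) (l, q'))"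
    by (intro sum.cong[OF refl]) (rule sum.swap)
  also have "\<dots> \<le> (\<Sum>k=1..N. 4 ^ m * (real k ^ (CARD('n) - 1) * \<psi> k ^ m) * 2)"
  proof (rule sum_mono)
    fix k assume k: "k \<in> {1..N}"
    let ?c = "4 ^ m * (real k ^ (CARD('n) - 1) * \<psi> k ^ m)"
    have "(\<Sum>l=1..N. \<Sum>q\<in>denoms j k. \<Sum>q'\<in>denoms j l. parallel_excess \<psi> m (k, q) (l, q')) =
      (\<Sum>l=1..k. \<Sum>q\<in>denoms j k. \<Sum>q'\<in>denoms j l. parallel_excess \<psi> m (k, q) (l, q'))"
      by (rule sum.mono_neutral_right) (use k in \<open>auto simp: parallel_excess_def intro!: sum.neutral\<close>)
    also have "\<dots> \<le> (\<Sum>l=1..k. ?c * (1 / real (k div gcd k l) ^ 3))"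
      using k nm by (intro sum_mono sum_parallel_excess_fixed_le \<psi>) auto
    also have "\<dots> = ?c * (\<Sum>l=1..k. 1 / real (k div gcd k l) ^ 3)"
      by (simp only: sum_distrib_left)
    also have "\<dots> \<le> ?c * 2"
      using \<psi> by (intro mult_left_mono sum_reduced_denominators_le) auto
    finally show "(\<Sum>l=1..N. \<Sum>q\<in>denoms j k. \<Sum>q'\<in>denoms j l. parallel_excess \<psi> m (k, q) (l, q')) \<le> ?c * 2" .
  qed
  finally show ?thesis by (simp add: sum_distrib_left mult_ac)
qed

text \<open>Expanding the square gives all ordered pairs: the products sum to \<open>S^2\<close>,
  and the excess terms, taken in both orders and including the diagonal, to a multiple of
  \<open>S\<close>. The translation by \<open>w\<close> lets the bound be used on a unit cube around
  any chosen point.\<close>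

lemma second_moment:
  fixes y :: "real ^ 'm" and j :: "'n::finite" and w :: "real ^ 'm ^ 'n" and N :: nat
  assumes \<psi>: "\<And>k. 0 \<le> \<psi> k" and nm: "CARD('n) + CARD('m) \<ge> 4"
  defines "S \<equiv> (\<Sum>k=1..N. real k ^ (CARD('n) - 1) * \<psi> k ^ CARD('m))"
  shows "(\<integral>\<^sup>+x. (\<Sum>k=1..N. \<Sum>q\<in>denoms j k. approx_count y (\<psi> k) q (x + w)) ^ 2 * indicator unit_cube x \<partial>lborel)
    \<le> ennreal (8 ^ CARD('m) * S ^ 2 + 4 * 4 ^ CARD('m) * S)"
proof -
  define D where "D = Sigma {1..N} (denoms j)"
  have fD: "finite D" by (auto simp: D_def finite_denoms)
  define G where "G = (\<lambda>a :: nat \<times> (int ^ 'n). approx_count y (\<psi> (fst a)) (snd a))"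
  have [measurable]: "G a \<in> borel_measurable borel" for a by (simp add: G_def)
  define F where "F = (\<lambda>x. \<Sum>a\<in>D. G a x)"
  have F: "(\<Sum>k=1..N. \<Sum>q\<in>denoms j k. approx_count y (\<psi> k) q x) = F x" for x
    unfolding F_def D_def G_def by (simp add: sum_Sigma_pair finite_denoms)
  have "lattice_periodic (\<lambda>x. F x ^ 2)"
    by (simp add: lattice_periodic_def F_def G_def periodic_approx_count[unfolded lattice_periodic_def, rule_format])
  then have "(\<integral>\<^sup>+x. F (x + w) ^ 2 * indicator unit_cube x \<partial>lborel) = (\<integral>\<^sup>+x. F x ^ 2 * indicator unit_cube x \<partial>lborel)"
    by (intro nn_integral_periodic_shift) (auto simp: F_def)
  also have "\<dots> = (\<integral>\<^sup>+x. (\<Sum>a\<in>D. \<Sum>b\<in>D. G a x * G b x * indicator unit_cube x) \<partial>lborel)"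
    unfolding F_def power2_eq_square sum_product by (simp only: sum_distrib_right)
  also have "\<dots> = (\<Sum>a\<in>D. \<Sum>b\<in>D. \<integral>\<^sup>+x. G a x * G b x * indicator unit_cube x \<partial>lborel)"
    by (simp add: nn_integral_sum)
  also have "\<dots> \<le> (\<Sum>a\<in>D. \<Sum>b\<in>D. ennreal (8 ^ CARD('m) * (\<psi> (fst a) ^ CARD('m) * \<psi> (fst b) ^ CARD('m)) +
        (parallel_excess \<psi> CARD('m) a b + parallel_excess \<psi> CARD('m) b a)))"
    unfolding G_def D_def by (intro sum_mono) (use approx_count_pair_le[of _ j _ _ _ \<psi> y] \<psi> in \<open>fastforce\<close>)
  also have "\<dots> = ennreal (\<Sum>a\<in>D. \<Sum>b\<in>D. 8 ^ CARD('m) * (\<psi> (fst a) ^ CARD('m) * \<psi> (fst b) ^ CARD('m)) +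
        (parallel_excess \<psi> CARD('m) a b + parallel_excess \<psi> CARD('m) b a))"
    by (simp add: sum_nonneg add_nonneg_nonneg parallel_excess_nonneg \<psi> del: ennreal_plus)
  also have "\<dots> \<le> ennreal (8 ^ CARD('m) * S ^ 2 + 4 * 4 ^ CARD('m) * S)"
  proof (rule ennreal_leI)
    have S: "(\<Sum>a\<in>D. \<psi> (fst a) ^ CARD('m)) = S"
      unfolding D_def S_def by (simp add: sum_Sigma_pair finite_denoms card_denoms)
    have "(\<Sum>a\<in>D. \<Sum>b\<in>D. 8 ^ CARD('m) * (\<psi> (fst a) ^ CARD('m) * \<psi> (fst b) ^ CARD('m)) +
        (parallel_excess \<psi> CARD('m) a b + parallel_excess \<psi> CARD('m) b a)) =
       (\<Sum>a\<in>D. \<Sum>b\<in>D. 8 ^ CARD('m) * (\<psi> (fst a) ^ CARD('m) * \<psi> (fst b) ^ CARD('m))) +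
       ((\<Sum>a\<in>D. \<Sum>b\<in>D. parallel_excess \<psi> CARD('m) a b) + (\<Sum>a\<in>D. \<Sum>b\<in>D. parallel_excess \<psi> CARD('m) b a))"
      by (simp only: sum.distrib)
    also have "(\<Sum>a\<in>D. \<Sum>b\<in>D. parallel_excess \<psi> CARD('m) b a) = (\<Sum>a\<in>D. \<Sum>b\<in>D. parallel_excess \<psi> CARD('m) a b)"
      by (rule sum.swap)
    also have "(\<Sum>a\<in>D. \<Sum>b\<in>D. 8 ^ CARD('m) * (\<psi> (fst a) ^ CARD('m) * \<psi> (fst b) ^ CARD('m))) = 8 ^ CARD('m) * (S * S)"
      unfolding S[symmetric] sum_product by (simp only: sum_distrib_left)
    finally show "(\<Sum>a\<in>D. \<Sum>b\<in>D. 8 ^ CARD('m) * (\<psi> (fst a) ^ CARD('m) * \<psi> (fst b) ^ CARD('m)) +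
        (parallel_excess \<psi> CARD('m) a b + parallel_excess \<psi> CARD('m) b a)) \<le> 8 ^ CARD('m) * S ^ 2 + 4 * 4 ^ CARD('m) * S"
      using sum_parallel_excess_le[where \<psi>=\<psi> and N=N and j=j, OF \<psi> nm] unfolding D_def[symmetric] S_def[symmetric] power2_eq_square
      by linarith
  qed
  finally show ?thesis unfolding F .
qed

subsection \<open>Counting primitive points\<close>

definition progression :: "nat \<Rightarrow> int \<Rightarrow> nat \<Rightarrow> int set" where
  "progression M a R = (\<lambda>t. 1 + int M * (a + t)) ` {0..<int R}"

lemma finite_progression: "finite (progression M a R)"
  by (simp add: progression_def)

lemma card_progression: "0 < M \<Longrightarrow> card (progression M a R) = R"
  by (subst progression_def, subst card_image) (auto simp: inj_on_def)

text \<open>As \<open>l\<close> is coprime to \<open>M\<close>, two indices \<open>t\<close> that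
  give multiples of \<open>l\<close> differ by a multiple of \<open>l\<close>. Hence a block of
  \<open>l\<close> consecutive indices contains at most one of them, and at most
  \<open>R / l + 1\<close> blocks occur.\<close>

lemma card_progression_dvd_le:
  assumes "0 < M" "0 < l" "coprime l M"
  shows "real (card {x \<in> progression M a R. int l dvd x}) \<le> real R / real l + 1"
proof -
  define T where "T = {t \<in> {0..<int R}. int l dvd 1 + int M * (a + t)}"
  have "{x \<in> progression M a R. int l dvd x} = (\<lambda>t. 1 + int M * (a + t)) ` T"
    by (auto simp: progression_def T_def)
  then have "card {x \<in> progression M a R. int l dvd x} \<le> card T"
    by (metis card_image_le T_def finite_Collect_conjI finite_atLeastLessThan_int Collect_mem_eq)
  also have "card T \<le> card {0..R div l}"
  proof (rule card_inj_on_le[of "\<lambda>t. nat t div l"])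
    show "inj_on (\<lambda>t. nat t div l) T"
    proof (rule inj_onI)
      fix t t' assume t: "t \<in> T" "t' \<in> T" and eq: "nat t div l = nat t' div l"
      have "int l dvd (1 + int M * (a + t)) - (1 + int M * (a + t'))"
        using t unfolding T_def by (intro dvd_diff) auto
      then have "int l dvd int M * (t - t')" by (simp add: algebra_simps)
      then have dvd: "int l dvd t - t'" using assms(3) by (simp add: coprime_dvd_mult_right_iff)
      have "t div int l = t' div int l"
      proof -
        have "int (nat t div l) = t div int l" "int (nat t' div l) = t' div int l"
          using t by (auto simp: T_def zdiv_int)
        then show ?thesis using eq by simp
      qed
      moreover have "t mod int l = t' mod int l" using dvd by (simp add: mod_eq_dvd_iff)
      ultimately show "t = t'" by (metis div_mult_mod_eq)
    qed
    show "(\<lambda>t. nat t div l) ` T \<subseteq> {0..R div l}"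
      by (auto simp: T_def intro!: div_le_mono)
  qed simp
  also have "\<dots> = R div l + 1" by simp
  finally have "real (card {x \<in> progression M a R. int l dvd x}) \<le> real (R div l) + 1" by linarith
  also have "\<dots> \<le> real R / real l + 1" using floor_divide_of_nat_eq[of R l, where ?'a=real] by linarith
  finally show ?thesis .
qed

text \<open>All free coordinates are kept in the residue class \<open>1\<close> modulo \<open>M\<close>, which rules out common prime
  factors dividing \<open>M\<close>.\<close>

definition class_denoms :: "'n \<Rightarrow> nat \<Rightarrow> nat \<Rightarrow> nat \<Rightarrow> (int ^ 'n) set" where
  "class_denoms j k M K = {q. \<forall>i. q $ i \<in> (if i = j then {int k} else progression M 0 K)}"

definition class_nums :: "nat \<Rightarrow> ('m \<Rightarrow> int) \<Rightarrow> nat \<Rightarrow> (int ^ 'm) set" where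
  "class_nums M a R = {p. \<forall>s. p $ s \<in> progression M (a s) R}"

lemma finite_class_denoms: "finite (class_denoms j k M K)"
  unfolding class_denoms_def by (rule finite_vec_product) (simp add: finite_progression)

lemma finite_class_nums: "finite (class_nums M a R)"
  unfolding class_nums_def by (rule finite_vec_product) (simp add: finite_progression)

lemma card_class_denoms: "0 < M \<Longrightarrow> card (class_denoms (j :: 'n::finite) k M K) = K ^ (CARD('n) - 1)"
proof -
  assume M: "0 < M"
  have "card (class_denoms j k M K) = (\<Prod>i\<in>UNIV. card (if i = j then {int k} else progression M 0 K))"
    unfolding class_denoms_def by (rule card_vec_product)
  also have "\<dots> = (\<Prod>i\<in>UNIV. if i = j then 1 else K)" by (rule prod.cong) (auto simp: card_progression M)
  finally show ?thesis by (simp add: prod_if_eq_power)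
qed

lemma card_class_nums: "0 < M \<Longrightarrow> card (class_nums M (a :: 'm::finite \<Rightarrow> int) R) = R ^ CARD('m)"
  unfolding class_nums_def by (subst card_vec_product) (simp add: card_progression)

lemma prod_if_mem_eq_power:
  fixes c :: real and U :: "'k::finite set"
  shows "(\<Prod>i\<in>UNIV. if i \<in> U then c else 1) = c ^ card U"
  by (simp add: prod.If_cases)

text \<open>The density is weakened from \<open>1 / l + 1 / K\<close> to
  \<open>1 / l + 1 / R\<close> so that denominators and numerators share one factor per coordinate
  and the exponents can be added. The entry \<open>j\<close> stays out of \<open>U\<close> because
  it has the fixed value \<open>k\<close>.\<close>

lemma card_class_denoms_dvd_le:
  fixes j :: "'n::finite"
  assumes M: "0 < M" "0 < l" "coprime l M" and RK: "0 < R" "R \<le> K" and U: "j \<notin> U"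
  shows "real (card {q \<in> class_denoms j k M K. \<forall>i\<in>U. int l dvd q $ i})
    \<le> real K ^ (CARD('n) - 1) * (1 / real l + 1 / real R) ^ card U"
proof -
  let ?P = "progression M 0 K"
  let ?c = "1 / real l + 1 / real R"
  have eq: "{q \<in> class_denoms j k M K. \<forall>i\<in>U. int l dvd q $ i} =
     {q. \<forall>i. q $ i \<in> (if i = j then {int k} else if i \<in> U then {x \<in> ?P. int l dvd x} else ?P)}"
    using U by (auto simp: class_denoms_def split: if_splits)
  have "real K / real l + 1 \<le> real K * ?c" using RK by (simp add: field_simps)
  then have 1: "real (card {x \<in> ?P. int l dvd x}) \<le> real K * ?c"
    using card_progression_dvd_le[OF M, of 0 K] by linarith
  have "real (card {q \<in> class_denoms j k M K. \<forall>i\<in>U. int l dvd q $ i}) =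
    (\<Prod>i\<in>UNIV. real (card (if i = j then {int k} else if i \<in> U then {x \<in> ?P. int l dvd x} else ?P)))"
    unfolding eq card_vec_product by simp
  also have "\<dots> \<le> (\<Prod>i\<in>UNIV. (if i = j then 1 else real K) * (if i \<in> U then ?c else 1))"
    using 1 U by (intro prod_mono) (auto simp: card_progression M)
  also have "\<dots> = real K ^ (CARD('n) - 1) * ?c ^ card U"
    by (simp only: prod.distrib prod_if_eq_power prod_if_mem_eq_power mult_1_left)
  finally show ?thesis .
qed

lemma card_class_nums_dvd_le:
  fixes a :: "'m::finite \<Rightarrow> int"
  assumes M: "0 < M" "0 < l" "coprime l M" and R: "0 < R"
  shows "real (card {p \<in> class_nums M a R. \<forall>s\<in>V. int l dvd p $ s})
    \<le> real R ^ CARD('m) * (1 / real l + 1 / real R) ^ card V"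
proof -
  let ?P = "\<lambda>s. progression M (a s) R"
  let ?c = "1 / real l + 1 / real R"
  have eq: "{p \<in> class_nums M a R. \<forall>s\<in>V. int l dvd p $ s} =
     {p. \<forall>s. p $ s \<in> (if s \<in> V then {x \<in> ?P s. int l dvd x} else ?P s)}"
    by (auto simp: class_nums_def split: if_splits)
  have "real R / real l + 1 = real R * ?c" using R by (simp add: field_simps)
  then have 1: "real (card {x \<in> ?P s. int l dvd x}) \<le> real R * ?c" for s
    using card_progression_dvd_le[OF M, of "a s" R] by linarith
  have "real (card {p \<in> class_nums M a R. \<forall>s\<in>V. int l dvd p $ s}) =
    (\<Prod>s\<in>UNIV. real (card (if s \<in> V then {x \<in> ?P s. int l dvd x} else ?P s)))"
    unfolding eq card_vec_product by simp
  also have "\<dots> \<le> (\<Prod>s\<in>UNIV. real R * (if s \<in> V then ?c else 1))"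
    using 1 by (intro prod_mono) (auto simp: card_progression M)
  also have "\<dots> = real R ^ CARD('m) * ?c ^ card V"
    by (simp only: prod.distrib prod_if_mem_eq_power prod_constant)
  finally show ?thesis .
qed

text \<open>The two coordinates in \<open>S\<close> may be numerators, denominators or one of each;
  every one contributes the same factor, so the square appears in all cases. The square is what
  makes the sum over primes converge.\<close>

lemma card_class_pairs_dvd_le:
  fixes j :: "'n::finite" and a :: "int ^ 'n \<Rightarrow> 'm::finite \<Rightarrow> int" and S :: "('m + 'n) set"
  assumes M: "0 < M" "0 < l" "coprime l M" and RK: "0 < R" "R \<le> K" and S: "Inr j \<notin> S" "card S = 2"
  shows "real (card {(q, p) \<in> Sigma (class_denoms j k M K) (\<lambda>q. class_nums M (a q) R). \<forall>c\<in>S. int l dvd coord (p, q) c})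
    \<le> real K ^ (CARD('n) - 1) * real R ^ CARD('m) * (1 / real l + 1 / real R) ^ 2"
proof -
  define U V where "U = {i. Inr i \<in> S}" and "V = {s. Inl s \<in> S}"
  have SUV: "S = Inl ` V \<union> Inr ` U" unfolding U_def V_def
    by (auto simp: image_iff) (metis sum.exhaust)
  have "card S = card (Inl ` V :: ('m + 'n) set) + card (Inr ` U :: ('m + 'n) set)"
    unfolding SUV by (rule card_Un_disjoint) auto
  then have UV: "card V + card U = 2" using S(2) by (simp add: card_image)
  let ?c = "1 / real l + 1 / real R"
  let ?Q = "{q \<in> class_denoms j k M K. \<forall>i\<in>U. int l dvd q $ i}"
  let ?P = "\<lambda>q. {p \<in> class_nums M (a q) R. \<forall>s\<in>V. int l dvd p $ s}"
  have "{(q, p) \<in> Sigma (class_denoms j k M K) (\<lambda>q. class_nums M (a q) R). \<forall>c\<in>S. int l dvd coord (p, q) c} = Sigma ?Q ?P"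
    unfolding SUV by (auto simp: coord_def ball_Un)
  then have "real (card {(q, p) \<in> Sigma (class_denoms j k M K) (\<lambda>q. class_nums M (a q) R). \<forall>c\<in>S. int l dvd coord (p, q) c})
    = (\<Sum>q\<in>?Q. real (card (?P q)))"
    by (simp add: card_SigmaI finite_class_denoms finite_class_nums)
  also have "\<dots> \<le> (\<Sum>q\<in>?Q. real R ^ CARD('m) * ?c ^ card V)"
    by (intro sum_mono card_class_nums_dvd_le M RK)
  also have "\<dots> = real (card ?Q) * (real R ^ CARD('m) * ?c ^ card V)" by simp
  also have "\<dots> \<le> (real K ^ (CARD('n) - 1) * ?c ^ card U) * (real R ^ CARD('m) * ?c ^ card V)"
    using S by (intro mult_right_mono card_class_denoms_dvd_le M RK) (auto simp: U_def)
  also have "\<dots> = real K ^ (CARD('n) - 1) * real R ^ CARD('m) * ?c ^ (card V + card U)"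
    by (simp add: power_add mult_ac)
  finally show ?thesis by (simp only: UV)
qed

lemma sum_inverse_squares_tail_le:
  assumes "0 < L"
  shows "(\<Sum>l\<in>{L<..H}. 1 / real l ^ 2) \<le> 1 / real L"
proof (cases "L \<le> H")
  case True
  then have "(\<Sum>l\<in>{L<..H}. 1 / real l ^ 2) \<le> 1 / real L - 1 / real H"
  proof (induction H rule: dec_induct)
    case (step H)
    have "{L<..Suc H} = insert (Suc H) {L<..H}" using step by auto
    then have "(\<Sum>l\<in>{L<..Suc H}. 1 / real l ^ 2) = 1 / real (Suc H) ^ 2 + (\<Sum>l\<in>{L<..H}. 1 / real l ^ 2)" by simp
    moreover have "1 / real (Suc H) ^ 2 \<le> 1 / real H - 1 / real (Suc H)"
      using step assms by (simp add: divide_simps power2_eq_square)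
    ultimately show ?case using step by linarith
  qed simp
  then show ?thesis by (smt (verit) divide_nonneg_nonneg of_nat_0_le_iff)
qed simp

text \<open>A union bound over parts and primes. If the gcd of a part is not 1, some prime
  \<open>l\<close> divides all its coordinates; the residue 1 modulo the factorial of
  \<open>L\<close> forces \<open>l > L\<close>, and the bound \<open>H\<close> on the coordinates
  forces \<open>l \<le> H\<close>. The bad proportion is at most \<open>card \<pi>\<close> times the
  sum of \<open>(1 / l + 1 / R)^2\<close> over \<open>L < l \<le> H\<close>, which
  \<open>small\<close> bounds by one half.\<close>

lemma class_pairs_coprime_count:
  fixes j :: "'n::finite" and a :: "int ^ 'n \<Rightarrow> 'm::finite \<Rightarrow> int" and \<pi> :: "('m + 'n) set set"
  assumes \<pi>: "\<And>A. A \<in> \<pi> \<Longrightarrow> card (A - {Inr j}) \<ge> 2"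
    and L: "2 \<le> L" "M = fact L" and RK: "0 < R" "R \<le> K" and MK: "M * K \<le> k"
    and H: "k \<le> H" "\<And>q p s. q \<in> class_denoms j k M K \<Longrightarrow> p \<in> class_nums M (a q) R \<Longrightarrow> \<bar>p $ s\<bar> \<le> int H"
    and small: "real (card \<pi>) * (2 / real L + 2 * real H / real R ^ 2) \<le> 1 / 2"
  shows "real (card {(q, p) \<in> Sigma (class_denoms j k M K) (\<lambda>q. class_nums M (a q) R). (p, q) \<in> coprime_on_parts \<pi>})
    \<ge> real K ^ (CARD('n) - 1) * real R ^ CARD('m) / 2"
proof -
  define W where "W = Sigma (class_denoms j k M K) (\<lambda>q. class_nums M (a q) R)"
  define G where "G = {(q, p) \<in> W. (p, q) \<in> coprime_on_parts \<pi>}"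
  define X where "X = real K ^ (CARD('n) - 1) * real R ^ CARD('m)"
  have M: "0 < M" "2 \<le> M" using L by (auto intro: order_trans[OF _ fact_ge_self])
  have fW: "finite W" by (auto simp: W_def finite_class_denoms finite_class_nums)
  have cW: "real (card W) = X"
    by (simp add: W_def X_def card_SigmaI finite_class_denoms finite_class_nums card_class_nums card_class_denoms M)
  have "\<exists>S. S \<subseteq> A - {Inr j} \<and> card S = 2" if "A \<in> \<pi>" for A
    using obtain_subset_with_card_n[OF \<pi>[OF that]] by blast
  \<comment> \<open>Two coordinates to be sieved are selected in each part, avoiding the rigid
    \<open>Inr j\<close>.\<close>
  then obtain S where S: "\<And>A. A \<in> \<pi> \<Longrightarrow> S A \<subseteq> A - {Inr j} \<and> card (S A) = 2"
    by metis
  have f\<pi>: "finite \<pi>" by simp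
  define Pr where "Pr = {l \<in> {L<..H}. prime l}"
  define Bad where "Bad = (\<lambda>A l. {(q, p) \<in> W. \<forall>c\<in>S A. int l dvd coord (p, q) c})"
  have val: "\<exists>t. coord (p, q) c = 1 + int M * t" "\<bar>coord (p, q) c\<bar> \<le> int H"
    if "(q, p) \<in> W" "c \<noteq> Inr j" for p q c
  proof -
    have qi: "\<exists>t. 0 \<le> t \<and> t < int K \<and> q $ i = 1 + int M * t" if "i \<noteq> j" for i
      using \<open>(q, p) \<in> W\<close> that by (auto simp: W_def class_denoms_def progression_def dest!: spec[of _ i]) blast
    have "\<bar>q $ i\<bar> \<le> int H" if ij: "i \<noteq> j" for i
    proof -
      obtain t where t: "0 \<le> t" "t < int K" "q $ i = 1 + int M * t" using qi[OF ij] by blast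
      have "int M * (t + 1) \<le> int M * int K" using t by (intro mult_left_mono) auto
      then have "int M * t + int M \<le> int k" using MK by (simp add: algebra_simps flip: of_nat_mult)
      then show ?thesis using t M H(1) by simp
    qed
    moreover have "\<exists>t. p $ s = 1 + int M * t" for s
      using \<open>(q, p) \<in> W\<close> by (auto simp: W_def class_nums_def progression_def dest!: spec[of _ s])
    moreover have "\<bar>p $ s\<bar> \<le> int H" for s
      using \<open>(q, p) \<in> W\<close> H(2) by (auto simp: W_def)
    ultimately show "\<exists>t. coord (p, q) c = 1 + int M * t" "\<bar>coord (p, q) c\<bar> \<le> int H"
      using qi that(2) by (auto simp: coord_def split: sum.splits) blast
  qed
  have "W - G \<subseteq> (\<Union>A\<in>\<pi>. \<Union>l\<in>Pr. Bad A l)"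
  proof
    fix x assume "x \<in> W - G"
    then obtain q p where x: "x = (q, p)" "(q, p) \<in> W" and "(p, q) \<notin> coprime_on_parts \<pi>"
      by (auto simp: G_def)
    then obtain A where A: "A \<in> \<pi>" "Gcd (coord (p, q) ` A) \<noteq> 1" by (auto simp: coprime_on_parts_def)
    let ?g = "Gcd (coord (p, q) ` A)"
    have nu: "\<not> is_unit ?g" using A by (metis Gcd_int_greater_eq_0 abs_of_nonneg zdvd1_eq)
    obtain c where c: "c \<in> S A" using S[OF A(1)] by fastforce
    have cA: "c \<in> A" "c \<noteq> Inr j" using S[OF A(1)] c by auto
    obtain t where t: "coord (p, q) c = 1 + int M * t" using val(1)[OF x(2) cA(2)] by blast
    \<comment> \<open>A coordinate congruent to 1 modulo \<open>M \<ge> 2\<close> is nonzero. This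
      excludes the gcd 0 and makes every prime divisor at most the absolute value of the
      coordinate.\<close>
    have nz: "coord (p, q) c \<noteq> 0"
    proof
      assume "coord (p, q) c = 0"
      then have "int M * (- t) = 1" using t by simp
      then have "int M dvd 1" by (metis dvd_triv_left)
      then show False using M by simp
    qed
    have "?g dvd coord (p, q) c" using cA by (intro Gcd_dvd) auto
    then have "?g \<noteq> 0" using nz by auto
    with nu obtain l' where l': "l' dvd ?g" "prime l'" using prime_divisor_exists by blast
    define l where "l = nat l'"
    have "0 \<le> l'" using l'(2) by (rule prime_ge_0_int)
    then have il: "int l = l'" by (simp add: l_def)
    then have l: "prime l" "int l dvd ?g" using l' by (metis prime_nat_int_transfer, simp)
    have dvd: "int l dvd coord (p, q) c'" if "c' \<in> A" for c'
      using l(2) that by (meson Gcd_dvd dvd_trans image_eqI)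
    have "\<not> l \<le> L"
    proof
      assume "l \<le> L"
      then have "l dvd M" using l(1) L(2) by (simp add: prime_dvd_fact_iff)
      then have "int l dvd int M * t" by auto
      moreover have "int l dvd 1 + int M * t" using dvd[OF cA(1)] t by simp
      ultimately have "int l dvd 1" by (simp add: dvd_add_left_iff)
      then show False using l(1) by (simp add: not_prime_unit)
    qed
    moreover have "l \<le> H"
    proof -
      have "int l \<le> \<bar>coord (p, q) c\<bar>" using dvd[OF cA(1)] nz by (metis abs_of_nat dvd_imp_le_int)
      then show ?thesis using val(2)[OF x(2) cA(2)] by linarith
    qed
    ultimately have "l \<in> Pr" using l by (simp add: Pr_def)
    moreover have "x \<in> Bad A l" using x dvd S[OF A(1)] by (auto simp: Bad_def)
    ultimately show "x \<in> (\<Union>A\<in>\<pi>. \<Union>l\<in>Pr. Bad A l)" using A(1) by blast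
  qed
  moreover have fBad: "finite (Bad A l)" for A l
    using fW by (rule finite_subset[rotated]) (auto simp: Bad_def)
  have fPr: "finite Pr" by (simp add: Pr_def)
  ultimately have "card (W - G) \<le> card (\<Union>A\<in>\<pi>. \<Union>l\<in>Pr. Bad A l)"
    by (intro card_mono) (auto simp: f\<pi> fPr fBad)
  also have "\<dots> \<le> (\<Sum>A\<in>\<pi>. card (\<Union>l\<in>Pr. Bad A l))" by (rule card_UN_le[OF f\<pi>])
  also have "\<dots> \<le> (\<Sum>A\<in>\<pi>. \<Sum>l\<in>Pr. card (Bad A l))" by (intro sum_mono card_UN_le fPr)
  finally have "real (card (W - G)) \<le> real (\<Sum>A\<in>\<pi>. \<Sum>l\<in>Pr. card (Bad A l))" by (rule of_nat_mono)
  also have "\<dots> = (\<Sum>A\<in>\<pi>. \<Sum>l\<in>Pr. real (card (Bad A l)))" by simp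
  also have "\<dots> \<le> (\<Sum>A\<in>\<pi>. \<Sum>l\<in>Pr. X * (1 / real l + 1 / real R) ^ 2)"
  proof (intro sum_mono)
    fix A l assume A: "A \<in> \<pi>" and l: "l \<in> Pr"
    have "coprime l M"
      using l L by (auto simp: Pr_def prime_dvd_fact_iff intro!: prime_imp_coprime)
    then show "real (card (Bad A l)) \<le> X * (1 / real l + 1 / real R) ^ 2"
      unfolding Bad_def W_def X_def using S[OF A] M RK l
      by (intro card_class_pairs_dvd_le) (auto simp: Pr_def prime_gt_0_nat)
  qed
  also have "\<dots> = real (card \<pi>) * X * (\<Sum>l\<in>Pr. (1 / real l + 1 / real R) ^ 2)"
    by (simp add: sum_distrib_left mult.assoc)
  also have "\<dots> \<le> real (card \<pi>) * X * (2 / real L + 2 * real H / real R ^ 2)"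
  proof (rule mult_left_mono)
    \<comment> \<open>Passing from primes to all integers above \<open>L\<close> is affordable,
      since the inverse squares are summable and their tail is at most \<open>1 / L\<close>.\<close>
    have "(\<Sum>l\<in>Pr. (1 / real l + 1 / real R) ^ 2) \<le> (\<Sum>l\<in>{L<..H}. (1 / real l + 1 / real R) ^ 2)"
      by (rule sum_mono2) (auto simp: Pr_def)
    also have "\<dots> \<le> (\<Sum>l\<in>{L<..H}. 2 * (1 / real l ^ 2) + 2 / real R ^ 2)"
    proof (rule sum_mono)
      fix l
      have "(1 / real l + 1 / real R) ^ 2 \<le> 2 * (1 / real l) ^ 2 + 2 * (1 / real R) ^ 2"
        using zero_le_power2[of "1 / real l - 1 / real R"] by (simp add: power2_sum power2_diff)
      then show "(1 / real l + 1 / real R) ^ 2 \<le> 2 * (1 / real l ^ 2) + 2 / real R ^ 2"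
        by (simp add: power_one_over)
    qed
    also have "\<dots> = 2 * (\<Sum>l\<in>{L<..H}. 1 / real l ^ 2) + real (H - L) * (2 / real R ^ 2)"
      by (simp add: sum.distrib sum_distrib_left)
    also have "\<dots> \<le> 2 * (1 / real L) + real H * (2 / real R ^ 2)"
      using L by (intro add_mono mult_left_mono mult_right_mono sum_inverse_squares_tail_le) auto
    finally show "(\<Sum>l\<in>Pr. (1 / real l + 1 / real R) ^ 2) \<le> 2 / real L + 2 * real H / real R ^ 2"
      by (simp add: mult.commute)
  qed (simp add: X_def)
  also have "\<dots> \<le> X * (1 / 2)"
    using mult_left_mono[OF small, of X] by (simp add: X_def mult_ac)
  finally have "real (card (W - G)) \<le> X / 2" by simp
  moreover have "card W = card G + card (W - G)"
  proof -
    have "G \<subseteq> W" by (auto simp: G_def)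
    then show ?thesis using fW by (metis card_Diff_subset card_mono finite_subset le_add_diff_inverse)
  qed
  ultimately have "real (card G) \<ge> X / 2" using cW by linarith
  then show ?thesis unfolding G_def W_def X_def by simp
qed

section \<open>Coprime points near a prescribed target\<close>

lemma component_le_infnorm_matrix: "\<bar>(x :: real ^ 'm ^ 'n) $ i $ s\<bar> \<le> infnorm x"
proof -
  have "axis i (axis s 1) \<in> (Basis :: (real ^ 'm ^ 'n) set)" by (auto simp: Basis_vec_def)
  then have "\<bar>x \<bullet> axis i (axis s 1)\<bar> \<le> infnorm x" using infnorm_le_iff[of x "infnorm x"] by blast
  then show ?thesis by (simp add: inner_axis)
qed

lemma infnorm_denoms_mult_le:
  fixes w :: "real ^ 'm ^ 'n"
  assumes q: "q \<in> denoms j k" "0 < k"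
  shows "infnorm (real_vec q v* w) \<le> real CARD('n) * real k * infnorm w"
  unfolding infnorm_le_iff_cart
proof
  fix s
  have "\<bar>(real_vec q v* w) $ s\<bar> \<le> (\<Sum>i\<in>UNIV. \<bar>real_vec q $ i * w $ i $ s\<bar>)"
    unfolding vector_matrix_mult_nth by (rule sum_abs)
  also have "\<dots> \<le> (\<Sum>i\<in>(UNIV :: 'n set). real k * infnorm w)"
  proof (rule sum_mono)
    fix i
    have "\<bar>real_vec q $ i\<bar> \<le> real k"
      using denoms_bounds[OF q, of i] by (simp add: real_vec_def)
    then show "\<bar>real_vec q $ i * w $ i $ s\<bar> \<le> real k * infnorm w"
      unfolding abs_mult by (intro mult_mono component_le_infnorm_matrix) auto
  qed
  finally show "\<bar>(real_vec q v* w) $ s\<bar> \<le> real CARD('n) * real k * infnorm w" by simp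
qed

lemma class_denoms_subset:
  assumes "M * K \<le> k" "0 < M"
  shows "class_denoms j k M K \<subseteq> denoms j k"
proof
  fix q assume q: "q \<in> class_denoms j k M K"
  have "q $ i \<in> (if i = j then {int k} else {1..int k})" for i
  proof (cases "i = j")
    case True
    then show ?thesis using q by (auto simp: class_denoms_def dest!: spec[of _ i])
  next
    case False
    then obtain t where t: "0 \<le> t" "t < int K" "q $ i = 1 + int M * t"
      using q by (auto simp: class_denoms_def progression_def dest!: spec[of _ i])
    have "int M * (t + 1) \<le> int M * int K" using t by (intro mult_left_mono) auto
    also have "\<dots> \<le> int k" using assms(1) by (simp flip: of_nat_mult)
    finally have "int M * t + int M \<le> int k" by (simp add: distrib_left)
    moreover have "int M \<ge> 1" "int M * t \<ge> 0" using assms t by auto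
    ultimately show ?thesis using t False by auto
  qed
  then show "q \<in> denoms j k" by (simp add: denoms_def)
qed

text \<open>The start is rounded up, so the first term is at least \<open>\<alpha> - h / 2\<close>,
  the \<open>- 1\<close> compensating the residue 1; rounding loses less than \<open>M\<close>, so
  the last term stays below \<open>\<alpha> - h / 2 + M R\<close>.\<close>

lemma progression_window:
  assumes M: "0 < M" and R: "real M * real R \<le> h" and x: "x \<in> progression M \<lceil>(\<alpha> - h / 2 - 1) / real M\<rceil> R"
  shows "\<bar>of_int x - \<alpha>\<bar> \<le> h / 2"
proof -
  define c where "c = \<lceil>(\<alpha> - h / 2 - 1) / real M\<rceil>"
  obtain t where t: "0 \<le> t" "t < int R" "x = 1 + int M * (c + t)" using x by (auto simp: progression_def c_def)
  have c: "(\<alpha> - h / 2 - 1) / real M \<le> of_int c" "of_int c < (\<alpha> - h / 2 - 1) / real M + 1"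
    unfolding c_def by linarith+
  then have c': "\<alpha> - h / 2 - 1 \<le> real M * of_int c" "real M * of_int c < \<alpha> - h / 2 - 1 + real M"
    using M by (simp_all add: field_simps)
  have "real M * of_int t \<le> real M * (real R - 1)" using t by (intro mult_left_mono) linarith+
  moreover have "real M * of_int t \<ge> 0" using t by simp
  moreover have "of_int x = 1 + real M * of_int c + real M * of_int t" using t by (simp add: distrib_left)
  ultimately show ?thesis using c' R by (simp only: right_diff_distrib)
qed

lemma half_le_floor: "1 \<le> (z :: real) \<Longrightarrow> z / 2 \<le> of_int \<lfloor>z\<rfloor>"
proof -
  assume "1 \<le> z"
  then have "1 \<le> \<lfloor>z\<rfloor>" by simp
  then show ?thesis by linarith
qed

text \<open>For each denominator the numerators run through a window of width
  \<open>k \<delta> / 4\<close> around \<open>q b - y\<close>, and the sieve leaves at least half of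
  the candidates. The quantifier order matters: \<open>c\<close> precedes \<open>\<delta>\<close>
  and \<open>B\<close>, so the proportion is uniform over cube sizes and centres, and only
  \<open>k0\<close> depends on them.\<close>

lemma primitive_count:
  fixes j :: "'n::finite" and y :: "real ^ 'm" and \<pi> :: "('m + 'n) set set"
  assumes \<pi>: "\<forall>A\<in>\<pi>. card (A - {Inr j}) \<ge> 2"
  shows "\<exists>c>0. \<forall>\<delta> B. 0 < \<delta> \<longrightarrow> \<delta> \<le> 1 \<longrightarrow> 0 \<le> B \<longrightarrow> (\<exists>k0. \<forall>k\<ge>k0. \<forall>b :: real ^ 'm ^ 'n. infnorm b \<le> B \<longrightarrow>
    (\<exists>W. finite W \<and> c * (real k ^ (CARD('n) - 1) * (real k * \<delta>) ^ CARD('m)) \<le> real (card W) \<and>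
      (\<forall>(q, p)\<in>W. q \<in> denoms j k \<and> (p, q) \<in> coprime_on_parts \<pi> \<and>
        infnorm (real_vec q v* b - real_vec p - y) \<le> real k * \<delta> / 8)))"
proof -
  \<comment> \<open>The multiple 8 makes \<open>2 * card \<pi> / L\<close> at most 1/4, half of what
    the sieve may lose; the summand 2 ensures \<open>L \<ge> 2\<close>.\<close>
  define L where "L = 8 * card \<pi> + 2"
  define M :: nat where "M = fact L"
  have M: "0 < M" by (simp add: M_def)
  \<comment> \<open>The factors come from \<open>K \<ge> k / (2 M)\<close>, from
    \<open>R \<ge> k \<delta> / (8 M)\<close> and from the half that survives the sieve.\<close>
  define c where "c = (1 / (2 * real M)) ^ (CARD('n) - 1) * (1 / (8 * real M)) ^ CARD('m) / 2"
  have c: "c > 0" using M by (simp add: c_def)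
  have "\<exists>k0. \<forall>k\<ge>k0. \<forall>b :: real ^ 'm ^ 'n. infnorm b \<le> B \<longrightarrow>
    (\<exists>W. finite W \<and> c * (real k ^ (CARD('n) - 1) * (real k * \<delta>) ^ CARD('m)) \<le> real (card W) \<and>
      (\<forall>(q, p)\<in>W. q \<in> denoms j k \<and> (p, q) \<in> coprime_on_parts \<pi> \<and>
        infnorm (real_vec q v* b - real_vec p - y) \<le> real k * \<delta> / 8))" if \<delta>: "0 < \<delta>" "\<delta> \<le> 1" and B: "0 \<le> B" for \<delta> B
  proof -
    \<comment> \<open>\<open>C k\<close> will bound every numerator: \<open>q b\<close> contributes
      at most \<open>n k B\<close>, and the vector \<open>y\<close> and the window account for the
      rest.\<close>
    define C where "C = nat \<lceil>real CARD('n) * B + infnorm y + 1\<rceil>"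
    have C: "real CARD('n) * B + infnorm y + 1 \<le> real C" unfolding C_def by linarith
    then have C1: "1 \<le> real C" using B infnorm_pos_le[of y] by (smt (verit) mult_nonneg_nonneg of_nat_0_le_iff)
    \<comment> \<open>The first term gives \<open>k \<delta> / (4 M) \<ge> 1\<close>, so that
      rounding down to \<open>R\<close> at most halves it. The second makes
      \<open>2 * card \<pi> * C * k / R^2\<close> at most 1/4, using
      \<open>R \<ge> k \<delta> / (8 M)\<close>. The last summand gives
      \<open>k > 0\<close>.\<close>
    define k0 where "k0 = nat \<lceil>4 * real M / \<delta> + 512 * real (card \<pi>) * real C * real M ^ 2 / \<delta> ^ 2 + 1\<rceil>"
    have "\<exists>W. finite W \<and> c * (real k ^ (CARD('n) - 1) * (real k * \<delta>) ^ CARD('m)) \<le> real (card W) \<and>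
      (\<forall>(q, p)\<in>W. q \<in> denoms j k \<and> (p, q) \<in> coprime_on_parts \<pi> \<and>
        infnorm (real_vec q v* b - real_vec p - y) \<le> real k * \<delta> / 8)"
      if k: "k \<ge> k0" and b: "infnorm b \<le> B" for k and b :: "real ^ 'm ^ 'n"
    proof -
      have "4 * real M / \<delta> + 512 * real (card \<pi>) * real C * real M ^ 2 / \<delta> ^ 2 + 1 \<le> real k"
        using k unfolding k0_def by linarith
      moreover have "0 \<le> 4 * real M / \<delta>" "0 \<le> 512 * real (card \<pi>) * real C * real M ^ 2 / \<delta> ^ 2" using \<delta> by auto
      ultimately have k1: "1 \<le> real k" and k2: "4 * real M / \<delta> \<le> real k"
        and k3: "512 * real (card \<pi>) * real C * real M ^ 2 / \<delta> ^ 2 \<le> real k" by linarith+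
      have kpos: "0 < k" using k1 by simp
      define K where "K = k div M"
      define x where "x = real k * \<delta> / (4 * real M)"
      define R where "R = nat \<lfloor>x\<rfloor>"
      have x1: "1 \<le> x" using k2 M \<delta> by (simp add: x_def field_simps)
      have "1 \<le> \<lfloor>x\<rfloor>" using x1 by simp
      then have "real R = of_int \<lfloor>x\<rfloor>" "0 < R" by (simp_all add: R_def)
      with \<open>1 \<le> \<lfloor>x\<rfloor>\<close> have R: "real R \<le> x" "x / 2 \<le> real R" "0 < R" by linarith+
      have MR: "real M * real R \<le> real k * \<delta> / 4" using R(1) M by (simp add: x_def field_simps)
      have MK: "M * K \<le> k" by (simp add: K_def)
      have "real k * \<delta> / 4 \<le> real k" using \<delta> mult_left_mono[of \<delta> 1 "real k"] by simp
      then have "real (R * M) \<le> real k" using MR by (simp add: mult.commute)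
      then have "R * M \<le> k" by (simp only: of_nat_le_iff)
      then have RK: "R \<le> K" using M by (simp add: K_def less_eq_div_iff_mult_less_eq)
      have Mk: "real M \<le> real k"
      proof -
        have "real M \<le> real M / \<delta>" using \<delta> M by (simp add: field_simps)
        moreover have "4 * (real M / \<delta>) \<le> real k" using k2 by simp
        ultimately show ?thesis by linarith
      qed
      have K: "real k / (2 * real M) \<le> real K"
      proof -
        have "real k / real M / 2 \<le> of_int \<lfloor>real k / real M\<rfloor>" using Mk M by (intro half_le_floor) simp
        also have "\<dots> = real K" by (simp add: K_def floor_divide_of_nat_eq)
        finally have "real k / real M / 2 \<le> real K" .
        then show ?thesis by simp
      qed
      define \<alpha> where "\<alpha> = (\<lambda>q. real_vec q v* b - y)"
      define a where "a = (\<lambda>q s. \<lceil>(\<alpha> q $ s - real k * \<delta> / 4 / 2 - 1) / real M\<rceil>)"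
      have win: "\<bar>of_int (p $ s) - \<alpha> q $ s\<bar> \<le> real k * \<delta> / 8" if "p \<in> class_nums M (a q) R" for p q s
      proof -
        have "p $ s \<in> progression M (a q s) R" using that by (simp add: class_nums_def)
        from progression_window[OF M MR this[unfolded a_def]] show ?thesis by simp
      qed
      have \<alpha>: "\<bar>\<alpha> q $ s\<bar> \<le> real CARD('n) * real k * B + infnorm y" if "q \<in> class_denoms j k M K" for q s
      proof -
        have "q \<in> denoms j k" using that class_denoms_subset[OF MK M] by blast
        then have "infnorm (real_vec q v* b) \<le> real CARD('n) * real k * infnorm b"
          using kpos by (rule infnorm_denoms_mult_le)
        also have "\<dots> \<le> real CARD('n) * real k * B" using b by (intro mult_left_mono) auto
        finally have "\<bar>(real_vec q v* b) $ s\<bar> \<le> real CARD('n) * real k * B"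
          using component_le_infnorm_cart order_trans by blast
        moreover have "\<bar>y $ s\<bar> \<le> infnorm y" by (rule component_le_infnorm_cart)
        ultimately show ?thesis by (simp add: \<alpha>_def)
      qed
      define W where "W = {(q, p) \<in> Sigma (class_denoms j k M K) (\<lambda>q. class_nums M (a q) R). (p, q) \<in> coprime_on_parts \<pi>}"
      have "real K ^ (CARD('n) - 1) * real R ^ CARD('m) / 2 \<le> real (card W)"
        unfolding W_def
      proof (rule class_pairs_coprime_count[where H="C * k", OF \<pi>[rule_format]])
        show "2 \<le> L" by (simp add: L_def)
        show "M = fact L" "0 < R" "R \<le> K" "M * K \<le> k" by (rule M_def R RK MK)+
        show "k \<le> C * k" using C1 by simp
        show "\<bar>p $ s\<bar> \<le> int (C * k)" if "q \<in> class_denoms j k M K" "p \<in> class_nums M (a q) R" for q p s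
        proof -
          have "\<bar>real_of_int (p $ s)\<bar> \<le> \<bar>\<alpha> q $ s\<bar> + real k * \<delta> / 8" using win[OF that(2), of s] by linarith
          also have "\<dots> \<le> real CARD('n) * real k * B + infnorm y + real k"
            using \<alpha>[OF that(1), of s] \<delta> mult_left_mono[of \<delta> 1 "real k"] by simp
          also have "\<dots> \<le> real CARD('n) * B * real k + infnorm y * real k + real k"
            using mult_left_mono[OF k1, of "infnorm y"] infnorm_pos_le[of y] by (simp add: mult_ac)
          also have "\<dots> = (real CARD('n) * B + infnorm y + 1) * real k" by (simp add: distrib_right)
          also have "\<dots> \<le> real C * real k" using C by (intro mult_right_mono) auto
          finally have "real_of_int \<bar>p $ s\<bar> \<le> real_of_int (int (C * k))" by simp
          then show ?thesis by (simp only: of_int_le_iff)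
        qed
        have "real (card \<pi>) * (2 / real L) \<le> 1 / 4" by (simp add: L_def field_simps)
        moreover have "real (card \<pi>) * (2 * real (C * k) / real R ^ 2) \<le> 1 / 4"
        proof -
          have "x ^ 2 / 4 \<le> real R ^ 2" using power_mono[OF R(2), of 2] x1 by (simp add: power_divide)
          then have "real (card \<pi>) * (2 * real (C * k) / real R ^ 2) \<le> real (card \<pi>) * (2 * real (C * k) / (x ^ 2 / 4))"
            using x1 R by (intro mult_left_mono divide_left_mono) auto
          also have "\<dots> = (512 * real (card \<pi>) * real C * real M ^ 2 / \<delta> ^ 2) / real k / 4"
            using kpos M \<delta> by (simp add: x_def power2_eq_square field_simps)
          also have "\<dots> \<le> real k / real k / 4" by (intro divide_right_mono k3) simp_all
          also have "\<dots> = 1 / 4" using kpos by simp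
          finally show ?thesis .
        qed
        ultimately show "real (card \<pi>) * (2 / real L + 2 * real (C * k) / real R ^ 2) \<le> 1 / 2"
          by (simp add: distrib_left)
      qed
      moreover have "c * (real k ^ (CARD('n) - 1) * (real k * \<delta>) ^ CARD('m)) \<le> real K ^ (CARD('n) - 1) * real R ^ CARD('m) / 2"
      proof -
        have "c * (real k ^ (CARD('n) - 1) * (real k * \<delta>) ^ CARD('m)) =
           (real k / (2 * real M)) ^ (CARD('n) - 1) * (real k * \<delta> / (8 * real M)) ^ CARD('m) / 2"
          by (simp add: c_def power_divide power_mult_distrib)
        also have "\<dots> \<le> real K ^ (CARD('n) - 1) * real R ^ CARD('m) / 2"
          using K R(2) \<delta> by (intro divide_right_mono mult_mono power_mono) (auto simp: x_def)
        finally show ?thesis .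
      qed
      moreover have "finite W"
        unfolding W_def by (rule finite_subset[of _ "Sigma (class_denoms j k M K) (\<lambda>q. class_nums M (a q) R)"])
          (auto simp: finite_class_denoms finite_class_nums)
      moreover have "q \<in> denoms j k \<and> (p, q) \<in> coprime_on_parts \<pi> \<and>
        infnorm (real_vec q v* b - real_vec p - y) \<le> real k * \<delta> / 8" if "(q, p) \<in> W" for q p
      proof -
        have "q \<in> class_denoms j k M K" "p \<in> class_nums M (a q) R" "(p, q) \<in> coprime_on_parts \<pi>"
          using that by (auto simp: W_def)
        moreover have "infnorm (real_vec q v* b - real_vec p - y) \<le> real k * \<delta> / 8"
          unfolding infnorm_le_iff_cart
        proof
          fix s
          show "\<bar>(real_vec q v* b - real_vec p - y) $ s\<bar> \<le> real k * \<delta> / 8"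
            using win[OF \<open>p \<in> class_nums M (a q) R\<close>, of s] by (simp add: \<alpha>_def real_vec_def abs_minus_commute algebra_simps)
        qed
        ultimately show ?thesis using class_denoms_subset[OF MK M] by blast
      qed
      ultimately show ?thesis by (intro exI[of _ W]) auto
    qed
    then show ?thesis by blast
  qed
  then show ?thesis using c by blast
qed

subsection \<open>First moment on small cubes\<close>

lemma linear_axis_matrix: "linear (\<lambda>t :: real ^ 'm. axis j t :: real ^ 'm ^ 'n)"
  by (rule linearI) (simp_all add: axis_def vec_eq_iff)

lemma axis_matrix_measurable [measurable]:
  "(\<lambda>t :: real ^ 'm. axis j t :: real ^ 'm ^ 'n) \<in> borel_measurable borel"
  using linear_axis_matrix[of j]
  by (intro borel_measurable_continuous_onI linear_continuous_on) (simp add: linear_conv_bounded_linear)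

lemma axis_nth_if: "axis j t $ i = (if i = j then t else 0)"
  by (simp add: axis_def)

lemma infnorm_axis_le: "infnorm (axis j t :: real ^ 'm ^ 'n) \<le> infnorm (t :: real ^ 'm)"
  using component_le_infnorm_cart[of t] infnorm_pos_le[of t]
  by (auto simp: infnorm_le_iff Basis_vec_def inner_axis axis_nth_if)

lemma ennreal_le_of_le_mult:
  assumes "ennreal a \<le> ennreal c * I" "0 \<le> a" "0 < c"
  shows "ennreal (a / c) \<le> I"
proof -
  have "ennreal (a / c) = ennreal (1 / c) * ennreal a"
    using assms by (simp flip: ennreal_mult)
  also have "\<dots> \<le> ennreal (1 / c) * (ennreal c * I)" by (intro mult_left_mono assms) simp
  also have "\<dots> = I" using assms by (simp flip: mult.assoc ennreal_mult)
  finally show ?thesis .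
qed

text \<open>Sliding a small cube around \<open>b\<close> along row \<open>j\<close>: every slide that meets the slab keeps the small cube
  inside the large one, while on average over the slides the slab occupies the expected proportion.\<close>

lemma slab_in_cube_ge:
  fixes b :: "real ^ 'm ^ 'n" and y :: "real ^ 'm"
  assumes q: "q \<in> denoms j k" "0 < k" and \<delta>: "0 < \<delta>" and r: "0 \<le> r" "r \<le> real k * \<delta> / 16"
    and near: "infnorm (real_vec q v* b - real_vec p - y) \<le> real k * \<delta> / 8"
  shows "ennreal ((\<delta> / (8 * real CARD('n))) ^ (CARD('n) * CARD('m)) * (4 * r / (real k * \<delta>)) ^ CARD('m)) \<le>
    (\<integral>\<^sup>+x. indicator {..<r} (infnorm (real_vec q v* x - real_vec p - y)) * indicator {..\<delta> / 2} (infnorm (x - b)) \<partial>lborel)"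
    (is "_ \<le> ?I")
proof -
  \<comment> \<open>A displacement of \<open>x\<close> by at most \<open>\<rho>\<close> moves
    \<open>q x\<close> by at most \<open>k \<delta> / 16\<close>; together with
    \<open>k \<delta> / 8\<close> from \<open>near\<close> and the slab radius
    \<open>r \<le> k \<delta> / 16\<close> this gives \<open>k \<delta> / 4\<close>, so the slide is
    at most \<open>\<delta> / 4\<close>.\<close>
  define \<rho> where "\<rho> = \<delta> / (16 * real CARD('n))"
  have \<rho>: "0 < \<rho>" "real CARD('n) * \<rho> = \<delta> / 16" using \<delta> by (simp_all add: \<rho>_def)
  have "1 * \<rho> \<le> real CARD('n) * \<rho>" using \<rho>(1) by (intro mult_right_mono) (auto simp: Suc_le_eq)
  then have \<rho>2: "\<rho> \<le> \<delta> / 16" using \<rho> by simp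
  let ?s = "\<lambda>x :: real ^ 'm ^ 'n. indicator {..<r} (infnorm (real_vec q v* x - real_vec p - y)) :: ennreal"
  let ?C = "\<lambda>x. indicator {..\<rho>} (infnorm (x - b)) :: ennreal"
  have qj: "real_vec q $ j = real k" using denoms_nth[OF q(1)] by (simp add: real_vec_def)
  have slide: "real_vec q v* (x - axis j t) = real_vec q v* x - real k *\<^sub>R t" for x :: "real ^ 'm ^ 'n" and t
    by (simp add: linear_diff[OF linear_vector_matrix_mult] vector_matrix_mult_axis qj)
  have "(\<integral>\<^sup>+t. (\<integral>\<^sup>+x. ?s (x - axis j t) * ?C x \<partial>lborel) \<partial>lborel) = (\<integral>\<^sup>+x. (\<integral>\<^sup>+t. ?s (x - axis j t) * ?C x \<partial>lborel) \<partial>lborel)"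
    by (rule lborel_pair.Fubini') measurable
  also have "\<dots> = (\<integral>\<^sup>+x. ennreal ((2 * r / real k) ^ CARD('m)) * ?C x \<partial>lborel)"
  proof (rule nn_integral_cong)
    fix x :: "real ^ 'm ^ 'n"
    have "(\<integral>\<^sup>+t. ?s (x - axis j t) * ?C x \<partial>lborel) = (\<integral>\<^sup>+t. ?s (x - axis j t) \<partial>lborel) * ?C x"
      by (rule nn_integral_multc) measurable
    also have "(\<integral>\<^sup>+t. ?s (x - axis j t) \<partial>lborel) =
       (\<integral>\<^sup>+t. indicator {..<r} (infnorm (real k *\<^sub>R t - (real_vec q v* x - real_vec p - y))) \<partial>lborel)"
      unfolding slide by (subst infnorm_sub) (simp add: algebra_simps)
    also have "\<dots> = ennreal ((2 * r / real k) ^ CARD('m))"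
      using nn_integral_scaled_infnorm_ball[of r "real k" "real_vec q v* x - real_vec p - y"] r q by simp
    finally show "(\<integral>\<^sup>+t. ?s (x - axis j t) * ?C x \<partial>lborel) = ennreal ((2 * r / real k) ^ CARD('m)) * ?C x" .
  qed
  also have "\<dots> = ennreal ((2 * r / real k) ^ CARD('m)) * emeasure lborel {x. infnorm (x - b) \<le> \<rho>}"
  proof -
    have "(\<integral>\<^sup>+x. ?C x \<partial>lborel) = (\<integral>\<^sup>+x. indicator {x. infnorm (x - b) \<le> \<rho>} x \<partial>lborel)"
      by (intro nn_integral_cong) (auto simp: indicator_def)
    also have "\<dots> = emeasure lborel {x. infnorm (x - b) \<le> \<rho>}"
      by (rule nn_integral_indicator) (simp add: infnorm_cball_eq_cbox)
    finally show ?thesis by (simp add: nn_integral_cmult)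
  qed
  also have "\<dots> = ennreal ((2 * r / real k) ^ CARD('m) * (2 * \<rho>) ^ (CARD('n) * CARD('m)))"
    using \<rho> r by (simp add: emeasure_infnorm_cball ennreal_mult)
  finally have 1: "(\<integral>\<^sup>+t. (\<integral>\<^sup>+x. ?s (x - axis j t) * ?C x \<partial>lborel) \<partial>lborel) =
    ennreal ((2 * r / real k) ^ CARD('m) * (2 * \<rho>) ^ (CARD('n) * CARD('m)))" .
  have "(\<integral>\<^sup>+t. (\<integral>\<^sup>+x. ?s (x - axis j t) * ?C x \<partial>lborel) \<partial>lborel) \<le> (\<integral>\<^sup>+t. ?I * indicator {t :: real ^ 'm. infnorm (t - 0) \<le> \<delta> / 4} t \<partial>lborel)"
  proof (rule nn_integral_mono)
    fix t :: "real ^ 'm"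
    have "(\<integral>\<^sup>+x. ?s (x - axis j t) * ?C x \<partial>lborel) = (\<integral>\<^sup>+x. ?s (x + axis j t - axis j t) * ?C (x + axis j t) \<partial>lborel)"
      by (rule nn_integral_lborel_shift[symmetric]) measurable
    also have "\<dots> \<le> (\<integral>\<^sup>+x. ?s x * indicator {..\<delta> / 2} (infnorm (x - b)) * indicator {t. infnorm (t - 0) \<le> \<delta> / 4} t \<partial>lborel)"
    proof (rule nn_integral_mono)
      fix x :: "real ^ 'm ^ 'n"
      have "infnorm (x - b) \<le> \<delta> / 2 \<and> infnorm t \<le> \<delta> / 4"
        if 1: "infnorm (real_vec q v* x - real_vec p - y) < r" and 2: "infnorm (x + axis j t - b) \<le> \<rho>"
      proof -
        have "real k * infnorm t = infnorm (real k *\<^sub>R t)" by (simp add: infnorm_mul)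
        also have "real k *\<^sub>R t = real_vec q v* (x + axis j t - b) + ((real_vec q v* b - real_vec p - y) - (real_vec q v* x - real_vec p - y))"
          by (simp add: linear_diff[OF linear_vector_matrix_mult] linear_add[OF linear_vector_matrix_mult] vector_matrix_mult_axis qj)
        also have "infnorm \<dots> \<le> infnorm (real_vec q v* (x + axis j t - b)) + infnorm ((real_vec q v* b - real_vec p - y) - (real_vec q v* x - real_vec p - y))"
          by (rule infnorm_triangle)
        also have "infnorm ((real_vec q v* b - real_vec p - y) - (real_vec q v* x - real_vec p - y)) \<le> infnorm (real_vec q v* b - real_vec p - y) + infnorm (real_vec q v* x - real_vec p - y)"
          using infnorm_triangle[of "real_vec q v* b - real_vec p - y" "- (real_vec q v* x - real_vec p - y)"] by (simp only: infnorm_neg diff_conv_add_uminus)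
        also have "infnorm (real_vec q v* (x + axis j t - b)) \<le> real CARD('n) * real k * infnorm (x + axis j t - b)"
          by (rule infnorm_denoms_mult_le[OF q])
        also have "\<dots> \<le> real CARD('n) * real k * \<rho>" using 2 by (intro mult_left_mono) auto
        also have "\<dots> = real k * (\<delta> / 16)" using \<rho>(2) by (metis mult.assoc mult.commute)
        finally have "real k * infnorm t \<le> real k * (\<delta> / 4)" using near 1 r by (simp add: field_simps)
        then have t: "infnorm t \<le> \<delta> / 4" using q(2) by simp
        have "infnorm (x - b) = infnorm ((x + axis j t - b) + - axis j t)" by simp
        also have "\<dots> \<le> infnorm (x + axis j t - b) + infnorm (- axis j t :: real ^ 'm ^ 'n)" by (rule infnorm_triangle)
        also have "\<dots> \<le> \<rho> + infnorm t" using 2 infnorm_axis_le[of j t] by (simp add: infnorm_neg)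
        finally show ?thesis using t \<rho>2 \<delta> by simp
      qed
      then show "?s (x + axis j t - axis j t) * ?C (x + axis j t) \<le>
          ?s x * indicator {..\<delta> / 2} (infnorm (x - b)) * indicator {t. infnorm (t - 0) \<le> \<delta> / 4} t"
        by (auto simp: indicator_def)
    qed
    also have "\<dots> = ?I * indicator {t. infnorm (t - 0) \<le> \<delta> / 4} t"
      by (rule nn_integral_multc) measurable
    finally show "(\<integral>\<^sup>+x. ?s (x - axis j t) * ?C x \<partial>lborel) \<le> ?I * indicator {t. infnorm (t - 0) \<le> \<delta> / 4} t" .
  qed
  also have "\<dots> = ?I * emeasure lborel {t :: real ^ 'm. infnorm (t - 0) \<le> \<delta> / 4}"
    by (rule nn_integral_cmult_indicator) (simp only: infnorm_cball_eq_cbox sets_lborel borel_closed closed_cbox)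
  also have "\<dots> = ennreal ((\<delta> / 2) ^ CARD('m)) * ?I"
    using \<delta> emeasure_infnorm_cball[of "\<delta> / 4" "0 :: real ^ 'm"] by (simp add: mult.commute)
  finally have "ennreal ((2 * r / real k) ^ CARD('m) * (2 * \<rho>) ^ (CARD('n) * CARD('m))) \<le> ennreal ((\<delta> / 2) ^ CARD('m)) * ?I"
    unfolding 1 .
  then have "ennreal ((2 * r / real k) ^ CARD('m) * (2 * \<rho>) ^ (CARD('n) * CARD('m)) / (\<delta> / 2) ^ CARD('m)) \<le> ?I"
    by (rule ennreal_le_of_le_mult) (use r \<rho> \<delta> in auto)
  also have "(2 * r / real k) ^ CARD('m) * (2 * \<rho>) ^ (CARD('n) * CARD('m)) / (\<delta> / 2) ^ CARD('m) =
     (2 * \<rho>) ^ (CARD('n) * CARD('m)) * ((2 * r / real k) / (\<delta> / 2)) ^ CARD('m)"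
    by (simp only: power_divide[of _ "\<delta> / 2"] times_divide_eq_right mult.commute)
  also have "2 * \<rho> = \<delta> / (8 * real CARD('n))" by (simp add: \<rho>_def)
  also have "(2 * r / real k) / (\<delta> / 2) = 4 * r / (real k * \<delta>)" by simp
  finally show ?thesis .
qed

text \<open>In general no longer periodic, since an integer shift of \<open>x\<close> changes
  \<open>p\<close> for fixed \<open>q\<close>. It is bounded below on small cubes, and above by the
  periodic count.\<close>

definition prim_count :: "('m + 'n) set set \<Rightarrow> real ^ 'm \<Rightarrow> real \<Rightarrow> int ^ 'n \<Rightarrow> real ^ 'm ^ 'n \<Rightarrow> ennreal" where
  "prim_count \<pi> y r q x = (\<integral>\<^sup>+p. indicator {..<r} (infnorm (real_vec q v* x - real_vec p - y)) *
      indicator (coprime_on_parts \<pi>) (p, q) \<partial>count_space UNIV)"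

lemma prim_count_measurable [measurable]: "prim_count \<pi> y r q \<in> borel_measurable borel"
  unfolding prim_count_def by (rule borel_measurable_nn_integral_countable) measurable

lemma prim_count_le: "prim_count \<pi> y r q x \<le> approx_count y r q x"
  unfolding prim_count_def approx_count_def near_count_def
  by (intro nn_integral_mono) (auto simp: indicator_def)

lemma sum_le_nn_integral_count_space:
  assumes "finite A"
  shows "(\<Sum>a\<in>A. f a) \<le> (\<integral>\<^sup>+a. f a \<partial>count_space UNIV)"
proof -
  have "(\<Sum>a\<in>A. f a) = (\<integral>\<^sup>+a. f a \<partial>count_space A)" using assms by (simp add: nn_integral_count_space_finite)
  also have "\<dots> = (\<integral>\<^sup>+a. f a * indicator A a \<partial>count_space UNIV)"
    by (rule nn_integral_count_space_indicator) simp
  also have "\<dots> \<le> (\<integral>\<^sup>+a. f a \<partial>count_space UNIV)"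
    by (intro nn_integral_mono) (auto simp: indicator_def)
  finally show ?thesis .
qed

text \<open>Each coprime point near the centre contributes a slab of volume about
  \<open>\<delta>^(n m) (r / (k \<delta>))^m\<close>, and there are about
  \<open>k^(n - 1) (k \<delta>)^m\<close> of them, so the powers of \<open>k \<delta>\<close>
  cancel. Relative to the volume \<open>\<delta>^(n m)\<close> of the cube, the constant is the same
  for all cubes.\<close>

lemma first_moment:
  fixes j :: "'n::finite" and y :: "real ^ 'm" and \<pi> :: "('m + 'n) set set"
  assumes \<pi>: "\<forall>A\<in>\<pi>. card (A - {Inr j}) \<ge> 2"
  shows "\<exists>c>0. \<forall>\<delta> B. 0 < \<delta> \<longrightarrow> \<delta> \<le> 1 \<longrightarrow> 0 \<le> B \<longrightarrow> (\<exists>k0. \<forall>k\<ge>k0. \<forall>b :: real ^ 'm ^ 'n. infnorm b \<le> B \<longrightarrow>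
    (\<forall>r. 0 \<le> r \<longrightarrow> r \<le> 1 \<longrightarrow> ennreal (c * \<delta> ^ (CARD('n) * CARD('m)) * (real k ^ (CARD('n) - 1) * r ^ CARD('m))) \<le>
      (\<integral>\<^sup>+x. (\<Sum>q\<in>denoms j k. prim_count \<pi> y r q x) * indicator {..\<delta> / 2} (infnorm (x - b)) \<partial>lborel)))"
proof -
  obtain c0 where c0: "c0 > 0" and count: "\<forall>\<delta> B. 0 < \<delta> \<longrightarrow> \<delta> \<le> 1 \<longrightarrow> 0 \<le> B \<longrightarrow> (\<exists>k0. \<forall>k\<ge>k0. \<forall>b :: real ^ 'm ^ 'n. infnorm b \<le> B \<longrightarrow>
    (\<exists>W. finite W \<and> c0 * (real k ^ (CARD('n) - 1) * (real k * \<delta>) ^ CARD('m)) \<le> real (card W) \<and>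
      (\<forall>(q, p)\<in>W. q \<in> denoms j k \<and> (p, q) \<in> coprime_on_parts \<pi> \<and>
        infnorm (real_vec q v* b - real_vec p - y) \<le> real k * \<delta> / 8)))"
    using primitive_count[where y=y, OF \<pi>] by (elim exE conjE) (rule that)
  define d where "d = CARD('n) * CARD('m)"
  define c where "c = c0 * 4 ^ CARD('m) / (8 * real CARD('n)) ^ d"
  have c: "c > 0" using c0 by (simp add: c_def)
  have "\<exists>k0. \<forall>k\<ge>k0. \<forall>b :: real ^ 'm ^ 'n. infnorm b \<le> B \<longrightarrow>
    (\<forall>r. 0 \<le> r \<longrightarrow> r \<le> 1 \<longrightarrow> ennreal (c * \<delta> ^ d * (real k ^ (CARD('n) - 1) * r ^ CARD('m))) \<le>
      (\<integral>\<^sup>+x. (\<Sum>q\<in>denoms j k. prim_count \<pi> y r q x) * indicator {..\<delta> / 2} (infnorm (x - b)) \<partial>lborel))"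
    if \<delta>: "0 < \<delta>" "\<delta> \<le> 1" and B: "0 \<le> B" for \<delta> B
  proof -
    obtain k1 where k1: "\<forall>k\<ge>k1. \<forall>b :: real ^ 'm ^ 'n. infnorm b \<le> B \<longrightarrow>
     (\<exists>W. finite W \<and> c0 * (real k ^ (CARD('n) - 1) * (real k * \<delta>) ^ CARD('m)) \<le> real (card W) \<and>
      (\<forall>(q, p)\<in>W. q \<in> denoms j k \<and> (p, q) \<in> coprime_on_parts \<pi> \<and>
        infnorm (real_vec q v* b - real_vec p - y) \<le> real k * \<delta> / 8))"
      using count[rule_format, OF \<delta> B] by (elim exE) (rule that)
    \<comment> \<open>Beyond \<open>16 / \<delta>\<close> every radius \<open>r \<le> 1\<close>
      satisfies \<open>r \<le> k \<delta> / 16\<close>, as the slab estimate demands.\<close>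
    define k0 where "k0 = max k1 (nat \<lceil>16 / \<delta>\<rceil> + 1)"
    have "ennreal (c * \<delta> ^ d * (real k ^ (CARD('n) - 1) * r ^ CARD('m))) \<le>
      (\<integral>\<^sup>+x. (\<Sum>q\<in>denoms j k. prim_count \<pi> y r q x) * indicator {..\<delta> / 2} (infnorm (x - b)) \<partial>lborel)"
      if k: "k0 \<le> k" and b: "infnorm b \<le> B" and r: "0 \<le> r" "r \<le> 1" for k r and b :: "real ^ 'm ^ 'n"
    proof -
      have kpos: "0 < k" and "16 / \<delta> \<le> real k" using k unfolding k0_def by linarith+
      then have k\<delta>: "1 \<le> real k * \<delta> / 16" using \<delta> by (simp add: field_simps)
      obtain W where W: "finite W" "c0 * (real k ^ (CARD('n) - 1) * (real k * \<delta>) ^ CARD('m)) \<le> real (card W)"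
        "\<And>q p. (q, p) \<in> W \<Longrightarrow> q \<in> denoms j k \<and> (p, q) \<in> coprime_on_parts \<pi> \<and>
        infnorm (real_vec q v* b - real_vec p - y) \<le> real k * \<delta> / 8"
        using k1[rule_format, of k b] k b unfolding k0_def by fastforce
      let ?s = "\<lambda>q p (x :: real ^ 'm ^ 'n). indicator {..<r} (infnorm (real_vec q v* x - real_vec p - y)) :: ennreal"
      let ?C = "\<lambda>x. indicator {..\<delta> / 2} (infnorm (x - b)) :: ennreal"
      define v where "v = (\<delta> / (8 * real CARD('n))) ^ d * (4 * r / (real k * \<delta>)) ^ CARD('m)"
      have v: "v \<ge> 0" using \<delta> r by (simp add: v_def)
      have "c * \<delta> ^ d * (real k ^ (CARD('n) - 1) * r ^ CARD('m)) =
         c0 * (real k ^ (CARD('n) - 1) * (real k * \<delta>) ^ CARD('m)) * v"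
        using kpos \<delta> by (simp add: c_def v_def power_divide power_mult_distrib)
      also have "\<dots> \<le> real (card W) * v" by (rule mult_right_mono[OF W(2) v])
      finally have "ennreal (c * \<delta> ^ d * (real k ^ (CARD('n) - 1) * r ^ CARD('m))) \<le> ennreal (real (card W) * v)"
        by (rule ennreal_leI)
      also have "\<dots> = (\<Sum>a\<in>W. ennreal v)" using v by (simp add: ennreal_mult flip: ennreal_of_nat_eq_real_of_nat)
      also have "\<dots> \<le> (\<Sum>a\<in>W. \<integral>\<^sup>+x. ?s (fst a) (snd a) x * ?C x \<partial>lborel)"
        unfolding v_def d_def
      proof (rule sum_mono)
        fix a assume "a \<in> W"
        then have "(fst a, snd a) \<in> W" by simp
        from W(3)[OF this] show "ennreal ((\<delta> / (8 * real CARD('n))) ^ (CARD('n) * CARD('m)) * (4 * r / (real k * \<delta>)) ^ CARD('m)) \<le>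
            (\<integral>\<^sup>+x. ?s (fst a) (snd a) x * ?C x \<partial>lborel)"
          using kpos \<delta> r k\<delta> by (intro slab_in_cube_ge) auto
      qed
      also have "\<dots> = (\<integral>\<^sup>+x. (\<Sum>a\<in>W. ?s (fst a) (snd a) x) * ?C x \<partial>lborel)"
        by (simp add: nn_integral_sum sum_distrib_right)
      also have "\<dots> \<le> (\<integral>\<^sup>+x. (\<Sum>q\<in>denoms j k. prim_count \<pi> y r q x) * ?C x \<partial>lborel)"
      proof (intro nn_integral_mono mult_right_mono)
        fix x :: "real ^ 'm ^ 'n"
        define W' where "W' = (\<lambda>q. {p. (q, p) \<in> W})"
        have fW': "finite (W' q)" for q
          using finite_vimageI[OF W(1), of "Pair q"] by (simp add: W'_def vimage_def inj_on_def)
        have "W = Sigma (denoms j k) W'" using W(3) by (auto simp: W'_def)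
        then have "(\<Sum>a\<in>W. ?s (fst a) (snd a) x) = (\<Sum>q\<in>denoms j k. \<Sum>p\<in>W' q. ?s q p x)"
          by (simp add: sum_Sigma_pair finite_denoms fW')
        also have "\<dots> \<le> (\<Sum>q\<in>denoms j k. prim_count \<pi> y r q x)"
        proof (rule sum_mono)
          fix q
          have "(\<Sum>p\<in>W' q. ?s q p x) = (\<Sum>p\<in>W' q. ?s q p x * indicator (coprime_on_parts \<pi>) (p, q))"
            using W(3) by (intro sum.cong) (auto simp: W'_def)
          also have "\<dots> \<le> prim_count \<pi> y r q x"
            unfolding prim_count_def by (rule sum_le_nn_integral_count_space[OF fW'])
          finally show "(\<Sum>p\<in>W' q. ?s q p x) \<le> prim_count \<pi> y r q x" .
        qed
        finally show "(\<Sum>a\<in>W. ?s (fst a) (snd a) x) \<le> (\<Sum>q\<in>denoms j k. prim_count \<pi> y r q x)" .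
      qed simp
      finally show ?thesis .
    qed
    then show ?thesis by blast
  qed
  then show ?thesis using c unfolding d_def by blast
qed

subsection \<open>Divergence and convergence\<close>

lemma max_norm_denoms:
  assumes "q \<in> denoms j k" "0 < k"
  shows "max_norm q = k"
  unfolding max_norm_def
proof (rule Max_eqI)
  fix a assume "a \<in> range (\<lambda>i. nat \<bar>q $ i\<bar>)"
  then obtain i where "a = nat \<bar>q $ i\<bar>" by auto
  then show "a \<le> k" using denoms_bounds[OF assms, of i] by auto
next
  show "k \<in> range (\<lambda>i. nat \<bar>q $ i\<bar>)"
    using denoms_nth[OF assms(1)] by (intro range_eqI[of _ _ j]) simp
qed simp

text \<open>The inequality \<open>2 t F \<le> F^2 + t^2\<close> divided by \<open>2 t\<close>.
  Integrated over a set it takes the place of the Cauchy-Schwarz inequality: the second moment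
  enters with weight \<open>1 / (2 t)\<close> and the measure of the set with weight
  \<open>t / 2\<close>.\<close>

lemma ennreal_le_square_add:
  fixes F :: ennreal
  assumes "0 < t"
  shows "F \<le> ennreal (1 / (2 * t)) * F ^ 2 + ennreal (t / 2)"
proof (cases F rule: ennreal_cases)
  case (real f)
  have "0 \<le> (f - t) ^ 2 / (2 * t)" using assms by simp
  also have "\<dots> = 1 / (2 * t) * f ^ 2 + t / 2 - f" using assms by (simp add: power2_eq_square field_simps)
  finally have "f \<le> 1 / (2 * t) * f ^ 2 + t / 2" by simp
  then have "ennreal f \<le> ennreal (1 / (2 * t) * f ^ 2 + t / 2)" by (rule ennreal_leI)
  moreover have "ennreal (1 / (2 * t)) * F ^ 2 = ennreal (1 / (2 * t) * f ^ 2)"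
    using real assms by (simp add: ennreal_power flip: ennreal_mult)
  ultimately show ?thesis using real assms by simp
next
  case top
  then show ?thesis using assms by (simp add: power2_eq_square ennreal_mult_top)
qed

text \<open>The local bound is integrated over all centres \<open>x\<close> in \<open>K\<close>;
  after exchanging the integrals, a point \<open>w\<close> of \<open>U\<close> is met by centres of
  total volume at most \<open>\<delta> ^ DIM('a)\<close>. This averaging does the work of a covering
  of \<open>K\<close> by disjoint cubes.\<close>

lemma local_average_le:
  fixes f :: "'a::euclidean_space \<Rightarrow> ennreal"
  assumes [measurable]: "f \<in> borel_measurable borel" "K \<in> sets borel" "U \<in> sets borel"
    and \<delta>: "0 \<le> \<delta>" and U: "\<And>x w. x \<in> K \<Longrightarrow> infnorm (w - x) \<le> \<delta> / 2 \<Longrightarrow> w \<in> U"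
    and v: "\<And>x. x \<in> K \<Longrightarrow> v \<le> (\<integral>\<^sup>+w. f w * indicator {..\<delta> / 2} (infnorm (w - x)) \<partial>lborel)"
  shows "v * emeasure lborel K \<le> ennreal (\<delta> ^ DIM('a)) * (\<integral>\<^sup>+w. f w * indicator U w \<partial>lborel)"
proof -
  let ?C = "\<lambda>w x. indicator {..\<delta> / 2} (infnorm (w - x)) :: ennreal"
  have "v * emeasure lborel K = (\<integral>\<^sup>+x. v * indicator K x \<partial>lborel)"
    by (simp add: nn_integral_cmult_indicator)
  also have "\<dots> \<le> (\<integral>\<^sup>+x. (\<integral>\<^sup>+w. f w * ?C w x \<partial>lborel) * indicator K x \<partial>lborel)"
  proof (rule nn_integral_mono)
    fix x
    show "v * indicator K x \<le> (\<integral>\<^sup>+w. f w * ?C w x \<partial>lborel) * indicator K x"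
      by (cases "x \<in> K") (simp_all add: v)
  qed
  also have "\<dots> = (\<integral>\<^sup>+x. (\<integral>\<^sup>+w. f w * ?C w x * indicator K x \<partial>lborel) \<partial>lborel)"
    by (simp add: nn_integral_multc)
  also have "\<dots> \<le> (\<integral>\<^sup>+x. (\<integral>\<^sup>+w. f w * indicator U w * ?C w x \<partial>lborel) \<partial>lborel)"
    by (intro nn_integral_mono) (auto simp: indicator_def dest: U)
  also have "\<dots> = (\<integral>\<^sup>+w. (\<integral>\<^sup>+x. f w * indicator U w * ?C w x \<partial>lborel) \<partial>lborel)"
    by (rule lborel_pair.Fubini') measurable
  also have "\<dots> = (\<integral>\<^sup>+w. (f w * indicator U w) * ennreal (\<delta> ^ DIM('a)) \<partial>lborel)"
  proof (rule nn_integral_cong)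
    fix w :: 'a
    have "(\<integral>\<^sup>+x. ?C w x \<partial>lborel) = (\<integral>\<^sup>+x. indicator {x. infnorm (x - w) \<le> \<delta> / 2} x \<partial>lborel)"
      by (intro nn_integral_cong) (auto simp: indicator_def infnorm_sub)
    also have "\<dots> = emeasure lborel {x. infnorm (x - w) \<le> \<delta> / 2}"
      by (rule nn_integral_indicator) (simp add: infnorm_cball_eq_cbox)
    also have "\<dots> = ennreal ((2 * (\<delta> / 2)) ^ DIM('a))" using \<delta> by (intro emeasure_infnorm_cball) simp
    also have "\<dots> = ennreal (\<delta> ^ DIM('a))" by simp
    finally show "(\<integral>\<^sup>+x. f w * indicator U w * ?C w x \<partial>lborel) = (f w * indicator U w) * ennreal (\<delta> ^ DIM('a))"
      by (simp add: nn_integral_cmult)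
  qed
  also have "\<dots> = ennreal (\<delta> ^ DIM('a)) * (\<integral>\<^sup>+w. f w * indicator U w \<partial>lborel)"
    by (subst nn_integral_multc) (simp_all add: mult.commute)
  finally show ?thesis .
qed

text \<open>A point with only finitely many solutions lies in this set for all large
  \<open>N\<close>. A bound on the norm is a closed condition on \<open>x\<close>, one weak
  inequality for each coprime point, so bounded closed pieces of the set are compact.\<close>

definition unsolvable_from ::
  "('m + 'n) set set \<Rightarrow> real ^ 'm \<Rightarrow> (nat \<Rightarrow> real) \<Rightarrow> nat \<Rightarrow> (real ^ 'm ^ 'n) set" where
  "unsolvable_from \<pi> y \<psi> N = {x. \<forall>(p, q)\<in>solutions \<pi> y \<psi> x. max_norm q < N}"

lemma closed_unsolvable_from: "closed (unsolvable_from \<pi> y \<psi> N :: (real ^ 'm ^ 'n) set)"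
proof -
  have "(unsolvable_from \<pi> y \<psi> N :: (real ^ 'm ^ 'n) set) =
    (\<Inter>(p, q)\<in>{(p, q) \<in> coprime_on_parts \<pi>. N \<le> max_norm q}. {x. \<psi> (max_norm q) \<le> infnorm (real_vec q v* x - real_vec p - y)})"
    by (auto simp: unsolvable_from_def solutions_def not_less[symmetric])
  also have "closed \<dots>"
  proof (rule closed_INT, clarify)
    fix p :: "int ^ 'm" and q :: "int ^ 'n"
    have "continuous_on UNIV (\<lambda>x :: real ^ 'm ^ 'n. real_vec q v* x)"
      using linear_vector_matrix_mult[of "real_vec q"] by (intro linear_continuous_on) (simp add: linear_conv_bounded_linear)
    then show "closed {x. \<psi> (max_norm q) \<le> infnorm (real_vec q v* x - real_vec p - y)}"
      by (intro closed_Collect_le continuous_intros)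
  qed
  finally show ?thesis .
qed

lemma prim_count_unsolvable:
  assumes "x \<in> unsolvable_from \<pi> y \<psi> N" "q \<in> denoms j k" "0 < k" "N \<le> k"
  shows "prim_count \<pi> y (\<psi> k) q x = 0"
proof -
  have "indicator {..<\<psi> k} (infnorm (real_vec q v* x - real_vec p - y)) * indicator (coprime_on_parts \<pi>) (p, q) = (0 :: ennreal)" for p
    using assms max_norm_denoms[OF assms(2,3)]
    by (auto simp: unsolvable_from_def solutions_def indicator_def not_less[symmetric])
  then show ?thesis unfolding prim_count_def by (simp only: nn_integral_const mult_zero_left)
qed

lemma infnorm_half_ball_subset_cube:
  fixes a :: "'a::euclidean_space"
  assumes "infnorm (x - a) < 1 / 2"
  shows "x - (a - (1 / 2) *\<^sub>R One) \<in> unit_cube"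
proof -
  have "0 \<le> (x - (a - (1 / 2) *\<^sub>R One)) \<bullet> b \<and> (x - (a - (1 / 2) *\<^sub>R One)) \<bullet> b < 1" if b: "b \<in> Basis" for b
  proof -
    have "\<bar>(x - a) \<bullet> b\<bar> < 1 / 2" using assms b by (simp only: infnorm_less_iff)
    moreover have "(x - (a - (1 / 2) *\<^sub>R One)) \<bullet> b = (x - a) \<bullet> b + 1 / 2"
      using b by (simp add: inner_diff_left)
    ultimately show ?thesis by linarith
  qed
  then show ?thesis by (simp add: unit_cube_def)
qed

lemma nn_integral_shifted_cube:
  fixes f :: "'a::euclidean_space \<Rightarrow> ennreal"
  assumes [measurable]: "f \<in> borel_measurable borel"
  shows "(\<integral>\<^sup>+x. f x * indicator unit_cube (x - w) \<partial>lborel) = (\<integral>\<^sup>+x. f (x + w) * indicator unit_cube x \<partial>lborel)"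
  using nn_integral_lborel_shift[of "\<lambda>x. f x * indicator unit_cube (x - w)" w] by simp

text \<open>On a neighbourhood \<open>U\<close> of the compact piece \<open>K\<close> the coprime
  counts up to \<open>N\<close> have mass at least \<open>c * \<kappa> * (S N - S k0)\<close>. At
  most the constant \<open>A\<close> of it lies on \<open>K\<close>, and at most a quarter of
  \<open>c * \<kappa> * S N\<close> plus a constant on \<open>U - K\<close>, so the partial sums
  stay bounded. The radius 1/4 leaves room for \<open>U\<close> inside one translate of the unit
  cube, over which the second moment is known.\<close>

lemma unsolvable_local_null:
  fixes y :: "real ^ 'm" and \<pi> :: "('m + 'n::finite) set set" and a :: "real ^ 'm ^ 'n"
  assumes \<pi>: "\<forall>A\<in>\<pi>. card (A - {Inr j}) \<ge> 2" and nm: "CARD('n) + CARD('m) \<ge> 4"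
    and \<psi>: "\<And>k. 0 \<le> \<psi> k" "\<And>k. \<psi> k \<le> 1"
    and div: "\<not> summable (\<lambda>k. real (Suc k) ^ (CARD('n) - 1) * \<psi> (Suc k) ^ CARD('m))"
  shows "emeasure lborel (unsolvable_from \<pi> y \<psi> K0 \<inter> {x. infnorm (x - a) \<le> 1 / 4}) = 0"
proof (rule ccontr)
  define K where "K = unsolvable_from \<pi> y \<psi> K0 \<inter> {x. infnorm (x - a) \<le> 1 / 4}"
  assume "\<not> ?thesis"
  then have K0: "emeasure lborel K \<noteq> 0" by (simp add: K_def)
  have cK: "compact K" unfolding K_def infnorm_cball_eq_cbox
    by (intro closed_Int_compact closed_unsolvable_from compact_cbox)
  then have [measurable]: "K \<in> sets borel" by (simp add: borel_compact)
  have "emeasure lborel K \<noteq> \<infinity>" using emeasure_compact_finite[OF cK] by simp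
  then obtain \<kappa> where \<kappa>: "emeasure lborel K = ennreal \<kappa>" "0 < \<kappa>"
    using K0 by (cases "emeasure lborel K" rule: ennreal_cases) (auto simp: less_le)
  define d where "d = CARD('n) * CARD('m)"
  define g where "g = (\<lambda>k. real k ^ (CARD('n) - 1) * \<psi> k ^ CARD('m))"
  have g: "0 \<le> g k" for k using \<psi> by (simp add: g_def)
  define S where "S = (\<lambda>N. \<Sum>k=1..N. g k)"
  obtain c where c: "0 < c" and fm: "\<forall>\<delta> B. 0 < \<delta> \<longrightarrow> \<delta> \<le> 1 \<longrightarrow> 0 \<le> B \<longrightarrow> (\<exists>k0. \<forall>k\<ge>k0. \<forall>b :: real ^ 'm ^ 'n. infnorm b \<le> B \<longrightarrow>
    (\<forall>r. 0 \<le> r \<longrightarrow> r \<le> 1 \<longrightarrow> ennreal (c * \<delta> ^ (CARD('n) * CARD('m)) * (real k ^ (CARD('n) - 1) * r ^ CARD('m))) \<le>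
      (\<integral>\<^sup>+x. (\<Sum>q\<in>denoms j k. prim_count \<pi> y r q x) * indicator {..\<delta> / 2} (infnorm (x - b)) \<partial>lborel)))"
    using first_moment[where y=y, OF \<pi>] by (elim exE conjE) (rule that)
  define C1 C2 where "C1 = (8 :: real) ^ CARD('m)" and "C2 = 4 * (4 :: real) ^ CARD('m)"
  have C: "0 < C1" "0 < C2" by (auto simp: C1_def C2_def)
  \<comment> \<open>\<open>\<mu>\<close> and the later \<open>\<epsilon>\<close> balance the two
    terms of the square estimate at \<open>t = \<mu> * S N\<close>: up to a bounded remainder each
    becomes \<open>c * \<kappa> / 8 * S N\<close>.\<close>
  define \<mu> where "\<mu> = 4 * C1 / (c * \<kappa>)"
  have \<mu>: "0 < \<mu>" using C c \<kappa> by (simp add: \<mu>_def)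
  define \<epsilon> where "\<epsilon> = c * \<kappa> / (4 * \<mu>)"
  have \<epsilon>: "0 < \<epsilon>" using c \<kappa> \<mu> by (simp add: \<epsilon>_def)
  \<comment> \<open>Outer regularity. \<open>\<epsilon>\<close> is already fixed, from constants
    that do not involve the cube size \<open>\<delta>\<close>, and \<open>\<delta>\<close> is fitted
    to this open set afterwards.\<close>
  obtain T where T: "open T" "K \<subseteq> T" "T - K \<in> lmeasurable" "emeasure lebesgue (T - K) < ennreal \<epsilon>"
    using sets_lebesgue_outer_open[of K \<epsilon>] \<epsilon> by auto
  define U where "U = T \<inter> {x. infnorm (x - a) < 1 / 2}"
  have oU: "open U" unfolding U_def infnorm_ball_eq_box using T(1) by (intro open_Int open_box)
  then have [measurable]: "U \<in> sets borel" by simp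
  have KU: "K \<subseteq> U" using T(2) by (auto simp: U_def K_def)
  have Ueps: "emeasure lborel (U - K) \<le> ennreal \<epsilon>"
  proof -
    have "emeasure lborel (U - K) = emeasure lebesgue (U - K)" by simp
    also have "\<dots> \<le> emeasure lebesgue (T - K)"
      by (rule emeasure_mono) (use T(3) in \<open>auto simp: U_def\<close>)
    finally show ?thesis using T(4) by simp
  qed
  obtain e where e: "0 < e" "(\<Union>x\<in>K. ball x e) \<subseteq> U"
    using compact_subset_open_imp_ball_epsilon_subset[OF cK oU KU] by metis
  \<comment> \<open>Compactness provides Euclidean balls, whereas the cubes are max-norm balls;
    \<open>D\<close> is the constant comparing the two norms.\<close>
  define D where "D = sqrt (real DIM(real ^ 'm ^ 'n))"
  have D: "0 \<le> D" by (simp add: D_def)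
  define \<delta> where "\<delta> = min 1 (e / (D + 1))"
  have \<delta>: "0 < \<delta>" "\<delta> \<le> 1" using e D by (auto simp: \<delta>_def)
  have nbhd: "w \<in> U" if "x \<in> K" "infnorm (w - x) \<le> \<delta> / 2" for x w
  proof -
    have "norm (w - x) \<le> D * infnorm (w - x)" unfolding D_def by (rule norm_le_infnorm)
    also have "\<dots> \<le> D * (\<delta> / 2)" using that D by (intro mult_left_mono) auto
    also have "\<dots> \<le> D * (e / (D + 1) / 2)" using D by (intro mult_left_mono divide_right_mono) (auto simp: \<delta>_def)
    also have "\<dots> < e" using e D by (simp add: field_simps add_pos_nonneg add_nonneg_pos)
    finally have "w \<in> ball x e" by (simp add: dist_norm norm_minus_commute)
    then show ?thesis using e that by blast
  qed
  have B0: "0 \<le> infnorm a + 1" using infnorm_pos_le[of a] by simp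
  obtain k0 where k0: "\<forall>k\<ge>k0. \<forall>b :: real ^ 'm ^ 'n. infnorm b \<le> infnorm a + 1 \<longrightarrow>
    (\<forall>r. 0 \<le> r \<longrightarrow> r \<le> 1 \<longrightarrow> ennreal (c * \<delta> ^ (CARD('n) * CARD('m)) * (real k ^ (CARD('n) - 1) * r ^ CARD('m))) \<le>
      (\<integral>\<^sup>+x. (\<Sum>q\<in>denoms j k. prim_count \<pi> y r q x) * indicator {..\<delta> / 2} (infnorm (x - b)) \<partial>lborel))"
    using fm[rule_format, OF \<delta> B0] by (elim exE) (rule that)
  have Kb: "infnorm x \<le> infnorm a + 1" if "x \<in> K" for x
  proof -
    have "infnorm x \<le> infnorm (x - a) + infnorm a" using infnorm_triangle[of "x - a" a] by simp
    then show ?thesis using that by (simp add: K_def)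
  qed
  define w0 where "w0 = a - (1 / 2) *\<^sub>R One"
  have Uc: "x - w0 \<in> unit_cube" if "x \<in> U" for x
    using that infnorm_half_ball_subset_cube[of x a] by (simp add: U_def w0_def)
  define f where "f = (\<lambda>k x. \<Sum>q\<in>denoms j k. prim_count \<pi> y (\<psi> k) q x)"
  have [measurable]: "f k \<in> borel_measurable borel" for k unfolding f_def by measurable
  define F where "F = (\<lambda>N x. \<Sum>k=1..N. f k x)"
  have [measurable]: "F N \<in> borel_measurable borel" for N unfolding F_def by measurable
  \<comment> \<open>On \<open>K\<close> all terms with \<open>k \<ge> K0\<close> vanish, so the full
    torus integrals of the earlier ones bound the mass there for every \<open>N\<close>.\<close>
  define A where "A = (\<Sum>k=1..K0. \<Sum>q\<in>denoms j k. (2 * \<psi> k) ^ CARD('m))"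
  have A: "0 \<le> A" using \<psi> by (auto simp: A_def intro!: sum_nonneg)

  have lower: "ennreal (c * \<kappa> * (S N - S k0)) \<le> (\<integral>\<^sup>+x. F N x * indicator U x \<partial>lborel)" for N
  proof (cases "k0 \<le> N")
    case True
    have Sdiff: "S N - S k0 = (\<Sum>k\<in>{k0<..N}. g k)"
    proof -
      have "{1..N} = {1..k0} \<union> {k0<..N}" using True by auto
      then have "S N = S k0 + (\<Sum>k\<in>{k0<..N}. g k)" unfolding S_def by (subst sum.union_disjoint[symmetric]) auto
      then show ?thesis by simp
    qed
    have "ennreal (c * \<delta> ^ d * (S N - S k0)) * emeasure lborel K \<le> ennreal (\<delta> ^ DIM(real ^ 'm ^ 'n)) * (\<integral>\<^sup>+x. F N x * indicator U x \<partial>lborel)"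
    proof (rule local_average_le)
      fix x assume x: "x \<in> K"
      have "ennreal (c * \<delta> ^ d * (S N - S k0)) = (\<Sum>k\<in>{k0<..N}. ennreal (c * \<delta> ^ d * g k))"
        using c \<delta> g by (simp add: Sdiff sum_distrib_left)
      also have "\<dots> \<le> (\<Sum>k\<in>{k0<..N}. \<integral>\<^sup>+w. f k w * indicator {..\<delta> / 2} (infnorm (w - x)) \<partial>lborel)"
        unfolding f_def g_def d_def
        by (intro sum_mono k0[rule_format]) (use Kb[OF x] \<psi> in auto)
      also have "\<dots> = (\<integral>\<^sup>+w. (\<Sum>k\<in>{k0<..N}. f k w) * indicator {..\<delta> / 2} (infnorm (w - x)) \<partial>lborel)"
        unfolding sum_distrib_right by (rule nn_integral_sum[symmetric]) measurable
      also have "\<dots> \<le> (\<integral>\<^sup>+w. F N w * indicator {..\<delta> / 2} (infnorm (w - x)) \<partial>lborel)"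
        unfolding F_def by (intro nn_integral_mono mult_right_mono sum_mono2) auto
      finally show "ennreal (c * \<delta> ^ d * (S N - S k0)) \<le> (\<integral>\<^sup>+w. F N w * indicator {..\<delta> / 2} (infnorm (w - x)) \<partial>lborel)" .
    qed (use \<delta> nbhd in auto)
    moreover have "ennreal (c * \<delta> ^ d * (S N - S k0)) * emeasure lborel K = ennreal (c * \<kappa> * (S N - S k0) * \<delta> ^ d)"
      using c \<delta> \<kappa> by (simp add: \<kappa>(1) mult_ac flip: ennreal_mult')
    moreover have "DIM(real ^ 'm ^ 'n) = d" by (simp add: d_def)
    ultimately have "ennreal (c * \<kappa> * (S N - S k0) * \<delta> ^ d) \<le> ennreal (\<delta> ^ d) * (\<integral>\<^sup>+x. F N x * indicator U x \<partial>lborel)"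
      by simp
    moreover have "0 \<le> S N - S k0" unfolding Sdiff using g by (intro sum_nonneg)
    \<comment> \<open>The factor \<open>\<delta> ^ d\<close> of the local first moment cancels
      against the one from averaging, so the lower bound no longer depends on
      \<open>\<delta>\<close> except through \<open>k0\<close>.\<close>
    ultimately have "ennreal (c * \<kappa> * (S N - S k0) * \<delta> ^ d / \<delta> ^ d) \<le> (\<integral>\<^sup>+x. F N x * indicator U x \<partial>lborel)"
      using c \<kappa> \<delta> by (intro ennreal_le_of_le_mult) auto
    then show ?thesis using \<delta> by simp
  next
    case False
    then have "S N \<le> S k0" unfolding S_def using g by (intro sum_mono2) auto
    then have "c * \<kappa> * (S N - S k0) \<le> 0" using c \<kappa> by (simp add: mult_nonneg_nonpos)
    then show ?thesis by (simp add: ennreal_neg)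
  qed

  have onK: "(\<integral>\<^sup>+x. F N x * indicator K x \<partial>lborel) \<le> ennreal A" for N
  proof -
    have "F N x * indicator K x \<le> (\<Sum>k=1..K0. \<Sum>q\<in>denoms j k. approx_count y (\<psi> k) q x * indicator unit_cube (x - w0))" for x
    proof (cases "x \<in> K")
      case True
      then have E: "x \<in> unsolvable_from \<pi> y \<psi> K0" "x - w0 \<in> unit_cube" using Uc KU by (auto simp: K_def)
      have "F N x = (\<Sum>k\<in>{1..N} \<inter> {1..K0}. f k x)"
        unfolding F_def
      proof (rule sum.mono_neutral_right)
        show "\<forall>k\<in>{1..N} - {1..N} \<inter> {1..K0}. f k x = 0"
          unfolding f_def using E(1) by (auto intro!: sum.neutral prim_count_unsolvable)
      qed auto
      also have "\<dots> \<le> (\<Sum>k=1..K0. f k x)" by (rule sum_mono2) auto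
      also have "\<dots> \<le> (\<Sum>k=1..K0. \<Sum>q\<in>denoms j k. approx_count y (\<psi> k) q x)"
        unfolding f_def by (intro sum_mono prim_count_le)
      finally show ?thesis using True E(2) by simp
    qed simp
    then have "(\<integral>\<^sup>+x. F N x * indicator K x \<partial>lborel) \<le> (\<integral>\<^sup>+x. (\<Sum>k=1..K0. \<Sum>q\<in>denoms j k. approx_count y (\<psi> k) q x * indicator unit_cube (x - w0)) \<partial>lborel)"
      by (rule nn_integral_mono)
    also have "\<dots> = (\<Sum>k=1..K0. \<Sum>q\<in>denoms j k. \<integral>\<^sup>+x. approx_count y (\<psi> k) q x * indicator unit_cube (x - w0) \<partial>lborel)"
      by (simp add: nn_integral_sum)
    also have "\<dots> = (\<Sum>k=1..K0. \<Sum>q\<in>denoms j k. ennreal ((2 * \<psi> k) ^ CARD('m)))"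
    proof (intro sum.cong refl)
      fix k q assume "k \<in> {1..K0}" "q \<in> denoms j k"
      then have "q $ j \<noteq> 0" using denoms_nth[of q j k] by auto
      then show "(\<integral>\<^sup>+x. approx_count y (\<psi> k) q x * indicator unit_cube (x - w0) \<partial>lborel) = ennreal ((2 * \<psi> k) ^ CARD('m))"
        by (simp add: nn_integral_shifted_cube nn_integral_periodic_shift periodic_approx_count nn_integral_approx_count \<psi>)
    qed
    also have "\<dots> = ennreal A" unfolding A_def using \<psi> by (simp add: sum_nonneg del: sum_constant)
    finally show ?thesis .
  qed

  have offK: "(\<integral>\<^sup>+x. F N x * indicator (U - K) x \<partial>lborel) \<le> ennreal (c * \<kappa> / 4 * S N + C2 / (2 * \<mu>))" if S: "0 < S N" for N
  proof -
    define t where "t = \<mu> * S N"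
    have t: "0 < t" using S \<mu> by (simp add: t_def)
    have "(\<integral>\<^sup>+x. F N x * indicator (U - K) x \<partial>lborel) \<le>
      (\<integral>\<^sup>+x. ennreal (1 / (2 * t)) * (F N x ^ 2 * indicator unit_cube (x - w0)) + ennreal (t / 2) * indicator (U - K) x \<partial>lborel)"
    proof (rule nn_integral_mono)
      fix x
      show "F N x * indicator (U - K) x \<le> ennreal (1 / (2 * t)) * (F N x ^ 2 * indicator unit_cube (x - w0)) + ennreal (t / 2) * indicator (U - K) x"
        using ennreal_le_square_add[OF t, of "F N x"] Uc[of x] by (cases "x \<in> U - K") auto
    qed
    also have "\<dots> = ennreal (1 / (2 * t)) * (\<integral>\<^sup>+x. F N x ^ 2 * indicator unit_cube (x - w0) \<partial>lborel) + ennreal (t / 2) * emeasure lborel (U - K)"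
      by (simp add: nn_integral_add nn_integral_cmult)
    also have "\<dots> \<le> ennreal (1 / (2 * t)) * ennreal (C1 * S N ^ 2 + C2 * S N) + ennreal (t / 2) * ennreal \<epsilon>"
    proof (intro add_mono mult_left_mono Ueps)
      have "(\<integral>\<^sup>+x. F N x ^ 2 * indicator unit_cube (x - w0) \<partial>lborel) \<le>
        (\<integral>\<^sup>+x. (\<Sum>k=1..N. \<Sum>q\<in>denoms j k. approx_count y (\<psi> k) q x) ^ 2 * indicator unit_cube (x - w0) \<partial>lborel)"
        unfolding F_def f_def by (intro nn_integral_mono mult_right_mono power_mono sum_mono prim_count_le) auto
      also have "\<dots> = (\<integral>\<^sup>+x. (\<Sum>k=1..N. \<Sum>q\<in>denoms j k. approx_count y (\<psi> k) q (x + w0)) ^ 2 * indicator unit_cube x \<partial>lborel)"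
        by (rule nn_integral_shifted_cube) measurable
      also have "\<dots> \<le> ennreal (C1 * S N ^ 2 + C2 * S N)"
        unfolding C1_def C2_def S_def g_def by (rule second_moment[OF \<psi>(1) nm])
      finally show "(\<integral>\<^sup>+x. F N x ^ 2 * indicator unit_cube (x - w0) \<partial>lborel) \<le> ennreal (C1 * S N ^ 2 + C2 * S N)" .
    qed auto
    also have "\<dots> = ennreal (1 / (2 * t) * (C1 * S N ^ 2 + C2 * S N) + t / 2 * \<epsilon>)"
      using t C S \<epsilon> by (simp flip: ennreal_mult ennreal_plus)
    also have "1 / (2 * t) * (C1 * S N ^ 2 + C2 * S N) = c * \<kappa> / 8 * S N + C2 / (2 * \<mu>)"
    proof -
      have "1 / (2 * t) * (C1 * S N ^ 2 + C2 * S N) = C1 / (2 * \<mu>) * S N + C2 / (2 * \<mu>)"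
        using S \<mu> by (simp add: t_def field_simps power2_eq_square)
      also have "C1 / (2 * \<mu>) = c * \<kappa> / 8" using C c \<kappa> by (simp add: \<mu>_def field_simps)
      finally show ?thesis .
    qed
    also have "t / 2 * \<epsilon> = c * \<kappa> / 8 * S N" using \<mu> by (simp add: t_def \<epsilon>_def)
    also have "c * \<kappa> / 8 * S N + C2 / (2 * \<mu>) + c * \<kappa> / 8 * S N = c * \<kappa> / 4 * S N + C2 / (2 * \<mu>)" by simp
    finally show ?thesis .
  qed

  define Bd where "Bd = (c * \<kappa> * S k0 + A + C2 / (2 * \<mu>)) * (4 / (3 * (c * \<kappa>)))"
  \<comment> \<open>The estimate off \<open>K\<close> needs \<open>t = \<mu> * S N\<close> to be
    positive; \<open>max 0\<close> takes care of the other case.\<close>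
  have bound: "S N \<le> max 0 Bd" for N
  proof (cases "0 < S N")
    case True
    have "ennreal (c * \<kappa> * (S N - S k0)) \<le> (\<integral>\<^sup>+x. F N x * indicator U x \<partial>lborel)" by (rule lower)
    also have "\<dots> = (\<integral>\<^sup>+x. F N x * indicator K x + F N x * indicator (U - K) x \<partial>lborel)"
      by (intro nn_integral_cong) (use KU in \<open>auto simp: indicator_def\<close>)
    also have "\<dots> = (\<integral>\<^sup>+x. F N x * indicator K x \<partial>lborel) + (\<integral>\<^sup>+x. F N x * indicator (U - K) x \<partial>lborel)"
      by (rule nn_integral_add) measurable
    also have "\<dots> \<le> ennreal A + ennreal (c * \<kappa> / 4 * S N + C2 / (2 * \<mu>))"
      by (intro add_mono onK offK True)
    also have "\<dots> = ennreal (A + (c * \<kappa> / 4 * S N + C2 / (2 * \<mu>)))"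
      using A True c \<kappa> C \<mu> by (subst ennreal_plus[symmetric]) auto
    finally have "c * \<kappa> * (S N - S k0) \<le> A + (c * \<kappa> / 4 * S N + C2 / (2 * \<mu>))"
      using A True c \<kappa> C \<mu> by (subst (asm) ennreal_le_iff) auto
    then have "c * \<kappa> * S N - c * \<kappa> * S k0 \<le> A + (c * \<kappa> * S N / 4 + C2 / (2 * \<mu>))"
      by (simp only: right_diff_distrib times_divide_eq_left)
    moreover have "z - z' \<le> A + (z / 4 + h) \<Longrightarrow> 3 / 4 * z \<le> z' + A + h" for z z' h by simp
    ultimately have "3 / 4 * (c * \<kappa> * S N) \<le> c * \<kappa> * S k0 + A + C2 / (2 * \<mu>)" by blast
    then have "3 / 4 * (c * \<kappa>) * S N \<le> c * \<kappa> * S k0 + A + C2 / (2 * \<mu>)" by (simp only: mult.assoc)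
    then have "3 / 4 * (c * \<kappa>) * S N * (4 / (3 * (c * \<kappa>))) \<le> Bd"
      unfolding Bd_def using c \<kappa> by (intro mult_right_mono) auto
    moreover have "3 / 4 * (c * \<kappa>) * S N * (4 / (3 * (c * \<kappa>))) = S N" using c \<kappa> by simp
    ultimately show ?thesis by simp
  qed simp
  have "summable (\<lambda>k. g (Suc k))"
  proof (rule summableI_nonneg_bounded)
    show "(\<Sum>k<N. g (Suc k)) \<le> max 0 Bd" for N
      using bound[of N] by (simp add: S_def sum.atLeast1_atMost_eq)
  qed (rule g)
  then show False using div by (simp add: g_def)
qed

lemma AE_infinite_solutions:
  fixes y :: "real ^ 'm" and \<pi> :: "('m + 'n::finite) set set"
  assumes \<pi>: "\<forall>A\<in>\<pi>. card (A - {Inr j}) \<ge> 2" and nm: "CARD('n) + CARD('m) \<ge> 4"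
    and \<psi>: "\<And>k. 0 \<le> \<psi> k"
    and div: "\<not> summable (\<lambda>k. real (Suc k) ^ (CARD('n) - 1) * \<psi> (Suc k) ^ CARD('m))"
  shows "AE x :: real ^ 'm ^ 'n in lebesgue. infinite (solutions \<pi> y \<psi> x)"
proof -
  \<comment> \<open>Truncation at 1 puts the radii into the range of the first moment bound.
    Divergence survives: if the truncated series converged, its terms would tend to 0, forcing
    \<open>\<phi> < 1\<close> and hence \<open>\<phi> = \<psi>\<close> from some index on.\<close>
  define \<phi> where "\<phi> = (\<lambda>k. min (\<psi> k) 1)"
  have \<phi>: "0 \<le> \<phi> k" "\<phi> k \<le> 1" "\<phi> k \<le> \<psi> k" for k using \<psi>[of k] by (auto simp: \<phi>_def)
  have div': "\<not> summable (\<lambda>k. real (Suc k) ^ (CARD('n) - 1) * \<phi> (Suc k) ^ CARD('m))"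
  proof
    assume sm: "summable (\<lambda>k. real (Suc k) ^ (CARD('n) - 1) * \<phi> (Suc k) ^ CARD('m))"
    then have "(\<lambda>k. real (Suc k) ^ (CARD('n) - 1) * \<phi> (Suc k) ^ CARD('m)) \<longlonglongrightarrow> 0" by (rule summable_LIMSEQ_zero)
    then have "eventually (\<lambda>k. real (Suc k) ^ (CARD('n) - 1) * \<phi> (Suc k) ^ CARD('m) < 1) sequentially"
      by (rule order_tendstoD) simp
    then have "eventually (\<lambda>k. real (Suc k) ^ (CARD('n) - 1) * \<phi> (Suc k) ^ CARD('m) =
        real (Suc k) ^ (CARD('n) - 1) * \<psi> (Suc k) ^ CARD('m)) sequentially"
    proof eventually_elim
      case (elim k)
      have "\<phi> (Suc k) \<noteq> 1"
      proof
        assume "\<phi> (Suc k) = 1"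
        then have "real (Suc k) ^ (CARD('n) - 1) < 1" using elim by simp
        moreover have "1 \<le> real (Suc k) ^ (CARD('n) - 1)" by (rule one_le_power) simp
        ultimately show False by linarith
      qed
      then have "\<phi> (Suc k) = \<psi> (Suc k)" by (auto simp: \<phi>_def min_def split: if_splits)
      then show ?case by simp
    qed
    then have "summable (\<lambda>k. real (Suc k) ^ (CARD('n) - 1) * \<psi> (Suc k) ^ CARD('m))"
      by (rule iffD1[OF summable_cong sm])
    then show False using div by contradiction
  qed
  let ?E = "\<lambda>N. unsolvable_from \<pi> y \<phi> N :: (real ^ 'm ^ 'n) set"
  \<comment> \<open>Negligibility is a local property, and the null set statement holds around an
    arbitrary centre; the open ball serves as the relatively open neighbourhood inside the closed
    one.\<close>
  have neg: "negligible (?E N)" for N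
  proof (subst locally_negligible_alt, clarify)
    fix a assume a: "a \<in> ?E N"
    let ?U = "?E N \<inter> {x. infnorm (x - a) < 1 / 4}"
    have "openin (top_of_set (?E N)) ?U"
      unfolding infnorm_ball_eq_box by (rule openin_open_Int) (rule open_box)
    moreover have "a \<in> ?U" using a by (simp add: infnorm_0)
    moreover have "negligible ?U"
    proof (rule negligible_subset)
      have "closed (?E N \<inter> {x. infnorm (x - a) \<le> 1 / 4})"
        unfolding infnorm_cball_eq_cbox by (intro closed_Int closed_unsolvable_from closed_cbox)
      then have "?E N \<inter> {x. infnorm (x - a) \<le> 1 / 4} \<in> null_sets lborel"
        using unsolvable_local_null[OF \<pi> nm \<phi>(1,2) div', where a=a and ?K0.0=N and y=y] by (auto intro: null_setsI)
      then show "negligible (?E N \<inter> {x. infnorm (x - a) \<le> 1 / 4})"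
        by (simp add: negligible_iff_null_sets null_sets_completionI)
    qed auto
    ultimately show "\<exists>U. openin (top_of_set (?E N)) U \<and> a \<in> U \<and> negligible U" by blast
  qed
  have "negligible (\<Union>N. ?E N)" by (rule negligible_countable_Union) (use neg in auto)
  then have "AE x in lebesgue. x \<notin> (\<Union>N. ?E N)"
    by (intro AE_not_in) (simp add: negligible_iff_null_sets)
  then show ?thesis
  proof eventually_elim
    case (elim x)
    show ?case
    proof
      assume fin: "finite (solutions \<pi> y \<psi> x)"
      have sub: "solutions \<pi> y \<phi> x \<subseteq> solutions \<pi> y \<psi> x"
        using \<phi>(3) by (auto simp: solutions_def intro: order.strict_trans2)
      \<comment> \<open>One more than a sum that dominates every max norm occurring in a
        solution.\<close>
      define N where "N = Suc (\<Sum>(p, q)\<in>solutions \<pi> y \<psi> x. max_norm q)"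
      have "max_norm q < N" if "(p, q) \<in> solutions \<pi> y \<phi> x" for p q
      proof -
        have "max_norm q \<le> (\<Sum>(p, q)\<in>solutions \<pi> y \<psi> x. max_norm q)"
          using member_le_sum[of "(p, q)" "solutions \<pi> y \<psi> x" "\<lambda>(p, q). max_norm q"] that sub fin by auto
        then show ?thesis by (simp add: N_def)
      qed
      then have "x \<in> ?E N" by (auto simp: unsolvable_from_def)
      then show False using elim by blast
    qed
  qed
qed

section \<open>The convergence half\<close>

lemma abs_le_max_norm: "\<bar>q $ i\<bar> \<le> int (max_norm q)"
proof -
  have "nat \<bar>q $ i\<bar> \<le> max_norm q" unfolding max_norm_def by (rule Max_ge) auto
  then show ?thesis by simp
qed

lemma max_norm_attained: "\<exists>i. \<bar>q $ i\<bar> = int (max_norm q)"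
proof -
  have "max_norm q \<in> range (\<lambda>i. nat \<bar>q $ i\<bar>)" unfolding max_norm_def by (rule Max_in) auto
  then show ?thesis by auto
qed

text \<open>Some entry is \<open>k + 1\<close> or its negative, so the sphere is covered by n pairs
  of opposite faces. The factor 3 absorbs \<open>2 (k + 1) + 1\<close>.\<close>

lemma card_max_norm_sphere_le:
  "finite {q :: int ^ 'n. max_norm q = Suc k}"
  "real (card {q :: int ^ 'n. max_norm q = Suc k}) \<le> real CARD('n) * 2 * 3 ^ (CARD('n) - 1) * real (Suc k) ^ (CARD('n) - 1)"
proof -
  let ?c = "int (Suc k)"
  let ?F = "\<lambda>i :: 'n. {q :: int ^ 'n. \<forall>i'. q $ i' \<in> (if i' = i then {- ?c, ?c} else {- ?c..?c})}"
  have sub: "{q :: int ^ 'n. max_norm q = Suc k} \<subseteq> (\<Union>i. ?F i)"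
  proof
    fix q :: "int ^ 'n" assume q: "q \<in> {q. max_norm q = Suc k}"
    obtain i where i: "\<bar>q $ i\<bar> = ?c" using max_norm_attained[of q] q by auto
    have "q $ i' \<in> {- ?c..?c}" for i' using abs_le_max_norm[of q i'] q by (auto simp: abs_le_iff)
    moreover have "q $ i \<in> {- ?c, ?c}" using i by auto
    ultimately have "q \<in> ?F i" by auto
    then show "q \<in> (\<Union>i. ?F i)" by blast
  qed
  have fin: "finite (?F i)" for i by (rule finite_vec_product) simp
  then show "finite {q :: int ^ 'n. max_norm q = Suc k}" using sub by (auto intro: finite_subset)
  have cF: "card (?F i) = 2 * (2 * Suc k + 1) ^ (CARD('n) - 1)" for i
  proof -
    have "card (?F i) = (\<Prod>i'\<in>UNIV. card (if i' = i then {- ?c, ?c} else {- ?c..?c}))" by (rule card_vec_product)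
    also have "\<dots> = (\<Prod>i'\<in>UNIV. if i' = i then 2 else 2 * Suc k + 1)" by (rule prod.cong) auto
    finally show ?thesis by (simp only: prod_if_eq_power)
  qed
  have "card {q :: int ^ 'n. max_norm q = Suc k} \<le> card (\<Union>i. ?F i)" using sub fin by (intro card_mono) auto
  also have "\<dots> \<le> (\<Sum>i\<in>UNIV. card (?F i))" by (rule card_UN_le) simp
  also have "\<dots> = CARD('n) * (2 * (2 * Suc k + 1) ^ (CARD('n) - 1))" by (simp only: cF sum_constant of_nat_id)
  also have "\<dots> \<le> CARD('n) * (2 * (3 * Suc k) ^ (CARD('n) - 1))" by (intro mult_left_mono power_mono) auto
  finally have "real (card {q :: int ^ 'n. max_norm q = Suc k}) \<le> real (CARD('n) * (2 * (3 * Suc k) ^ (CARD('n) - 1)))"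
    by (rule of_nat_mono)
  also have "\<dots> = real CARD('n) * 2 * 3 ^ (CARD('n) - 1) * real (Suc k) ^ (CARD('n) - 1)"
    by (simp only: of_nat_mult of_nat_power of_nat_numeral power_mult_distrib mult.assoc)
  finally show "real (card {q :: int ^ 'n. max_norm q = Suc k}) \<le> real CARD('n) * 2 * 3 ^ (CARD('n) - 1) * real (Suc k) ^ (CARD('n) - 1)" .
qed

text \<open>Borel-Cantelli in integrated form: \<open>H\<close> counts all approximating pairs with
  \<open>q \<noteq> 0\<close>, coprime or not. Its integral over one period is dominated by the
  series, so \<open>H\<close> is finite almost everywhere, and a finite sum of natural numbers has
  only finitely many nonzero terms.\<close>

lemma AE_finite_solutions:
  fixes y :: "real ^ 'm" and \<pi> :: "('m + 'n::finite) set set"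
  assumes \<psi>: "\<And>k. 0 \<le> \<psi> k"
    and conv: "summable (\<lambda>k. real (Suc k) ^ (CARD('n) - 1) * \<psi> (Suc k) ^ CARD('m))"
  shows "AE x :: real ^ 'm ^ 'n in lebesgue. finite (solutions \<pi> y \<psi> x)"
proof -
  let ?S = "\<lambda>k. {q :: int ^ 'n. max_norm q = Suc k}"
  define G where "G = (\<lambda>k (x :: real ^ 'm ^ 'n). \<Sum>q\<in>?S k. approx_count y (\<psi> (Suc k)) q x)"
  have [measurable]: "G k \<in> borel_measurable borel" for k unfolding G_def by measurable
  define H where "H = (\<lambda>x. \<Sum>k. G k x)"
  have [measurable]: "H \<in> borel_measurable borel" unfolding H_def by measurable
  have "lattice_periodic H"
    by (simp add: lattice_periodic_def H_def G_def periodic_approx_count[unfolded lattice_periodic_def, rule_format])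
  define C where "C = real CARD('n) * 2 * 3 ^ (CARD('n) - 1) * 2 ^ CARD('m)"
  have "(\<integral>\<^sup>+x. H x * indicator unit_cube x \<partial>lborel) = (\<integral>\<^sup>+x. (\<Sum>k. G k x * indicator unit_cube x) \<partial>lborel)"
    by (simp add: H_def)
  also have "\<dots> = (\<Sum>k. \<integral>\<^sup>+x. G k x * indicator unit_cube x \<partial>lborel)"
    by (rule nn_integral_suminf) measurable
  also have "\<dots> \<le> (\<Sum>k. ennreal (C * (real (Suc k) ^ (CARD('n) - 1) * \<psi> (Suc k) ^ CARD('m))))"
  proof (rule suminf_le)
    fix k
    have "(\<integral>\<^sup>+x. G k x * indicator unit_cube x \<partial>lborel) = (\<Sum>q\<in>?S k. \<integral>\<^sup>+x. approx_count y (\<psi> (Suc k)) q x * indicator unit_cube x \<partial>lborel)"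
      unfolding G_def sum_distrib_right by (rule nn_integral_sum) measurable
    also have "\<dots> = (\<Sum>q\<in>?S k. ennreal ((2 * \<psi> (Suc k)) ^ CARD('m)))"
    proof (rule sum.cong[OF refl])
      fix q assume "q \<in> ?S k"
      then obtain i where "q $ i \<noteq> 0" using max_norm_attained[of q] by force
      then show "(\<integral>\<^sup>+x. approx_count y (\<psi> (Suc k)) q x * indicator unit_cube x \<partial>lborel) = ennreal ((2 * \<psi> (Suc k)) ^ CARD('m))"
        by (rule nn_integral_approx_count) (rule \<psi>)
    qed
    also have "\<dots> = ennreal (real (card (?S k)) * (2 * \<psi> (Suc k)) ^ CARD('m))"
      using \<psi> by (simp add: ennreal_mult ennreal_of_nat_eq_real_of_nat)
    also have "\<dots> \<le> ennreal (real CARD('n) * 2 * 3 ^ (CARD('n) - 1) * real (Suc k) ^ (CARD('n) - 1) * (2 * \<psi> (Suc k)) ^ CARD('m))"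
      using \<psi> by (intro ennreal_leI mult_right_mono card_max_norm_sphere_le) auto
    also have "real CARD('n) * 2 * 3 ^ (CARD('n) - 1) * real (Suc k) ^ (CARD('n) - 1) * (2 * \<psi> (Suc k)) ^ CARD('m) =
        C * (real (Suc k) ^ (CARD('n) - 1) * \<psi> (Suc k) ^ CARD('m))"
      by (simp only: C_def power_mult_distrib mult_ac)
    finally show "(\<integral>\<^sup>+x. G k x * indicator unit_cube x \<partial>lborel) \<le> ennreal (C * (real (Suc k) ^ (CARD('n) - 1) * \<psi> (Suc k) ^ CARD('m)))" .
  qed auto
  also have "\<dots> < \<infinity>"
  proof -
    have "(\<Sum>k. ennreal (C * (real (Suc k) ^ (CARD('n) - 1) * \<psi> (Suc k) ^ CARD('m)))) \<noteq> top"
      using \<psi> by (intro ennreal_suminf_neq_top summable_mult conv) (auto simp: C_def)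
    then show ?thesis by (simp add: less_top)
  qed
  finally have fin: "(\<integral>\<^sup>+x. H x * indicator unit_cube x \<partial>lborel) < \<infinity>" .
  \<comment> \<open>Finiteness of the integral concerns a single unit cube; periodicity gives it for
    each translate, and countably many integer translates cover the space.\<close>
  have "AE x in lborel. x - w \<in> unit_cube \<longrightarrow> H x \<noteq> \<infinity>" for w
  proof -
    have "(\<integral>\<^sup>+x. H x * indicator unit_cube (x - w) \<partial>lborel) = (\<integral>\<^sup>+x. H x * indicator unit_cube x \<partial>lborel)"
      using nn_integral_shifted_cube[of H w] nn_integral_periodic_shift[of H w] \<open>lattice_periodic H\<close> by simp
    then have "(\<integral>\<^sup>+x. H x * indicator unit_cube (x - w) \<partial>lborel) \<noteq> \<infinity>" using fin by simp
    then have "AE x in lborel. H x * indicator unit_cube (x - w) \<noteq> \<infinity>"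
      by (intro nn_integral_PInf_AE) measurable
    then show ?thesis by eventually_elim (auto simp: indicator_def)
  qed
  then have "AE x in lborel. \<forall>w\<in>int_lattice. x - w \<in> unit_cube \<longrightarrow> H x \<noteq> \<infinity>"
    by (subst AE_ball_countable[OF countable_int_lattice]) blast
  then have "AE x in lborel. H x \<noteq> \<infinity>"
  proof eventually_elim
    case (elim x)
    obtain z where z: "z \<in> int_lattice" "x + z \<in> unit_cube" using ex1_lattice_translate[of x] by blast
    then show ?case using elim[rule_format, of "- z"] int_lattice_uminus[OF z(1)] by simp
  qed
  then have "AE x in lborel. finite (solutions \<pi> y \<psi> x)"
  proof eventually_elim
    case (elim x)
    define near where "near = (\<lambda>q. {p. infnorm (real_vec q v* x - real_vec p - y) < \<psi> (max_norm q)})"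
    have fnear: "finite (near q)" for q unfolding near_def by (rule finite_near)
    define J where "J = {k. G k x \<noteq> 0}"
    have G1: "1 \<le> G k x" if kJ: "k \<in> J" for k
    proof -
      have "G k x = (\<Sum>q\<in>?S k. of_nat (card (near q)))"
        unfolding G_def near_def approx_count_def near_count_eq_card by (rule sum.cong) auto
      then have G': "G k x = of_nat (\<Sum>q\<in>?S k. card (near q))" by simp
      then have "(\<Sum>q\<in>?S k. card (near q)) \<noteq> 0" using kJ by (metis J_def mem_Collect_eq of_nat_0)
      then have "1 \<le> (\<Sum>q\<in>?S k. card (near q))" by simp
      then show ?thesis unfolding G' by (metis of_nat_1 of_nat_mono)
    qed
    have "finite J"
    proof (rule ccontr)
      assume inf: "infinite J"
      have "of_nat N \<le> H x" for N
      proof -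
        obtain J' where J': "J' \<subseteq> J" "finite J'" "card J' = N" using infinite_arbitrarily_large[OF inf] by blast
        have "of_nat N = (\<Sum>k\<in>J'. 1 :: ennreal)" using J' by simp
        also have "\<dots> \<le> (\<Sum>k\<in>J'. G k x)" using J' G1 by (intro sum_mono) auto
        also have "\<dots> \<le> H x" unfolding H_def by (rule sum_le_suminf) (use J' in auto)
        finally show ?thesis .
      qed
      then have "H x = top" by (metis ennreal_of_nat_neq_top ennreal_Ex_less_of_nat less_top not_le)
      then show False using elim by simp
    qed
    \<comment> \<open>The vector \<open>q = 0\<close> is not counted by \<open>H\<close>, since the
      torus integral requires a nonzero entry; it adds one denominator with finitely many
      \<open>p\<close>.\<close>
    have "solutions \<pi> y \<psi> x \<subseteq> (\<lambda>(q, p). (p, q)) ` Sigma ({0} \<union> (\<Union>k\<in>J. ?S k)) near"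
    proof
      fix v assume v: "v \<in> solutions \<pi> y \<psi> x"
      obtain p q where pq: "v = (p, q)" by (cases v)
      have near: "p \<in> near q" using v by (auto simp: pq solutions_def near_def)
      have "q \<in> {0} \<union> (\<Union>k\<in>J. ?S k)"
      proof (cases "max_norm q")
        case 0
        then have "q = 0" using abs_le_max_norm[of q] by (auto simp: vec_eq_iff)
        then show ?thesis by simp
      next
        case (Suc k)
        have "G k x \<noteq> 0"
        proof
          assume "G k x = 0"
          then have "approx_count y (\<psi> (Suc k)) q x = 0"
            using Suc by (simp add: G_def card_max_norm_sphere_le(1))
          then have "card (near q) = 0" by (simp add: approx_count_def near_count_eq_card near_def Suc)
          then show False using near fnear[of q] by auto
        qed
        then show ?thesis using Suc by (auto simp: J_def)
      qed
      then show "v \<in> (\<lambda>(q, p). (p, q)) ` Sigma ({0} \<union> (\<Union>k\<in>J. ?S k)) near"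
        using near by (force simp: pq)
    qed
    moreover have "finite (Sigma ({0} \<union> (\<Union>k\<in>J. ?S k)) near)"
      using \<open>finite J\<close> fnear by (intro finite_SigmaI) (auto simp: card_max_norm_sphere_le(1))
    ultimately show ?case by (meson finite_imageI finite_subset)
  qed
  then show ?thesis by (rule AE_completion)
qed

lemma add_ge_four_of_mult_gt_two:
  fixes n m :: nat
  assumes "n * m > 2"
  shows "n + m \<ge> 4"
proof (rule ccontr)
  assume "\<not> n + m \<ge> 4"
  then have "n = 0 \<or> m = 0 \<or> (n = 1 \<and> m \<le> 2) \<or> (n = 2 \<and> m = 1)" by linarith
  then show False using assms by auto
qed

theorem theorem2p2:
  fixes y :: "real ^ 'm"
    and \<pi> :: "('m + 'n::finite) set set"
    and \<psi> :: "nat \<Rightarrow> real"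
  assumes "CARD('n) * CARD('m) > 2"
    and "partition_on UNIV \<pi>"
    and "\<forall>A\<in>\<pi>. card A \<ge> 2"
    and "\<exists>A\<in>\<pi>. card A \<ge> 3 \<and> A \<inter> range Inr \<noteq> {}"
    and "\<forall>q. \<psi> q \<ge> 0"
  shows "(\<not> summable (\<lambda>k. real (Suc k) ^ (CARD('n) - 1) * \<psi> (Suc k) ^ CARD('m))
            \<longrightarrow> (AE x :: real ^ 'm ^ 'n in lebesgue. infinite (solutions \<pi> y \<psi> x))) \<and>
         (summable (\<lambda>k. real (Suc k) ^ (CARD('n) - 1) * \<psi> (Suc k) ^ CARD('m))
            \<longrightarrow> (AE x :: real ^ 'm ^ 'n in lebesgue. finite (solutions \<pi> y \<psi> x)))"
proof -
  \<comment> \<open>Taking \<open>j\<close> in the part with at least three elements ensures that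
    deleting \<open>Inr j\<close> leaves two coordinates in every part: the other parts are disjoint
    from this one and keep all of theirs.\<close>
  obtain A0 j where A0: "A0 \<in> \<pi>" "card A0 \<ge> 3" "Inr j \<in> A0" using assms(4) by auto
  have "card (A - {Inr j}) \<ge> 2" if A: "A \<in> \<pi>" for A
  proof (cases "A = A0")
    case True
    then show ?thesis using A0 by simp
  next
    case False
    then have "A \<inter> A0 = {}" using partition_onD2[OF assms(2)] A A0(1) by (auto dest: disjointD)
    then have "A - {Inr j} = A" using A0(3) by blast
    then show ?thesis using assms(3) A by simp
  qed
  then have "\<forall>A\<in>\<pi>. card (A - {Inr j}) \<ge> 2" by blast
  then show ?thesis
    using AE_infinite_solutions[of \<pi> j \<psi> y] AE_finite_solutions[of \<psi> \<pi> y]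
      add_ge_four_of_mult_gt_two[OF assms(1)] assms(5) by blast
qed

end
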